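(* Let $\mathbf X,\mathbf Y,\mathbf Z,\mathbf S$ be pairwise disjoint node sets in a causal DAG $\mathcal D$ with $\mathbf Z\cap\mathrm{De}(\mathbf X,\mathcal D)=\emptyset$. If $\mathbf S$ is a conditional adjustment set relative to $(\mathbf X,\mathbf Y,\mathbf Z)$ in $\mathcal D$, then $\mathbf S$ satisfies the conditional adjustment criterion relative to $(\mathbf X,\mathbf Y,\mathbf Z)$ in $\mathcal D$.
   Context: DAG setting. In a DAG $\mathcal D=(\mathbf V,\mathbf E)$, a path is a sequence of distinct nodes with successive nodes adjacent; a path from $\mathbf X$ to $\mathbf Y$ runs from some $X\in\mathbf X$ to some $Y\in\mathbf Y$ and is proper if only its first node is in $\mathbf X$. A path $X\to\cdots\to Y$ is causal; otherwise it is non-causal. A non-endpoint $V_j$ on a path is a collider if $V_{j-1}\to V_j\leftarrow V_{j+1}$, else a non-collider. Descendants $\mathrm{De}$ and ancestors $\mathrm{An}$ include the node itself. A path is d-connecting given $\mathbf Z$ if no non-collider on it is in $\mathbf Z$ and every collider on it has a descendant in $\mathbf Z$; otherwise blocked. Mediators of $\mathbf X,\mathbf Y$: all non-first nodes on proper causal paths from $\mathbf X$ to $\mathbf Y$; $\mathrm{Forb}(\mathbf X,\mathbf Y,\mathcal D)=\mathrm{De}(\text{mediators},\mathcal D)$. Causal semantics. Densities are positive. A family $\{f(\mathbf v\mid do(\mathbf x')):\mathbf X'\subseteq\mathbf V\}$ is compatible with causal $\mathcal D$ if each member equals $\prod_{V_i\in\mathbf V\setminus\mathbf X'}f(v_i\mid\mathrm{pa}(v_i,\mathcal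 D))\mathbb 1(\mathbf X'=\mathbf x')$; an interventional density is consistent with $\mathcal D$ if it belongs to such a family. Conditional adjustment set: $\mathbf S$ is one relative to $(\mathbf X,\mathbf Y,\mathbf Z)$ in $\mathcal D$ if for every density $f$ consistent with $\mathcal D$, $f(\mathbf y\mid do(\mathbf x),\mathbf z)=f(\mathbf y\mid\mathbf x,\mathbf z)$ when $\mathbf S=\emptyset$ and $=\int f(\mathbf y\mid\mathbf x,\mathbf z,\mathbf s)f(\mathbf s\mid\mathbf z)d\mathbf s$ otherwise. Conditional adjustment criterion (in a DAG, with $\mathbf Z\cap\mathrm{De}(\mathbf X,\mathcal D)=\emptyset$): (a) $\mathbf S\cap\mathrm{Forb}(\mathbf X,\mathbf Y,\mathcal D)=\emptyset$ and (b) $\mathbf S\cup\mathbf Z$ blocks all proper non-causal paths from $\mathbf X$ to $\mathbf Y$ in $\mathcal D$. *)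

theory Defs
  imports "HOL-Analysis.Analysis"
begin

definition is_DAG :: "'v set \<Rightarrow> ('v \<times> 'v) set \<Rightarrow> bool" where
  "is_DAG V E \<longleftrightarrow> finite V \<and> E \<subseteq> V \<times> V \<and> acyclic E"

definition pa :: "('v \<times> 'v) set \<Rightarrow> 'v \<Rightarrow> 'v set" where
  "pa E v = {u. (u, v) \<in> E}"

definition De :: "('v \<times> 'v) set \<Rightarrow> 'v set \<Rightarrow> 'v set" where
  "De E A = {w. \<exists>a\<in>A. (a, w) \<in> E\<^sup>*}"

definition adjacent :: "('v \<times> 'v) set \<Rightarrow> 'v \<Rightarrow> 'v \<Rightarrow> bool" where
  "adjacent E a b \<longleftrightarrow> (a, b) \<in> E \<or> (b, a) \<in> E"

definition is_path :: "('v \<times> 'v) set \<Rightarrow> 'v list \<Rightarrow> bool" where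
  "is_path E p \<longleftrightarrow> p \<noteq> [] \<and> distinct p \<and>
     (\<forall>i. Suc i < length p \<longrightarrow> adjacent E (p ! i) (p ! Suc i))"

definition path_from_to :: "('v \<times> 'v) set \<Rightarrow> 'v set \<Rightarrow> 'v set \<Rightarrow> 'v list \<Rightarrow> bool" where
  "path_from_to E X Y p \<longleftrightarrow> is_path E p \<and> hd p \<in> X \<and> last p \<in> Y"

definition proper_path :: "('v \<times> 'v) set \<Rightarrow> 'v set \<Rightarrow> 'v set \<Rightarrow> 'v list \<Rightarrow> bool" where
  "proper_path E X Y p \<longleftrightarrow> path_from_to E X Y p \<and> (\<forall>i. 0 < i \<and> i < length p \<longrightarrow> p ! i \<notin> X)"

definition causal_path :: "('v \<times> 'v) set \<Rightarrow> 'v list \<Rightarrow> bool" where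
  "causal_path E p \<longleftrightarrow> (\<forall>i. Suc i < length p \<longrightarrow> (p ! i, p ! Suc i) \<in> E)"

definition collider :: "('v \<times> 'v) set \<Rightarrow> 'v list \<Rightarrow> nat \<Rightarrow> bool" where
  "collider E p j \<longleftrightarrow> 0 < j \<and> Suc j < length p \<and>
     (p ! (j - 1), p ! j) \<in> E \<and> (p ! Suc j, p ! j) \<in> E"

definition d_connecting :: "('v \<times> 'v) set \<Rightarrow> 'v set \<Rightarrow> 'v list \<Rightarrow> bool" where
  "d_connecting E Z p \<longleftrightarrow>
     (\<forall>j. 0 < j \<and> Suc j < length p \<longrightarrow>
        (if collider E p j then De E {p ! j} \<inter> Z \<noteq> {} else p ! j \<notin> Z))"

definition blocked :: "('v \<times> 'v) set \<Rightarrow> 'v set \<Rightarrow> 'v list \<Rightarrow> bool" where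
  "blocked E Z p \<longleftrightarrow> \<not> d_connecting E Z p"

definition mediators :: "('v \<times> 'v) set \<Rightarrow> 'v set \<Rightarrow> 'v set \<Rightarrow> 'v set" where
  "mediators E X Y = {p ! i | p i. proper_path E X Y p \<and> causal_path E p \<and> 0 < i \<and> i < length p}"

definition Forb :: "('v \<times> 'v) set \<Rightarrow> 'v set \<Rightarrow> 'v set \<Rightarrow> 'v set" where
  "Forb E X Y = De E (mediators E X Y)"

definition cond_adj_criterion ::
  "('v \<times> 'v) set \<Rightarrow> 'v set \<Rightarrow> 'v set \<Rightarrow> 'v set \<Rightarrow> 'v set \<Rightarrow> bool" where
  "cond_adj_criterion E X Y Z S \<longleftrightarrow>
     S \<inter> Forb E X Y = {} \<and>
     (\<forall>p. proper_path E X Y p \<and> \<not> causal_path E p \<longrightarrow> blocked E (S \<union> Z) p)"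

type_synonym 'v cfg = "'v \<Rightarrow> real"

definition cfgM :: "'v set \<Rightarrow> 'v cfg measure" where
  "cfgM A = PiM A (\<lambda>_. lborel)"

definition mrg :: "'v set \<Rightarrow> 'v cfg \<Rightarrow> 'v cfg \<Rightarrow> 'v cfg" where
  "mrg A a c = (\<lambda>v. if v \<in> A then a v else c v)"

text \<open>A family of conditional densities f(v_i | pa(v_i)): kernel k v is a function of the
  values of v and its parents; it is measurable, positive and integrates to 1 in v.\<close>
definition kernel_family :: "'v set \<Rightarrow> ('v \<times> 'v) set \<Rightarrow> ('v \<Rightarrow> 'v cfg \<Rightarrow> real) \<Rightarrow> bool" where
  "kernel_family V E k \<longleftrightarrow>
     (\<forall>v\<in>V. k v \<in> borel_measurable (cfgM (insert v (pa E v))) \<and> (\<forall>c. 0 < k v c) \<and>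
        (\<forall>c. (\<integral>\<^sup>+ t. ennreal (k v (restrict (c(v := t)) (insert v (pa E v)))) \<partial>lborel) = 1))"

text \<open>Truncated factorization f(v | do(a)) = prod over V - A of f(v_i | pa(v_i)), where the
  intervened variables A are set to the values c has on A (this encodes 1(A = a)).
  With A = {} this is the observational density.\<close>
definition fdo :: "'v set \<Rightarrow> ('v \<times> 'v) set \<Rightarrow> ('v \<Rightarrow> 'v cfg \<Rightarrow> real) \<Rightarrow> 'v set \<Rightarrow> 'v cfg \<Rightarrow> real" where
  "fdo V E k A c = (\<Prod>v\<in>V - A. k v (restrict c (insert v (pa E v))))"

definition margdo ::
  "'v set \<Rightarrow> ('v \<times> 'v) set \<Rightarrow> ('v \<Rightarrow> 'v cfg \<Rightarrow> real) \<Rightarrow> 'v set \<Rightarrow> 'v set \<Rightarrow> 'v cfg \<Rightarrow> ennreal" where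
  "margdo V E k A B c =
     (\<integral>\<^sup>+ r. ennreal (fdo V E k A (mrg (V - (A \<union> B)) r c)) \<partial>cfgM (V - (A \<union> B)))"

definition cond_do ::
  "'v set \<Rightarrow> ('v \<times> 'v) set \<Rightarrow> ('v \<Rightarrow> 'v cfg \<Rightarrow> real) \<Rightarrow> 'v set \<Rightarrow> 'v set \<Rightarrow> 'v set \<Rightarrow> 'v cfg \<Rightarrow> ennreal" where
  "cond_do V E k A B C c = margdo V E k A (B \<union> C) c / margdo V E k A C c"

definition cond_adj_set ::
  "'v set \<Rightarrow> ('v \<times> 'v) set \<Rightarrow> 'v set \<Rightarrow> 'v set \<Rightarrow> 'v set \<Rightarrow> 'v set \<Rightarrow> bool" where
  "cond_adj_set V E X Y Z S \<longleftrightarrow>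
     (\<forall>k. kernel_family V E k \<longrightarrow>
        (AE c in cfgM (X \<union> Y \<union> Z).
           cond_do V E k X Y Z c =
           (if S = {} then cond_do V E k {} Y (X \<union> Z) c
            else (\<integral>\<^sup>+ s. cond_do V E k {} Y (X \<union> Z \<union> S) (mrg S s c)
                          * cond_do V E k {} S Z (mrg S s c) \<partial>cfgM S))))"

end

(* Suppose the criterion fails. Real-valued nodes can carry arbitrarily many independent fair sign
   bits, so one may choose kernels that only see bits, each bit b_i having conditional mean mu_i in
   terms of bits of parents; all densities then reduce to finite averages over signs. Take an open
   walk from X to Y that is not directed: non-colliders avoid X, Y, S, Z and colliders lie in X, S
   or Z. Nodes may recur, since every visit uses its own bit, so no shortest path or disjointness
   argument is needed. A non-collider copies its parent's bit with noise and a collider takes the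
   sign of the product of its two neighbours, except that the first and the last collider leave out
   their outer neighbour half of the time. Averaging the hidden bits leaves
     1 + tau (alpha + beta x) (gamma + delta y),   tau = product of the collider bits,
   and setting X by intervention amounts to averaging the X-bits that are sinks; the adjustment
   formula fails for this density. This also handles a node s of S below a mediator m: the walk
   x -> ... -> m -> ... -> s <- ... <- m -> ... -> y visits m twice. What remains are directed
   walks from X through S to Y, or through Y to S or X, which are refuted by a noisy copying chain. *)

theory Submission
  imports Defs
begin

section \<open>Averages over signs\<close>

text \<open>The adjustment formula holds only almost everywhere, so it may not be evaluated at a
  chosen point. But the constructed kernels see a value only through its bits and a positive base
  density, so the formula holds somewhere in the set of positive measure where all bits of X, Y, Z
  are 1. There the base densities cancel and one equation between finite averages remains. The
  obstacle is to make this equation false however the colliders are spread over X, S and Z. The two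
  sides can agree only if a certain product vanishes: beta * delta when all colliders are in Z,
  (alpha + beta) * delta when some are in X and none in S, and (A - D) * (C - D) when some are in S,
  where A and D belong to f(y, x, z, s) and f(x, z, s), and C to f(s, z). Hence the signs of alpha,
  beta, gamma, delta are all that the elimination of hidden bits has to keep track of. On the graph
  side, a d-connecting path may open a collider only through a descendant. The walk then goes down
  to the first visible node and back up the same edges. This breaks down only when that node is in
  Y; then either an open walk has already ended there, or S contains a forbidden node.\<close>

definition avg :: "nat set \<Rightarrow> ((nat \<Rightarrow> real) \<Rightarrow> real) \<Rightarrow> (nat \<Rightarrow> real) \<Rightarrow> real" where
  "avg H F b = (\<Sum>J\<in>Pow H. F (\<lambda>i. if i \<in> H then (if i \<in> J then -1 else 1) else b i)) / 2 ^ card H"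

definition signs :: "(nat \<Rightarrow> real) \<Rightarrow> bool" where
  "signs b \<longleftrightarrow> (\<forall>i. b i = 1 \<or> b i = -1)"

text \<open>Phrased by the irrelevant coordinates rather than by a support, because the usual task
  is to see that averaged bits do not occur in a factor.\<close>

definition ignores :: "nat set \<Rightarrow> ((nat \<Rightarrow> real) \<Rightarrow> 'a) \<Rightarrow> bool" where
  "ignores H F \<longleftrightarrow> (\<forall>b b'. (\<forall>i. i \<notin> H \<longrightarrow> b i = b' i) \<longrightarrow> F b = F b')"

lemma signs_upd: "signs b \<Longrightarrow> signs (b(i := 1))" "signs b \<Longrightarrow> signs (b(i := -1))"
  by (auto simp: signs_def)

lemma signs_override:
  "signs b \<Longrightarrow> signs (\<lambda>i. if i \<in> H then (if i \<in> J then -1 else 1) else b i)"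
  by (auto simp: signs_def)

lemma signs_one: "signs (\<lambda>_. 1)"
  by (auto simp: signs_def)

lemma signs_abs: "signs b \<Longrightarrow> \<bar>b i\<bar> = 1"
  by (auto simp: signs_def dest: spec[of _ i])

lemma ignoresD: "ignores H F \<Longrightarrow> (\<And>i. i \<notin> H \<Longrightarrow> b i = b' i) \<Longrightarrow> F b = F b'"
  unfolding ignores_def by blast

lemma ignoresI: "(\<And>b b'. (\<And>i. i \<notin> H \<Longrightarrow> b i = b' i) \<Longrightarrow> F b = F b') \<Longrightarrow> ignores H F"
  unfolding ignores_def by blast

lemma ignores_mono: "ignores H F \<Longrightarrow> J \<subseteq> H \<Longrightarrow> ignores J F"
  unfolding ignores_def by blast

lemma ignores_const [simp]: "ignores H (\<lambda>_. c)"
  by (simp add: ignores_def)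

lemma ignores_upd: "ignores H F \<Longrightarrow> i \<in> H \<Longrightarrow> F (b(i := t)) = F b"
  by (rule ignoresD) auto

lemma ignores_prod:
  fixes F :: "'i \<Rightarrow> (nat \<Rightarrow> real) \<Rightarrow> real"
  shows "(\<And>i. i \<in> A \<Longrightarrow> ignores H (F i)) \<Longrightarrow> ignores H (\<lambda>b. \<Prod>i\<in>A. F i b)"
  unfolding ignores_def by (metis (no_types, lifting) prod.cong)

lemma avg_empty [simp]: "avg {} F b = F b"
  by (simp add: avg_def)

lemma avg_insert:
  assumes "finite H" "i \<notin> H"
  shows "avg (insert i H) F b = (avg H F (b(i := 1)) + avg H F (b(i := -1))) / 2"
proof -
  let ?o = "\<lambda>H J b i. if i \<in> H then (if i \<in> J then -1 else 1) else (b i :: real)"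
  have inj: "inj_on (insert i) (Pow H)"
    using assms by (auto simp: inj_on_def)
  have 1: "(\<Sum>J\<in>Pow H. F (?o (insert i H) J b)) = (\<Sum>J\<in>Pow H. F (?o H J (b(i := 1))))"
    using assms by (intro sum.cong refl arg_cong[where f = F]) (auto simp: fun_eq_iff)
  have 2: "(\<Sum>J\<in>insert i ` Pow H. F (?o (insert i H) J b)) = (\<Sum>J\<in>Pow H. F (?o H J (b(i := -1))))"
    unfolding sum.reindex[OF inj] o_def
    using assms by (intro sum.cong refl arg_cong[where f = F]) (auto simp: fun_eq_iff)
  have "(\<Sum>J\<in>Pow (insert i H). F (?o (insert i H) J b)) =
      (\<Sum>J\<in>Pow H. F (?o (insert i H) J b)) + (\<Sum>J\<in>insert i ` Pow H. F (?o (insert i H) J b))"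
    unfolding Pow_insert using assms by (intro sum.union_disjoint) auto
  then show ?thesis
    using assms 1 2 by (simp add: avg_def field_simps)
qed

lemma avg_single: "avg {i} F b = (F (b(i := 1)) + F (b(i := -1))) / 2"
  by (simp add: avg_insert)

lemma avg_union:
  assumes "finite A" "finite B" "A \<inter> B = {}"
  shows "avg (A \<union> B) F b = avg A (avg B F) b"
  using assms
proof (induction A arbitrary: b rule: finite_induct)
  case (insert i A)
  then have "finite (A \<union> B)" "i \<notin> A \<union> B" by auto
  then show ?case
    using insert by (simp add: avg_insert)
qed simp

lemma avg_cong:
  assumes "signs b" "\<And>b'. signs b' \<Longrightarrow> (\<And>i. i \<notin> H \<Longrightarrow> b' i = b i) \<Longrightarrow> F b' = G b'"
  shows "avg H F b = avg H G b"
  unfolding avg_def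
  by (rule arg_cong[where f = "\<lambda>x. x / 2 ^ card H"], rule sum.cong)
     (auto intro!: assms(2) signs_override assms(1))

lemma ignores_avg:
  assumes "ignores K F" shows "ignores (H \<union> K) (avg H F)"
proof (rule ignoresI)
  fix b b' :: "nat \<Rightarrow> real" assume *: "\<And>i. i \<notin> H \<union> K \<Longrightarrow> b i = b' i"
  show "avg H F b = avg H F b'"
    unfolding avg_def
    by (rule arg_cong[where f = "\<lambda>x. x / 2 ^ card H"], rule sum.cong)
       (use * in \<open>auto intro!: ignoresD[OF assms]\<close>)
qed

lemma avg_ignores:
  assumes "finite H" "ignores H F"
  shows "avg H F b = F b"
proof -
  have "(\<Sum>J\<in>Pow H. F (\<lambda>i. if i \<in> H then (if i \<in> J then -1 else 1) else b i)) = (\<Sum>J\<in>Pow H. F b)"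
    by (intro sum.cong refl ignoresD[OF assms(2)]) auto
  then show ?thesis
    using assms(1) by (simp add: avg_def card_Pow)
qed

lemma avg_const [simp]: "finite H \<Longrightarrow> avg H (\<lambda>_. c) b = c"
  by (rule avg_ignores) (auto simp: ignores_def)

lemma avg_add: "avg H (\<lambda>b. F b + G b) b = avg H F b + avg H G b"
  by (simp add: avg_def sum.distrib add_divide_distrib)

lemma avg_mult:
  assumes "ignores H C"
  shows "avg H (\<lambda>b. C b * F b) b = C b * avg H F b"
proof -
  let ?o = "\<lambda>J i. if i \<in> H then (if i \<in> J then -1 else 1) else b i"
  have "C (?o J) = C b" for J
    by (rule ignoresD[OF assms]) auto
  then show ?thesis
    by (simp add: avg_def sum_distrib_left)
qed

lemma avg_pos:
  assumes "finite H" "signs b" "\<And>b. signs b \<Longrightarrow> 0 < F b"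
  shows "0 < avg H F b"
  unfolding avg_def using assms
  by (intro divide_pos_pos sum_pos) (auto intro!: assms(3) signs_override)

lemma avg_nonneg:
  assumes "signs b" "\<And>b. signs b \<Longrightarrow> 0 \<le> F b"
  shows "0 \<le> avg H F b"
  unfolding avg_def using assms
  by (intro divide_nonneg_nonneg sum_nonneg) (auto intro!: assms(2) signs_override)

text \<open>\<open>1 + b i * \<mu> i b\<close> is the density, relative to a fair sign, of a sign
  with mean \<open>\<mu> i b\<close>. As no mean in \<open>J\<close> reads a bit of
  \<open>J\<close>, these signs are independent given the rest and each factor averages to
  1.\<close>

lemma avg_prod_one_plus:
  assumes "finite J" "\<And>i. i \<in> J \<Longrightarrow> ignores J (\<mu> i)" "ignores J C"
  shows "avg J (\<lambda>b. C b * (\<Prod>i\<in>J. 1 + b i * \<mu> i b)) b = C b"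
  using assms
proof (induction J arbitrary: b C rule: finite_induct)
  case (insert i J)
  let ?C = "\<lambda>b. C b * (1 + b i * \<mu> i b)"
  have mi: "ignores (insert i J) (\<mu> i)" using insert.prems by auto
  have "avg J (\<lambda>b. ?C b * (\<Prod>i\<in>J. 1 + b i * \<mu> i b)) b = ?C b" for b
  proof (rule insert.IH)
    show "ignores J (\<mu> j)" if "j \<in> J" for j
      using insert.prems(1)[of j] that by (auto intro: ignores_mono)
    show "ignores J ?C"
    proof (rule ignoresI)
      fix b b' :: "nat \<Rightarrow> real" assume *: "\<And>j. j \<notin> J \<Longrightarrow> b j = b' j"
      have "C b = C b'" by (rule ignoresD[OF insert.prems(2)]) (use * in auto)
      moreover have "\<mu> i b = \<mu> i b'" by (rule ignoresD[OF mi]) (use * in auto)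
      ultimately show "?C b = ?C b'" using * insert.hyps by simp
    qed
  qed
  then have "avg J (\<lambda>b. C b * (\<Prod>i\<in>insert i J. 1 + b i * \<mu> i b)) b = ?C b" for b
    using insert.hyps by (simp add: mult.assoc)
  moreover have "C (b(i := t)) = C b" "\<mu> i (b(i := t)) = \<mu> i b" for t
    by (rule ignores_upd[OF insert.prems(2)] ignores_upd[OF mi], simp)+
  ultimately show ?case
    using insert.hyps by (simp add: avg_insert field_simps del: fun_upd_apply) (simp add: algebra_simps)
qed simp

section \<open>Measurability, and sign bits realised by a positive density on the line\<close>

lemma measurable_override:
  "(\<lambda>b i. if i \<in> H then (if i \<in> J then -1 else 1) else b i)
     \<in> measurable (PiM UNIV (\<lambda>_::nat. borel)) (PiM UNIV (\<lambda>_::nat. borel :: real measure))"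
  by (rule measurable_PiM_single') (auto simp: space_PiM)

lemma measurable_avg [measurable]:
  assumes [measurable]: "F \<in> borel_measurable (PiM UNIV (\<lambda>_::nat. borel))"
  shows "avg H F \<in> borel_measurable (PiM UNIV (\<lambda>_::nat. borel))"
proof -
  have "(\<lambda>b. F (\<lambda>i. if i \<in> H then (if i \<in> J then -1 else 1) else b i))
      \<in> borel_measurable (PiM UNIV (\<lambda>_::nat. borel))" for J
    by (rule measurable_compose[OF measurable_override assms])
  then show ?thesis
    unfolding avg_def[abs_def] by simp
qed

text \<open>Cut the line into \<open>N\<close> cells of positive mass under a positive integrable
  function, then rescale it on each cell to mass \<open>1 / N\<close>. The result is positive
  everywhere, as kernels must be, although only the cell number will carry information.\<close>

lemma fair_cells_exist:
  fixes N :: nat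
  assumes "0 < N"
  obtains \<phi> :: "real \<Rightarrow> real" and d :: "real \<Rightarrow> nat"
  where "\<phi> \<in> borel_measurable borel" "\<And>t. 0 < \<phi> t"
    "d \<in> measurable borel (count_space UNIV)" "\<And>t. d t < N"
    "\<And>G. (\<And>k. k < N \<Longrightarrow> 0 \<le> G k) \<Longrightarrow>
       (\<integral>\<^sup>+ t. ennreal (\<phi> t * G (d t)) \<partial>lborel) = ennreal ((\<Sum>k<N. G k) / N)"
proof -
  obtain \<psi> :: "real \<Rightarrow> real" where \<psi>: "\<psi> \<in> borel_measurable lborel" "\<And>t. 0 < \<psi> t" "integrable lborel \<psi>"
    using sigma_finite_measure.obtain_positive_integrable_function[OF sigma_finite_lborel] by (metis borel_measurable_integrable)
  have [measurable]: "\<psi> \<in> borel_measurable borel" using \<psi>(1) by simp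
  \<comment> \<open>Cell \<open>k\<close> consists of the points where the integer part of the
    absolute value is \<open>k\<close>; the last cell absorbs the whole tail.\<close>
  define d where "d t = min (nat \<lfloor>\<bar>t\<bar>\<rfloor>) (N - 1)" for t :: real
  have d_meas [measurable]: "d \<in> measurable borel (count_space UNIV)"
    unfolding d_def[abs_def] by measurable
  have dN: "d t < N" for t using assms by (auto simp: d_def)
  define c where "c k = (\<integral>\<^sup>+ t. ennreal (\<psi> t) * indicator {t. d t = k} t \<partial>lborel)" for k
  have set_meas [measurable]: "{t. d t = k} \<in> sets borel" for k
    by measurable
  have c_fin: "c k < \<infinity>" for k
  proof -
    have "c k \<le> (\<integral>\<^sup>+ t. ennreal (\<psi> t) \<partial>lborel)"
      unfolding c_def by (intro nn_integral_mono) (auto split: split_indicator)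
    also have "\<dots> < \<infinity>"
      using \<psi>(3) nn_integral_eq_integral[OF \<psi>(3)] \<psi>(2) by (simp add: less_imp_le)
    finally show ?thesis .
  qed
  have c_pos: "c k \<noteq> 0" if "k < N" for k
  proof
    assume "c k = 0"
    then have "AE t in lborel. ennreal (\<psi> t) * indicator {t. d t = k} t = 0"
      unfolding c_def by (subst (asm) nn_integral_0_iff_AE) auto
    then have "AE t in lborel. t \<notin> {t. d t = k}"
    proof eventually_elim
      case (elim t)
      then show ?case using \<psi>(2)[of t] by (auto split: split_indicator_asm)
    qed
    then have "AE t in lborel. t \<notin> {real k..<real k + 1}"
    proof eventually_elim
      case (elim t)
      have "t \<in> {real k..<real k + 1} \<Longrightarrow> d t = k"
      proof -
        assume t: "t \<in> {real k..<real k + 1}"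
        then have "\<lfloor>\<bar>t\<bar>\<rfloor> = int k" by (intro floor_unique) auto
        then show "d t = k" using that by (simp add: d_def)
      qed
      with elim show ?case by auto
    qed
    then have "emeasure lborel {real k..<real k + 1} = 0"
      by (subst (asm) AE_iff_null) (auto simp: null_sets_def atLeastLessThan_def atLeast_def lessThan_def Collect_conj_eq)
    then show False by simp
  qed
  define r where "r k = enn2real (c k)" for k
  have r: "c k = ennreal (r k)" "0 \<le> r k" for k
    using c_fin[of k] by (auto simp: r_def)
  have r_pos: "0 < r k" if "k < N" for k
    using c_pos[OF that] r[of k] by (auto simp: less_le)
  define \<phi> where "\<phi> t = \<psi> t / (N * r (d t))" for t
  show thesis
  proof
    have "(\<lambda>t. r (d t)) \<in> borel_measurable borel"
      by (rule measurable_compose[OF d_meas]) simp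
    then show "\<phi> \<in> borel_measurable borel"
      unfolding \<phi>_def[abs_def] by measurable
    show "0 < \<phi> t" for t
      using \<psi>(2)[of t] r_pos[OF dN] assms by (simp add: \<phi>_def)
    show "d \<in> measurable borel (count_space UNIV)" "d t < N" for t by (fact d_meas, fact dN)
    fix G :: "nat \<Rightarrow> real" assume G: "\<And>k. k < N \<Longrightarrow> 0 \<le> G k"
    have "ennreal (\<phi> t * G (d t)) =
        (\<Sum>k<N. ennreal (G k / (N * r k)) * (ennreal (\<psi> t) * indicator {t. d t = k} t))" for t
    proof -
      have "(\<Sum>k<N. ennreal (G k / (N * r k)) * (ennreal (\<psi> t) * indicator {t. d t = k} t))
        = (\<Sum>k<N. if k = d t then ennreal (G k / (N * r k)) * ennreal (\<psi> t) else 0)"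
        by (intro sum.cong) (auto split: split_indicator)
      also have "\<dots> = ennreal (G (d t) / (N * r (d t))) * ennreal (\<psi> t)"
        using dN[of t] by simp
      also have "\<dots> = ennreal (\<phi> t * G (d t))"
        using \<psi>(2)[of t] G[OF dN[of t]] r(2)[of "d t"]
        by (subst ennreal_mult[symmetric]) (auto simp: \<phi>_def field_simps less_imp_le)
      finally show ?thesis ..
    qed
    then have "(\<integral>\<^sup>+ t. ennreal (\<phi> t * G (d t)) \<partial>lborel) = (\<Sum>k<N. ennreal (G k / (N * r k)) * c k)"
      by (simp add: nn_integral_sum nn_integral_cmult c_def)
    also have "\<dots> = (\<Sum>k<N. ennreal (G k / N))"
    proof (intro sum.cong refl)
      fix k assume "k \<in> {..<N}"
      then show "ennreal (G k / (N * r k)) * c k = ennreal (G k / N)"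
        using G[of k] r_pos[of k] unfolding r(1)
        by (subst ennreal_mult[symmetric]) auto
    qed
    also have "\<dots> = ennreal ((\<Sum>k<N. G k) / N)"
      using G by (subst sum_ennreal) (auto simp: sum_divide_distrib)
    finally show "(\<integral>\<^sup>+ t. ennreal (\<phi> t * G (d t)) \<partial>lborel) = ennreal ((\<Sum>k<N. G k) / N)" .
  qed
qed

text \<open>With one equally likely cell per subset of \<open>I\<close>, the subset is read as the
  set of negative signs. The formula allows \<open>J\<close> smaller than \<open>I\<close> because
  one node stores only some of the bits and the other arguments come from other nodes.\<close>

lemma fair_bits_exist:
  fixes I :: "nat set"
  assumes "finite I"
  obtains \<phi> :: "real \<Rightarrow> real" and \<beta> :: "nat \<Rightarrow> real \<Rightarrow> real"
  where "\<phi> \<in> borel_measurable borel" "\<And>t. 0 < \<phi> t"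
    "\<And>j. \<beta> j \<in> borel_measurable borel" "\<And>j t. \<beta> j t = 1 \<or> \<beta> j t = -1"
    "\<And>F b J. (\<And>b. signs b \<Longrightarrow> 0 \<le> F b) \<Longrightarrow> signs b \<Longrightarrow> J \<subseteq> I \<Longrightarrow>
       (\<integral>\<^sup>+ t. ennreal (\<phi> t * F (\<lambda>j. if j \<in> J then \<beta> j t else b j)) \<partial>lborel) = ennreal (avg J F b)"
proof -
  define N where "N = card (Pow I)"
  have N: "N = 2 ^ card I" using assms by (simp add: N_def card_Pow)
  then have "0 < N" by simp
  from fair_cells_exist[OF this] obtain \<phi> :: "real \<Rightarrow> real" and d :: "real \<Rightarrow> nat"
  where \<phi>: "\<phi> \<in> borel_measurable borel" "\<And>t. 0 < \<phi> t"
    and d: "d \<in> measurable borel (count_space UNIV)" "\<And>t. d t < N"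
    and cells: "\<And>G. (\<And>k. k < N \<Longrightarrow> 0 \<le> G k) \<Longrightarrow>
       (\<integral>\<^sup>+ t. ennreal (\<phi> t * G (d t)) \<partial>lborel) = ennreal ((\<Sum>k<N. G k) / N)" by blast
  obtain e where e: "bij_betw e {0..<N} (Pow I)"
    using ex_bij_betw_nat_finite[of "Pow I"] assms unfolding N_def by auto
  define \<beta> :: "nat \<Rightarrow> real \<Rightarrow> real" where "\<beta> j t = (if j \<in> e (d t) then -1 else 1)" for j t
  show thesis
  proof
    show "\<phi> \<in> borel_measurable borel" "0 < \<phi> t" for t by fact+
    show "\<beta> j \<in> borel_measurable borel" for j
      unfolding \<beta>_def[abs_def]
      by (rule measurable_compose[OF d(1), of "\<lambda>k. if j \<in> e k then -1 else 1"]) simp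
    show "\<beta> j t = 1 \<or> \<beta> j t = -1" for j t by (simp add: \<beta>_def)
    fix F :: "(nat \<Rightarrow> real) \<Rightarrow> real" and b J
    assume F: "\<And>b. signs b \<Longrightarrow> 0 \<le> F b" and b: "signs b" and J: "J \<subseteq> I"
    define F' where "F' b' = F (\<lambda>j. if j \<in> J then b' j else b j)" for b'
    let ?o = "\<lambda>K i. if i \<in> I then (if i \<in> K then -1 else 1) else b i"
    have F'eq: "F' (?o (e (d t))) = F (\<lambda>j. if j \<in> J then \<beta> j t else b j)" for t
      unfolding F'_def using J by (intro arg_cong[where f = F]) (auto simp: \<beta>_def fun_eq_iff)
    have F'pos: "0 \<le> F' (?o K)" for K
      unfolding F'_def using b by (intro F) (auto simp: signs_def)
    have "(\<integral>\<^sup>+ t. ennreal (\<phi> t * F (\<lambda>j. if j \<in> J then \<beta> j t else b j)) \<partial>lborel) =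
        ennreal ((\<Sum>k<N. F' (?o (e k))) / N)"
      unfolding F'eq[symmetric] by (rule cells[of "\<lambda>k. F' (?o (e k))"]) (rule F'pos)
    also have "(\<Sum>k<N. F' (?o (e k))) / N = avg I F' b"
      using sum.reindex_bij_betw[OF e, of "\<lambda>K. F' (?o K)"]
      by (simp add: avg_def N atLeast0LessThan)
    also have "\<dots> = avg (J \<union> (I - J)) F' b"
      using J by (simp add: Un_absorb1)
    also have "\<dots> = avg J (avg (I - J) F') b"
      using J assms by (intro avg_union) (auto intro: finite_subset)
    also have "avg (I - J) F' = F'"
      using assms by (intro ext avg_ignores) (auto simp: ignores_def F'_def intro!: arg_cong[where f = F])
    also have "avg J F' b = avg J F b"
      by (rule avg_cong[OF b]) (auto simp: F'_def intro!: arg_cong[where f = F])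
    finally show "(\<integral>\<^sup>+ t. ennreal (\<phi> t * F (\<lambda>j. if j \<in> J then \<beta> j t else b j)) \<partial>lborel) = ennreal (avg J F b)" .
  qed
qed

section \<open>Networks of sign bits\<close>

text \<open>Every index \<open>i\<close> is one bit stored in the node \<open>w i\<close>; a node may store several bits.
  Given its parents, the bit has mean \<open>\<mu> i\<close>. Up to the base density of the visible nodes, \<open>M A B\<close>
  below is the marginal density of \<open>B\<close> under an intervention on \<open>A\<close>.\<close>
locale bit_model =
  fixes V :: "'v set" and E :: "('v \<times> 'v) set" and I :: "nat set"
    and w :: "nat \<Rightarrow> 'v" and \<mu> :: "nat \<Rightarrow> (nat \<Rightarrow> real) \<Rightarrow> real"
  assumes dag: "is_DAG V E"
    and finI [simp]: "finite I"
    and label: "i \<in> I \<Longrightarrow> w i \<in> V"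
    and mu_bound: "i \<in> I \<Longrightarrow> signs b \<Longrightarrow> \<bar>\<mu> i b\<bar> < 1"
    and mu_local: "i \<in> I \<Longrightarrow> ignores (- {j \<in> I. (w j, w i) \<in> E}) (\<mu> i)"
    and mu_measurable: "i \<in> I \<Longrightarrow> \<mu> i \<in> borel_measurable (PiM UNIV (\<lambda>_. borel))"
begin

definition P :: "'v set \<Rightarrow> (nat \<Rightarrow> real) \<Rightarrow> real" where
  "P A b = (\<Prod>i | i \<in> I \<and> w i \<notin> A. 1 + b i * \<mu> i b)"

definition M :: "'v set \<Rightarrow> 'v set \<Rightarrow> (nat \<Rightarrow> real) \<Rightarrow> real" where
  "M A B = avg {i \<in> I. w i \<notin> A \<union> B} (P A)"

text \<open>The integrand f(y | x, z, s) f(s | z) with the base densities divided out. For empty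
  \<open>S\<close> the last quotient is 1, so one expression serves both branches of
  \<open>cond_adj_set\<close>.\<close>

definition adjusted :: "'v set \<Rightarrow> 'v set \<Rightarrow> 'v set \<Rightarrow> 'v set \<Rightarrow> (nat \<Rightarrow> real) \<Rightarrow> real" where
  "adjusted X Y Z S b = M {} (Y \<union> (X \<union> Z \<union> S)) b / M {} (X \<union> Z \<union> S) b * (M {} (S \<union> Z) b / M {} Z b)"

lemma finV: "finite V" and E_V: "E \<subseteq> V \<times> V" and acyc: "acyclic E"
  using dag by (auto simp: is_DAG_def)

lemma no_loop: "(v, v) \<notin> E"
  using acyc by (meson acyclic_def r_into_trancl')

lemma factor_pos:
  assumes "i \<in> I" "signs b" shows "0 < 1 + b i * \<mu> i b"
proof -
  have "\<bar>b i * \<mu> i b\<bar> < 1"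
    using mu_bound[OF assms] signs_abs[OF assms(2)] by (simp add: abs_mult)
  then show ?thesis by linarith
qed

lemma P_pos: "signs b \<Longrightarrow> 0 < P A b"
  unfolding P_def by (intro prod_pos) (auto intro: factor_pos)

lemma M_pos: "signs b \<Longrightarrow> 0 < M A B b"
  unfolding M_def by (intro avg_pos P_pos) auto

lemma mu_ignores: "i \<in> I \<Longrightarrow> (\<And>j. j \<in> J \<Longrightarrow> j \<in> I \<Longrightarrow> (w j, w i) \<notin> E) \<Longrightarrow> ignores J (\<mu> i)"
  by (rule ignores_mono[OF mu_local]) auto

lemma measurable_P [measurable]: "P A \<in> borel_measurable (PiM UNIV (\<lambda>_. borel))"
  unfolding P_def[abs_def]
  by (intro borel_measurable_prod borel_measurable_add borel_measurable_times)
     (auto intro: mu_measurable)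

lemma measurable_M [measurable]: "M A B \<in> borel_measurable (PiM UNIV (\<lambda>_. borel))"
  unfolding M_def by measurable

lemma ignores_P: "ignores (- I) (P A)"
proof -
  have "ignores (- I) (\<lambda>b. 1 + b i * \<mu> i b)" if "i \<in> I" for i
  proof (rule ignoresI)
    fix b b' :: "nat \<Rightarrow> real" assume *: "\<And>i. i \<notin> - I \<Longrightarrow> b i = b' i"
    have "\<mu> i b = \<mu> i b'" by (rule ignoresD[OF mu_local[OF that]]) (use * in auto)
    then show "1 + b i * \<mu> i b = 1 + b' i * \<mu> i b'" using * that by auto
  qed
  then show ?thesis
    unfolding P_def[abs_def] by (intro ignores_prod) auto
qed

lemma ignores_M: "ignores (- {i \<in> I. w i \<in> A \<union> B}) (M A B)"
  unfolding M_def by (rule ignores_mono[OF ignores_avg[OF ignores_P]]) auto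

lemma avg_P_sinks:
  assumes J: "J \<subseteq> I" and disj: "\<And>i. i \<in> J \<Longrightarrow> w i \<notin> A"
    and sink: "\<And>i. i \<in> I \<Longrightarrow> ignores J (\<mu> i)"
  shows "avg J (P A) b = (\<Prod>i | i \<in> I - J \<and> w i \<notin> A. 1 + b i * \<mu> i b)"
proof -
  let ?C = "\<lambda>b. \<Prod>i | i \<in> I - J \<and> w i \<notin> A. 1 + b i * \<mu> i b"
  have finJ: "finite J" using J by (rule finite_subset) simp
  have "{i. i \<in> I \<and> w i \<notin> A} = {i. i \<in> I - J \<and> w i \<notin> A} \<union> J"
    using J disj by auto
  then have "P A = (\<lambda>b. ?C b * (\<Prod>i\<in>J. 1 + b i * \<mu> i b))"
    unfolding P_def using finJ by (intro ext, simp only:, intro prod.union_disjoint) auto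
  moreover have "ignores J ?C"
  proof (rule ignores_prod)
    fix i assume i: "i \<in> {i. i \<in> I - J \<and> w i \<notin> A}"
    show "ignores J (\<lambda>b. 1 + b i * \<mu> i b)"
    proof (rule ignoresI)
      fix b b' :: "nat \<Rightarrow> real" assume *: "\<And>j. j \<notin> J \<Longrightarrow> b j = b' j"
      have "\<mu> i b = \<mu> i b'"
        by (rule ignoresD[OF sink]) (use i * in auto)
      then show "1 + b i * \<mu> i b = 1 + b' i * \<mu> i b'" using * i by auto
    qed
  qed
  ultimately show ?thesis
    using avg_prod_one_plus[OF finJ, of \<mu> ?C b] sink J by auto
qed

end

section \<open>Densities whose kernels see only sign bits\<close>

locale bit_density = bit_model +
  fixes \<phi> :: "real \<Rightarrow> real" and \<beta> :: "nat \<Rightarrow> real \<Rightarrow> real"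
  assumes phi_measurable [measurable]: "\<phi> \<in> borel_measurable borel"
    and phi_pos: "0 < \<phi> t"
    and beta_measurable [measurable]: "\<beta> j \<in> borel_measurable borel"
    and beta_sign: "\<beta> j t = 1 \<or> \<beta> j t = -1"
    and integral_bits: "(\<And>b. signs b \<Longrightarrow> 0 \<le> F b) \<Longrightarrow> signs b \<Longrightarrow> J \<subseteq> I \<Longrightarrow>
       (\<integral>\<^sup>+ t. ennreal (\<phi> t * F (\<lambda>j. if j \<in> J then \<beta> j t else b j)) \<partial>lborel) = ennreal (avg J F b)"
begin

definition bits :: "('a \<Rightarrow> real) \<Rightarrow> nat \<Rightarrow> real" where
  "bits c = (\<lambda>j. if j \<in> I then \<beta> j (c (w j)) else 1)"

definition kern :: "'a \<Rightarrow> ('a \<Rightarrow> real) \<Rightarrow> real" where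
  "kern v c = (let b = (\<lambda>j. if j \<in> I \<and> w j \<in> insert v (pa E v) then \<beta> j (c (w j)) else 1) in
     \<phi> (c v) * (\<Prod>i | i \<in> I \<and> w i = v. 1 + b i * \<mu> i b))"

lemma signs_bits: "signs (bits c)"
  using beta_sign by (auto simp: signs_def bits_def)

lemma kern_restrict:
  "kern v (restrict c (insert v (pa E v))) =
     \<phi> (c v) * (\<Prod>i | i \<in> I \<and> w i = v. 1 + bits c i * \<mu> i (bits c))"
proof -
  let ?b = "\<lambda>j. if j \<in> I \<and> w j \<in> insert v (pa E v) then \<beta> j (restrict c (insert v (pa E v)) (w j)) else 1"
  have "?b i = bits c i \<and> \<mu> i ?b = \<mu> i (bits c)" if "i \<in> I" "w i = v" for i
  proof
    show "?b i = bits c i" using that by (simp add: bits_def)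
    show "\<mu> i ?b = \<mu> i (bits c)"
      by (rule ignoresD[OF mu_local]) (use that in \<open>auto simp: bits_def pa_def\<close>)
  qed
  then have "(\<Prod>i | i \<in> I \<and> w i = v. 1 + ?b i * \<mu> i ?b) =
      (\<Prod>i | i \<in> I \<and> w i = v. 1 + bits c i * \<mu> i (bits c))"
    by (intro prod.cong) auto
  then show ?thesis by (simp add: kern_def Let_def)
qed

lemma measurable_bits:
  assumes "J \<subseteq> {j. w j \<in> H}"
  shows "(\<lambda>c j. if j \<in> J then \<beta> j (c (w j)) else b j) \<in> measurable (cfgM H) (PiM UNIV (\<lambda>_. borel))"
proof (rule measurable_PiM_single')
  fix j :: nat
  show "(\<lambda>c. if j \<in> J then \<beta> j (c (w j)) else b j) \<in> measurable (cfgM H) borel"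
  proof (cases "j \<in> J")
    case True
    then have "w j \<in> H" using assms by auto
    then have "(\<lambda>c. c (w j)) \<in> measurable (cfgM H) borel"
      unfolding cfgM_def by (rule measurable_compose[OF measurable_component_singleton]) simp
    from measurable_compose[OF this beta_measurable] True show ?thesis by simp
  qed simp
qed (auto simp: space_PiM)

lemma kernel_family_kern: "kernel_family V E kern"
  unfolding kernel_family_def
proof (intro ballI conjI allI)
  fix v assume v: "v \<in> V"
  let ?N = "insert v (pa E v)"
  let ?J = "{j. j \<in> I \<and> w j \<in> ?N}"
  let ?bb = "\<lambda>c j. if j \<in> ?J then \<beta> j (c (w j)) else 1"
  have "(\<lambda>c. \<Prod>i | i \<in> I \<and> w i = v. 1 + ?bb c i * \<mu> i (?bb c)) \<in> borel_measurable (cfgM ?N)"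
  proof (rule borel_measurable_prod)
    fix i assume i: "i \<in> {i \<in> I. w i = v}"
    have "(\<lambda>b. 1 + b i * \<mu> i b) \<in> borel_measurable (PiM UNIV (\<lambda>_. borel))"
      using i by (intro borel_measurable_add borel_measurable_times mu_measurable) auto
    from measurable_compose[OF measurable_bits[of ?J ?N "\<lambda>_. 1"] this]
    show "(\<lambda>c. 1 + ?bb c i * \<mu> i (?bb c)) \<in> borel_measurable (cfgM ?N)"
      by auto
  qed
  moreover have "(\<lambda>c. \<phi> (c v)) \<in> borel_measurable (cfgM ?N)"
    unfolding cfgM_def
    by (rule measurable_compose[OF measurable_component_singleton]) auto
  ultimately show "kern v \<in> borel_measurable (cfgM ?N)"
    unfolding kern_def[abs_def] Let_def by (intro borel_measurable_times) simp_all
  show "0 < kern v c" for c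
    unfolding kern_def Let_def
    by (intro mult_pos_pos phi_pos prod_pos ballI factor_pos) (use beta_sign in \<open>auto simp: signs_def\<close>)
  fix c
  let ?K = "{i. i \<in> I \<and> w i = v}"
  let ?F = "\<lambda>b. \<Prod>i\<in>?K. 1 + b i * \<mu> i b"
  have "bits (c(v := t)) = (\<lambda>j. if j \<in> ?K then \<beta> j t else bits c j)" for t
    by (auto simp: bits_def)
  then have "(\<integral>\<^sup>+ t. ennreal (kern v (restrict (c(v := t)) ?N)) \<partial>lborel) =
      (\<integral>\<^sup>+ t. ennreal (\<phi> t * ?F (\<lambda>j. if j \<in> ?K then \<beta> j t else bits c j)) \<partial>lborel)"
    by (simp only: kern_restrict fun_upd_same)
  also have "\<dots> = ennreal (avg ?K ?F (bits c))"
    by (rule integral_bits) (auto intro!: prod_nonneg less_imp_le[OF factor_pos] signs_bits)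
  also have "avg ?K ?F (bits c) = avg ?K (\<lambda>b. 1 * ?F b) (bits c)" by simp
  also have "\<dots> = 1"
    \<comment> \<open>Bits stored in the same node do not read each other, since there is no loop at
      \<open>v\<close>.\<close>
    by (rule avg_prod_one_plus) (auto simp: no_loop intro!: mu_ignores)
  finally show "(\<integral>\<^sup>+ t. ennreal (kern v (restrict (c(v := t)) ?N)) \<partial>lborel) = 1"
    by (simp only: ennreal_1)
qed

text \<open>Fubini, one node at a time: integrating the value of a node averages all bits stored
  there and absorbs its base density.\<close>

lemma integral_many_bits:
  assumes "finite H" "\<And>b. signs b \<Longrightarrow> 0 \<le> F b" "signs b"
    and "F \<in> borel_measurable (PiM UNIV (\<lambda>_. borel))"
  shows "(\<integral>\<^sup>+ r. ennreal ((\<Prod>v\<in>H. \<phi> (r v)) * F (\<lambda>j. if j \<in> I \<and> w j \<in> H then \<beta> j (r (w j)) else b j)) \<partial>cfgM H)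
     = ennreal (avg {j \<in> I. w j \<in> H} F b)"
  using assms
proof (induction H arbitrary: F b rule: finite_induct)
  case empty
  interpret product_sigma_finite "\<lambda>_::'a. lborel :: real measure" by standard
  show ?case by (simp add: cfgM_def space_PiM_empty emeasure_PiM_empty)
next
  case (insert v H)
  interpret product_sigma_finite "\<lambda>_::'a. lborel :: real measure" by standard
  let ?f = "\<lambda>r. ennreal ((\<Prod>v\<in>insert v H. \<phi> (r v)) * F (\<lambda>j. if j \<in> I \<and> w j \<in> insert v H then \<beta> j (r (w j)) else b j))"
  let ?b = "\<lambda>r j. if j \<in> I \<and> w j \<in> H then \<beta> j (r (w j)) else b j"
  let ?K = "{j. j \<in> I \<and> w j = v}"
  have f: "?f \<in> borel_measurable (PiM (insert v H) (\<lambda>_. lborel))"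
  proof (intro measurable_compose[OF _ measurable_ennreal] borel_measurable_times borel_measurable_prod)
    show "(\<lambda>r. \<phi> (r u)) \<in> borel_measurable (PiM (insert v H) (\<lambda>_. lborel))" if "u \<in> insert v H" for u
      by (rule measurable_compose[OF measurable_component_singleton[OF that]]) simp
    show "(\<lambda>r. F (\<lambda>j. if j \<in> I \<and> w j \<in> insert v H then \<beta> j (r (w j)) else b j))
        \<in> borel_measurable (PiM (insert v H) (\<lambda>_. lborel))"
    proof -
      have "{j. j \<in> I \<and> w j \<in> insert v H} \<subseteq> {j. w j \<in> insert v H}" by auto
      from measurable_compose[OF measurable_bits[OF this] insert.prems(3), of b]
      show ?thesis by (simp add: cfgM_def)
    qed
  qed
  have inner: "(\<integral>\<^sup>+ y. ?f (r(v := y)) \<partial>lborel) = ennreal ((\<Prod>v\<in>H. \<phi> (r v)) * avg ?K F (?b r))" for r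
  proof -
    let ?c = "\<Prod>v\<in>H. \<phi> (r v)"
    have c: "0 \<le> ?c" by (intro prod_nonneg) (auto intro: less_imp_le phi_pos)
    have sb: "signs (?b r)" using insert.prems(2) beta_sign by (auto simp: signs_def)
    have "(\<lambda>j. if j \<in> I \<and> w j \<in> insert v H then \<beta> j ((r(v := y)) (w j)) else b j) =
        (\<lambda>j. if j \<in> ?K then \<beta> j y else ?b r j)" for y
      using insert.hyps by (auto simp: fun_eq_iff)
    moreover have "(\<Prod>u\<in>insert v H. \<phi> ((r(v := y)) u)) = \<phi> y * ?c" for y
    proof -
      have "(\<Prod>u\<in>H. \<phi> ((r(v := y)) u)) = ?c"
        using insert.hyps by (intro prod.cong) auto
      then show ?thesis using insert.hyps by simp
    qed
    ultimately have "(\<integral>\<^sup>+ y. ?f (r(v := y)) \<partial>lborel) =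
        (\<integral>\<^sup>+ y. ennreal (\<phi> y * (\<lambda>b. ?c * F b) (\<lambda>j. if j \<in> ?K then \<beta> j y else ?b r j)) \<partial>lborel)"
      by (simp only: mult.assoc)
    also have "\<dots> = ennreal (avg ?K (\<lambda>b. ?c * F b) (?b r))"
      by (rule integral_bits) (use c insert.prems(1) sb in auto)
    also have "avg ?K (\<lambda>b. ?c * F b) (?b r) = ?c * avg ?K F (?b r)"
      by (rule avg_mult) (simp add: ignores_def)
    finally show ?thesis .
  qed
  have "integral\<^sup>N (cfgM (insert v H)) ?f = (\<integral>\<^sup>+ r. (\<integral>\<^sup>+ y. ?f (r(v := y)) \<partial>lborel) \<partial>cfgM H)"
    unfolding cfgM_def by (rule product_nn_integral_insert[OF insert.hyps f])
  also have "\<dots> = (\<integral>\<^sup>+ r. ennreal ((\<Prod>v\<in>H. \<phi> (r v)) * avg ?K F (?b r)) \<partial>cfgM H)"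
    by (simp only: inner)
  also have "\<dots> = ennreal (avg {j \<in> I. w j \<in> H} (avg ?K F) b)"
    by (rule insert.IH) (use insert.prems in \<open>auto intro!: avg_nonneg measurable_avg\<close>)
  also have "avg {j \<in> I. w j \<in> H} (avg ?K F) b = avg ({j \<in> I. w j \<in> H} \<union> ?K) F b"
    using insert.hyps by (intro avg_union[symmetric]) auto
  also have "{j \<in> I. w j \<in> H} \<union> ?K = {j \<in> I. w j \<in> insert v H}" by auto
  finally show ?case .
qed

lemma fdo_kern: "fdo V E kern A c = (\<Prod>v\<in>V - A. \<phi> (c v)) * P A (bits c)"
proof -
  let ?h = "\<lambda>i. 1 + bits c i * \<mu> i (bits c)"
  have "(\<Prod>v\<in>V - A. prod ?h {i \<in> {i \<in> I. w i \<notin> A}. w i = v}) = prod ?h {i \<in> I. w i \<notin> A}"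
    using finV label by (intro prod.group) auto
  moreover have "(\<Prod>v\<in>V - A. prod ?h {i \<in> {i \<in> I. w i \<notin> A}. w i = v}) = (\<Prod>v\<in>V - A. prod ?h {i. i \<in> I \<and> w i = v})"
    by (intro prod.cong) auto
  ultimately show ?thesis
    by (simp add: fdo_def kern_restrict prod.distrib P_def)
qed

text \<open>Base densities of hidden nodes integrate to 1, while those of visible nodes come out as
  a common factor. In a conditional density only the factor of the conditioned variables is
  left.\<close>

lemma margdo_kern:
  "margdo V E kern A B c = ennreal ((\<Prod>v\<in>V \<inter> B - A. \<phi> (c v)) * M A B (bits c))"
proof -
  let ?H = "V - (A \<union> B)"
  let ?C = "\<Prod>v\<in>V \<inter> B - A. \<phi> (c v)"
  let ?b = "\<lambda>r j. if j \<in> I \<and> w j \<in> ?H then \<beta> j (r (w j)) else bits c j"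
  have C: "0 \<le> ?C" by (intro prod_nonneg) (auto intro: less_imp_le phi_pos)
  have eq: "fdo V E kern A (mrg ?H r c) = (\<Prod>v\<in>?H. \<phi> (r v)) * (?C * P A (?b r))" for r
  proof -
    have "V - A = ?H \<union> (V \<inter> B - A)" by auto
    then have "(\<Prod>v\<in>V - A. \<phi> (mrg ?H r c v)) =
        (\<Prod>v\<in>?H. \<phi> (mrg ?H r c v)) * (\<Prod>v\<in>V \<inter> B - A. \<phi> (mrg ?H r c v))"
      using finV by (simp only:, intro prod.union_disjoint) auto
    also have "(\<Prod>v\<in>?H. \<phi> (mrg ?H r c v)) = (\<Prod>v\<in>?H. \<phi> (r v))"
      by (intro prod.cong) (auto simp: mrg_def)
    also have "(\<Prod>v\<in>V \<inter> B - A. \<phi> (mrg ?H r c v)) = ?C"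
      by (intro prod.cong) (auto simp: mrg_def)
    finally have 1: "(\<Prod>v\<in>V - A. \<phi> (mrg ?H r c v)) = (\<Prod>v\<in>?H. \<phi> (r v)) * ?C" .
    have 2: "bits (mrg ?H r c) = ?b r" by (auto simp: bits_def mrg_def)
    show ?thesis unfolding fdo_kern 1 2 by simp
  qed
  have "margdo V E kern A B c = ennreal (avg {j \<in> I. w j \<in> ?H} (\<lambda>b. ?C * P A b) (bits c))"
    unfolding margdo_def eq
    by (rule integral_many_bits)
       (auto simp: finV intro!: mult_nonneg_nonneg C less_imp_le[OF P_pos] signs_bits)
  also have "{j \<in> I. w j \<in> ?H} = {j \<in> I. w j \<notin> A \<union> B}" using label by auto
  also have "avg {j \<in> I. w j \<notin> A \<union> B} (\<lambda>b. ?C * P A b) (bits c) = ?C * M A B (bits c)"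
    unfolding M_def by (rule avg_mult) (simp add: ignores_def)
  finally show ?thesis .
qed

lemma cond_do_kern:
  assumes "B \<subseteq> V" "B \<inter> C = {}" "A \<inter> B = {}"
  shows "cond_do V E kern A B C c = ennreal ((\<Prod>v\<in>B. \<phi> (c v)) * (M A (B \<union> C) (bits c) / M A C (bits c)))"
proof -
  have pos: "0 < (\<Prod>v\<in>D. \<phi> (c v))" for D by (intro prod_pos) (auto intro: phi_pos)
  have "V \<inter> (B \<union> C) - A = B \<union> (V \<inter> C - A)" using assms by auto
  then have split: "(\<Prod>v\<in>V \<inter> (B \<union> C) - A. \<phi> (c v)) = (\<Prod>v\<in>B. \<phi> (c v)) * (\<Prod>v\<in>V \<inter> C - A. \<phi> (c v))"
    using assms finV by (simp only:, intro prod.union_disjoint) (auto intro: finite_subset)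
  have M: "0 < M A D (bits c)" for D by (rule M_pos[OF signs_bits])
  show ?thesis
    unfolding cond_do_def margdo_kern split
    using pos[of "V \<inter> C - A"] pos[of B] M[of C] M[of "B \<union> C"]
    by (subst divide_ennreal) (auto simp: less_imp_le intro!: mult_pos_pos)
qed

text \<open>If the set where all bits are 1 were null, the indicator of that event would have
  average 0 over the signs. This is what allows an almost everywhere identity to be used
  there.\<close>

lemma unit_cell_pos: "emeasure lborel {t. \<forall>j\<in>I. \<beta> j t = 1} \<noteq> 0"
proof
  let ?D = "{t. \<forall>j\<in>I. \<beta> j t = 1}"
  let ?F = "\<lambda>b::nat \<Rightarrow> real. if \<forall>j\<in>I. b j = 1 then 1 else 0 :: real"
  assume "emeasure lborel ?D = 0"
  then have "AE t in lborel. t \<notin> ?D"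
    by (intro AE_not_in) (auto simp: null_sets_def)
  then have "AE t in lborel. ennreal (\<phi> t * ?F (\<lambda>j. if j \<in> I then \<beta> j t else 1)) = 0"
    by eventually_elim auto
  then have "(\<integral>\<^sup>+ t. ennreal (\<phi> t * ?F (\<lambda>j. if j \<in> I then \<beta> j t else 1)) \<partial>lborel) = 0"
    by (subst nn_integral_0_iff_AE) auto
  moreover have "(\<integral>\<^sup>+ t. ennreal (\<phi> t * ?F (\<lambda>j. if j \<in> I then \<beta> j t else 1)) \<partial>lborel) = ennreal (avg I ?F (\<lambda>_. 1))"
    by (rule integral_bits) (auto intro: signs_one)
  moreover have "0 < avg I ?F (\<lambda>_. 1)"
    unfolding avg_def
    by (intro divide_pos_pos sum_pos2[of _ "{}"]) auto
  ultimately show False by simp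
qed

text \<open>A product of finitely many copies of a non-null set is not null, so a property that
  holds almost everywhere holds somewhere in it.\<close>

lemma obtain_unit_config:
  fixes A :: "'a set"
  assumes "finite A" "AE c in cfgM A. Q c"
  obtains c where "Q c" "\<And>v j. v \<in> A \<Longrightarrow> j \<in> I \<Longrightarrow> \<beta> j (c v) = 1"
proof (rule ccontr)
  interpret product_sigma_finite "\<lambda>_::'a. lborel :: real measure" by standard
  let ?D = "{t. \<forall>j\<in>I. \<beta> j t = 1}"
  assume "\<not> thesis"
  then have no: "Q c \<Longrightarrow> c \<notin> PiE A (\<lambda>_. ?D)" for c
    using that by (force simp: PiE_iff)
  have D: "?D \<in> sets lborel" by simp
  have "AE c in cfgM A. c \<notin> PiE A (\<lambda>_. ?D)"
    using assms(2) by eventually_elim (rule no)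
  moreover have "PiE A (\<lambda>_. ?D) \<in> sets (cfgM A)"
    unfolding cfgM_def by (rule sets_PiM_I_finite[OF assms(1)]) (rule D)
  ultimately have "emeasure (cfgM A) (PiE A (\<lambda>_. ?D)) = 0"
    by (subst (asm) AE_iff_null_sets[symmetric]) (auto dest: null_setsD1)
  moreover have "emeasure (cfgM A) (PiE A (\<lambda>_. ?D)) = (\<Prod>v\<in>A. emeasure lborel ?D)"
    unfolding cfgM_def by (rule emeasure_PiM[OF assms(1)]) (rule D)
  ultimately show False
    using unit_cell_pos assms(1) by (simp add: prod_zero_iff)
qed

text \<open>Both sides of the formula carry the base density of \<open>Y\<close> as a positive
  factor. Cancelling it at a point where all bits of \<open>X\<close>, \<open>Y\<close>,
  \<open>Z\<close> are 1 leaves an identity without real integrals.\<close>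

lemma adjustment_identity_bits:
  assumes sub: "X \<subseteq> V" "Y \<subseteq> V" "Z \<subseteq> V" "S \<subseteq> V"
    and disj: "X \<inter> Y = {}" "X \<inter> S = {}" "Y \<inter> Z = {}" "Y \<inter> S = {}" "Z \<inter> S = {}"
    and adj: "cond_adj_set V E X Y Z S"
  shows "M X (Y \<union> Z) (\<lambda>_. 1) / M X Z (\<lambda>_. 1) = avg {i \<in> I. w i \<in> S} (adjusted X Y Z S) (\<lambda>_. 1)"
proof -
  let ?A = "X \<union> Y \<union> Z"
  let ?G = "adjusted X Y Z S"
  let ?IS = "{i \<in> I. w i \<in> S}"
  have finA: "finite ?A" using sub finV by (auto intro: finite_subset)
  have finS: "finite S" using sub finV by (auto intro: finite_subset)
  from adj kernel_family_kern have "AE c in cfgM ?A. cond_do V E kern X Y Z c =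
           (if S = {} then cond_do V E kern {} Y (X \<union> Z) c
            else (\<integral>\<^sup>+ s. cond_do V E kern {} Y (X \<union> Z \<union> S) (mrg S s c)
                          * cond_do V E kern {} S Z (mrg S s c) \<partial>cfgM S))"
    unfolding cond_adj_set_def by blast
  from obtain_unit_config[OF finA this] obtain c where
    eq: "cond_do V E kern X Y Z c =
           (if S = {} then cond_do V E kern {} Y (X \<union> Z) c
            else (\<integral>\<^sup>+ s. cond_do V E kern {} Y (X \<union> Z \<union> S) (mrg S s c)
                          * cond_do V E kern {} S Z (mrg S s c) \<partial>cfgM S))"
    and unit: "\<And>v j. v \<in> ?A \<Longrightarrow> j \<in> I \<Longrightarrow> \<beta> j (c v) = 1" by blast
  let ?p = "\<Prod>v\<in>Y. \<phi> (c v)"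
  have p: "0 < ?p" by (intro prod_pos) (auto intro: phi_pos)
  have Mp: "0 < M A B b" if "signs b" for A B b using M_pos[OF that] .
  have Gp: "0 < ?G b" if "signs b" for b
    unfolding adjusted_def using Mp[OF that] by (intro mult_pos_pos divide_pos_pos) auto
  have Gm: "?G \<in> borel_measurable (PiM UNIV (\<lambda>_. borel))"
    unfolding adjusted_def[abs_def] by measurable
  have "(if S = {} then cond_do V E kern {} Y (X \<union> Z) c
            else (\<integral>\<^sup>+ s. cond_do V E kern {} Y (X \<union> Z \<union> S) (mrg S s c)
                          * cond_do V E kern {} S Z (mrg S s c) \<partial>cfgM S))
     = ennreal (?p * avg ?IS ?G (bits c))"
  proof (cases "S = {}")
    case True
    have "M {} Z (bits c) \<noteq> 0" using Mp[OF signs_bits, of "{}" Z c] by simp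
    moreover have "cond_do V E kern {} Y (X \<union> Z) c =
        ennreal (?p * (M {} (Y \<union> (X \<union> Z)) (bits c) / M {} (X \<union> Z) (bits c)))"
      by (rule cond_do_kern) (use sub disj in auto)
    ultimately show ?thesis using True by (simp add: adjusted_def)
  next
    case False
    let ?b = "\<lambda>s j. if j \<in> I \<and> w j \<in> S then \<beta> j (s (w j)) else bits c j"
    have "cond_do V E kern {} Y (X \<union> Z \<union> S) (mrg S s c) * cond_do V E kern {} S Z (mrg S s c)
        = ennreal ((\<Prod>v\<in>S. \<phi> (s v)) * (?p * ?G (?b s)))" for s
    proof -
      let ?m = "mrg S s c"
      have b: "bits ?m = ?b s" by (auto simp: bits_def mrg_def)
      have "(\<Prod>v\<in>Y. \<phi> (?m v)) = ?p" using disj by (intro prod.cong) (auto simp: mrg_def)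
      moreover have "(\<Prod>v\<in>S. \<phi> (?m v)) = (\<Prod>v\<in>S. \<phi> (s v))" by (intro prod.cong) (auto simp: mrg_def)
      moreover have "cond_do V E kern {} Y (X \<union> Z \<union> S) ?m = ennreal ((\<Prod>v\<in>Y. \<phi> (?m v)) *
          (M {} (Y \<union> (X \<union> Z \<union> S)) (bits ?m) / M {} (X \<union> Z \<union> S) (bits ?m)))"
        by (rule cond_do_kern) (use sub disj in auto)
      moreover have "cond_do V E kern {} S Z ?m = ennreal ((\<Prod>v\<in>S. \<phi> (?m v)) *
          (M {} (S \<union> Z) (bits ?m) / M {} Z (bits ?m)))"
        by (rule cond_do_kern) (use sub disj in auto)
      moreover have "0 < (\<Prod>v\<in>S. \<phi> (s v))" by (intro prod_pos) (auto intro: phi_pos)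
      moreover have "0 \<le> M {} A (bits ?m)" for A using Mp[OF signs_bits[of ?m], of "{}" A] by simp
      ultimately show ?thesis
        using p unfolding b[symmetric] adjusted_def
        by (simp add: ennreal_mult[symmetric] mult_ac)
    qed
    then have "(\<integral>\<^sup>+ s. cond_do V E kern {} Y (X \<union> Z \<union> S) (mrg S s c)
                          * cond_do V E kern {} S Z (mrg S s c) \<partial>cfgM S) =
        (\<integral>\<^sup>+ s. ennreal ((\<Prod>v\<in>S. \<phi> (s v)) * (?p * ?G (?b s))) \<partial>cfgM S)"
      by simp
    also have "\<dots> = ennreal (avg ?IS (\<lambda>b. ?p * ?G b) (bits c))"
      by (rule integral_many_bits[OF finS])
         (use p Gp Gm in \<open>auto intro: less_imp_le signs_bits\<close>)
    also have "avg ?IS (\<lambda>b. ?p * ?G b) (bits c) = ?p * avg ?IS ?G (bits c)"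
      by (rule avg_mult) simp
    finally show ?thesis using False by simp
  qed
  with eq have R: "cond_do V E kern X Y Z c = ennreal (?p * avg ?IS ?G (bits c))" by simp
  have L: "cond_do V E kern X Y Z c =
      ennreal (?p * (M X (Y \<union> Z) (bits c) / M X Z (bits c)))"
    by (rule cond_do_kern) (use sub disj in auto)
  have Rn: "0 \<le> ?p * avg ?IS ?G (bits c)"
    using p by (intro mult_nonneg_nonneg avg_nonneg[OF signs_bits]) (auto intro: less_imp_le Gp)
  have Ln: "0 \<le> ?p * (M X (Y \<union> Z) (bits c) / M X Z (bits c))"
    using p Mp[OF signs_bits] by (intro mult_nonneg_nonneg divide_nonneg_nonneg) (auto intro: less_imp_le)
  have "?p * (M X (Y \<union> Z) (bits c) / M X Z (bits c)) = ?p * avg ?IS ?G (bits c)"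
    using R unfolding L ennreal_inj[OF Ln Rn] .
  with p have ratio: "M X (Y \<union> Z) (bits c) / M X Z (bits c) = avg ?IS ?G (bits c)"
    by (simp only: mult_cancel_left) simp
  have bc: "bits c i = 1" if "i \<in> I \<Longrightarrow> w i \<in> ?A" for i
    using unit that by (auto simp: bits_def)
  have MX: "M X B (bits c) = M X B (\<lambda>_. 1)" if "B \<subseteq> ?A" for B
    by (rule ignoresD[OF ignores_M]) (use that in \<open>auto intro!: bc\<close>)
  \<comment> \<open>The adjusted expression reads only bits stored in \<open>X\<close>,
    \<open>Y\<close>, \<open>Z\<close>, \<open>S\<close>; those in \<open>S\<close> are averaged and
    the others are 1 at \<open>c\<close>.\<close>
  have AG: "avg ?IS ?G (bits c) = avg ?IS ?G (\<lambda>_. 1)"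
  proof (rule ignoresD[OF ignores_avg])
    show "ignores (- {i \<in> I. w i \<in> ?A \<union> S}) ?G"
    proof (rule ignoresI)
      fix b b' :: "nat \<Rightarrow> real" assume *: "\<And>i. i \<notin> - {i \<in> I. w i \<in> ?A \<union> S} \<Longrightarrow> b i = b' i"
      have "M {} B b = M {} B b'" if "B \<subseteq> ?A \<union> S" for B
        by (rule ignoresD[OF ignores_M]) (use * that in auto)
      then show "?G b = ?G b'" by (simp add: adjusted_def le_supI1 le_supI2)
    qed
    show "bits c i = 1" if "i \<notin> ?IS \<union> - {i \<in> I. w i \<in> ?A \<union> S}" for i
      using that by (intro bc) auto
  qed
  have "Y \<union> Z \<subseteq> ?A" "Z \<subseteq> ?A" by auto
  from this[THEN MX] ratio AG show ?thesis by simp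
qed

end

lemma (in bit_model) adjustment_identity:
  assumes "X \<subseteq> V" "Y \<subseteq> V" "Z \<subseteq> V" "S \<subseteq> V"
    and "X \<inter> Y = {}" "X \<inter> S = {}" "Y \<inter> Z = {}" "Y \<inter> S = {}" "Z \<inter> S = {}"
    and "cond_adj_set V E X Y Z S"
  shows "M X (Y \<union> Z) (\<lambda>_. 1) / M X Z (\<lambda>_. 1) = avg {i \<in> I. w i \<in> S} (adjusted X Y Z S) (\<lambda>_. 1)"
proof -
  obtain \<phi> :: "real \<Rightarrow> real" and \<beta> :: "nat \<Rightarrow> real \<Rightarrow> real"
    where *: "\<phi> \<in> borel_measurable borel" "\<And>t. 0 < \<phi> t"
      "\<And>j. \<beta> j \<in> borel_measurable borel" "\<And>j t. \<beta> j t = 1 \<or> \<beta> j t = -1"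
      "\<And>F b J. (\<And>b. signs b \<Longrightarrow> 0 \<le> F b) \<Longrightarrow> signs b \<Longrightarrow> J \<subseteq> I \<Longrightarrow>
         (\<integral>\<^sup>+ t. ennreal (\<phi> t * F (\<lambda>j. if j \<in> J then \<beta> j t else b j)) \<partial>lborel) = ennreal (avg J F b)"
    using fair_bits_exist[OF finI] by blast
  have "bit_density V E I w \<mu> \<phi> \<beta>"
    by unfold_locales (fact *)+
  then interpret bit_density V E I w \<mu> \<phi> \<beta> .
  show ?thesis using assms by (rule adjustment_identity_bits)
qed

section \<open>Bits along a walk\<close>

locale walk_model =
  fixes V :: "'v set" and E :: "('v \<times> 'v) set" and m :: nat and w :: "nat \<Rightarrow> 'v"
  assumes walk_dag: "is_DAG V E"
    and m_pos: "0 < m"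
    and walk_step: "i < m \<Longrightarrow> (w i, w (Suc i)) \<in> E \<or> (w (Suc i), w i) \<in> E"
begin

definition fwd :: "nat \<Rightarrow> bool" where
  "fwd i \<longleftrightarrow> (w i, w (Suc i)) \<in> E"

definition K :: "nat set" where
  "K = {i. 0 < i \<and> i < m \<and> fwd (i - 1) \<and> \<not> fwd i}"

text \<open>Pure products at every collider would make the collider bits independent of \<open>X\<close>, and then
  adjusting for them has no effect; hence the mixtures at the two outermost colliders.\<close>
definition lmap :: "nat \<Rightarrow> real \<Rightarrow> real" where
  "lmap i t = (if i = Min K then (1 + t) / 2 else t)"

definition rmap :: "nat \<Rightarrow> real \<Rightarrow> real" where
  "rmap i t = (if i = Max K then (1 + t) / 2 else t)"

text \<open>The factors 1/2 and 1/4 are noise: they keep the means strictly inside (-1, 1), hence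
  the kernels positive. A position into which no walk edge points falls through to 0 and is a fair
  sign.\<close>

definition mu :: "nat \<Rightarrow> (nat \<Rightarrow> real) \<Rightarrow> real" where
  "mu i b =
    (if i \<in> K then lmap i (b (i - 1)) * rmap i (b (Suc i)) / 4
     else if 0 < i \<and> fwd (i - 1) then b (i - 1) / 2
     else if i < m \<and> \<not> fwd i then b (Suc i) / 2
     else 0)"

text \<open>Every walk edge at \<open>i\<close> points into it: a collider, or an endpoint entered
  by its only edge. Such a bit is read by no mean.\<close>

definition sink :: "nat \<Rightarrow> bool" where
  "sink i \<longleftrightarrow> (0 < i \<longrightarrow> fwd (i - 1)) \<and> (i < m \<longrightarrow> \<not> fwd i)"

lemma finK: "finite K"
  by (rule finite_subset[of _ "{..m}"]) (auto simp: K_def)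

lemma K_bounds: "i \<in> K \<Longrightarrow> 0 < i \<and> i < m"
  by (auto simp: K_def)

lemma K_gap: "i \<in> K \<Longrightarrow> Suc i \<notin> K" "i \<in> K \<Longrightarrow> i - 1 \<notin> K"
  by (auto simp: K_def)

lemma bwd_edge: "i < m \<Longrightarrow> \<not> fwd i \<Longrightarrow> (w (Suc i), w i) \<in> E"
  using walk_step by (auto simp: fwd_def)

lemma fwd_edge: "0 < i \<Longrightarrow> fwd (i - 1) \<Longrightarrow> (w (i - 1), w i) \<in> E"
  by (auto simp: fwd_def)

lemma mu_bound: assumes "signs b" shows "\<bar>mu i b\<bar> < 1"
proof -
  have half: "\<bar>(1 + b j) / 2\<bar> \<le> 1" for j
    using assms unfolding signs_def by (elim allE[of _ j]) auto
  have abs1: "\<bar>b j\<bar> = 1" for j by (rule signs_abs[OF assms])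
  have "\<bar>lmap i (b j)\<bar> \<le> 1" "\<bar>rmap i (b j)\<bar> \<le> 1" for j
    using half[of j] abs1[of j] by (simp_all add: lmap_def rmap_def)
  then have "\<bar>lmap i (b (i - 1)) * rmap i (b (Suc i))\<bar> \<le> 1"
    unfolding abs_mult by (intro mult_le_one) auto
  then show ?thesis by (simp add: mu_def abs1)
qed

text \<open>Means read only along edges into \<open>i\<close>. This gives locality to the parents of
  \<open>w i\<close> and also that every bit read sits at a position with an outgoing walk edge, so
  not at a sink.\<close>

lemma mu_cong:
  assumes "i \<le> m" "\<And>j. j \<le> m \<Longrightarrow> (w j, w i) \<in> E \<Longrightarrow> \<not> sink j \<Longrightarrow> b j = b' j"
  shows "mu i b = mu i b'"
proof -
  have l: "b (i - 1) = b' (i - 1)" if "0 < i" "fwd (i - 1)"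
  proof (rule assms(2))
    show "\<not> sink (i - 1)" using that assms(1) by (auto simp: sink_def)
  qed (use that assms(1) fwd_edge in auto)
  have r: "b (Suc i) = b' (Suc i)" if "i < m" "\<not> fwd i"
  proof (rule assms(2))
    show "\<not> sink (Suc i)" using that by (simp add: sink_def)
  qed (use that bwd_edge in auto)
  show ?thesis
  proof (cases "i \<in> K")
    case True
    then have "0 < i" "fwd (i - 1)" "i < m" "\<not> fwd i" by (auto simp: K_def)
    with True l r show ?thesis by (simp add: mu_def)
  next
    case False
    with l r show ?thesis by (cases "i = 0") (simp_all add: mu_def)
  qed
qed

sublocale bit_model V E "{..m}" w mu
proof
  show "is_DAG V E" by (fact walk_dag)
  show "finite {..m}" by simp
  show "w i \<in> V" if "i \<in> {..m}" for i
  proof (cases "i = m")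
    case True
    then show ?thesis
      using m_pos walk_step[of "m - 1"] walk_dag by (auto simp: is_DAG_def)
  next
    case False
    then show ?thesis
      using that walk_step[of i] walk_dag by (auto simp: is_DAG_def)
  qed
  show "\<bar>mu i b\<bar> < 1" if "signs b" for i b by (rule mu_bound[OF that])
  show "ignores (- {j \<in> {..m}. (w j, w i) \<in> E}) (mu i)" if "i \<in> {..m}" for i
    using that by (intro ignoresI mu_cong) auto
  show "mu i \<in> borel_measurable (PiM UNIV (\<lambda>_. borel))" for i
    unfolding mu_def[abs_def] lmap_def rmap_def by measurable
qed

lemma mu_ignores_sinks: "i \<le> m \<Longrightarrow> (\<And>j. j \<in> J \<Longrightarrow> sink j) \<Longrightarrow> ignores J (mu i)"
  by (intro ignoresI mu_cong) auto

text \<open>A sink bit occurs in its own factor only, so removing that factor equals averaging the bit.\<close>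
lemma M_do_sinks:
  assumes "\<And>i. i \<le> m \<Longrightarrow> w i \<in> X \<Longrightarrow> sink i \<or> (i = 0 \<and> fwd 0)"
  shows "M X B = avg ({i. i \<le> m \<and> w i \<notin> X \<union> B} \<union> {i. i \<le> m \<and> w i \<in> X \<and> sink i}) (P {})"
proof
  fix b
  let ?J = "{i. i \<le> m \<and> w i \<in> X \<and> sink i}"
  have "avg ?J (P {}) b = P X b" for b
  proof -
    have "avg ?J (P {}) b = (\<Prod>i | i \<in> {..m} - ?J \<and> w i \<notin> {}. 1 + b i * mu i b)"
      by (rule avg_P_sinks) (auto intro: mu_ignores_sinks)
    also have "\<dots> = P X b"
      unfolding P_def
    proof (rule prod.mono_neutral_cong_right)
      \<comment> \<open>The only factor deleted by the intervention without being averaged is that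
        of position 0 when the walk leaves it forwards; its mean is 0, so the factor is 1.\<close>
      show "\<forall>i\<in>{i. i \<in> {..m} - ?J \<and> w i \<notin> {}} - {i. i \<in> {..m} \<and> w i \<notin> X}. 1 + b i * mu i b = 1"
        using assms m_pos by (auto simp: mu_def K_def)
    qed auto
    finally show ?thesis .
  qed
  then have "P X = avg ?J (P {})" by auto
  moreover have "{i \<in> {..m}. w i \<notin> X \<union> B} = {i. i \<le> m \<and> w i \<notin> X \<union> B}" by auto
  ultimately show "M X B b = avg ({i. i \<le> m \<and> w i \<notin> X \<union> B} \<union> ?J) (P {}) b"
    unfolding M_def by (subst avg_union) auto
qed

lemma M_obs: "M {} B = avg {i. i \<le> m \<and> w i \<notin> B} (P {})"
proof -
  have "{i \<in> {..m}. w i \<notin> {} \<union> B} = {i. i \<le> m \<and> w i \<notin> B}" by auto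
  then show ?thesis unfolding M_def by simp
qed

text \<open>Each factor of the density is charged to one edge, where edge \<open>n\<close> joins
  positions \<open>n - 1\<close> and \<open>n\<close>. A copying position is charged to the edge it
  copies along and a collider to its right edge, so its left edge gets 1. A fair position has factor
  1 and needs no edge.\<close>

definition edge_factor :: "nat \<Rightarrow> (nat \<Rightarrow> real) \<Rightarrow> real" where
  "edge_factor n b =
    (if fwd (n - 1) then (if n \<in> K then 1 else 1 + b (n - 1) * b n / 2)
     else (if n - 1 \<in> K then 1 + b (n - 1) * mu (n - 1) b else 1 + b (n - 1) * b n / 2))"

text \<open>The conditional factor is the boundary term of the induction: a position
  \<open>n\<close> that copies from the left is already charged to edge \<open>n\<close>, although
  it is not below \<open>n\<close>.\<close>

lemma prod_edge_factor_aux: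
  "n \<le> m \<Longrightarrow> (\<Prod>i<n. 1 + b i * mu i b) * (if 0 < n \<and> fwd (n - 1) \<and> n \<notin> K then 1 + b n * mu n b else 1)
     = (\<Prod>k\<in>{0<..n}. edge_factor k b)"
proof (induction n)
  case (Suc n)
  let ?h = "\<lambda>i. 1 + b i * mu i b"
  let ?T = "\<lambda>n. if 0 < n \<and> fwd (n - 1) \<and> n \<notin> K then ?h n else 1"
  have "{0<..Suc n} = insert (Suc n) {0<..n}" by auto
  then have R: "(\<Prod>k\<in>{0<..Suc n}. edge_factor k b) = edge_factor (Suc n) b * ((\<Prod>i<n. ?h i) * ?T n)"
    using Suc by simp
  have "?h n * ?T (Suc n) = edge_factor (Suc n) b * ?T n"
  proof (cases "fwd n")
    case True
    then have "n \<notin> K" by (simp add: K_def)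
    with True show ?thesis by (cases "n = 0") (simp_all add: edge_factor_def mu_def)
  next
    case False
    show ?thesis
    proof (cases "n \<in> K")
      case True
      with False show ?thesis by (simp add: edge_factor_def)
    next
      case nK: False
      with False Suc.prems have "\<not> (0 < n \<and> fwd (n - 1))" by (auto simp: K_def)
      with nK False Suc.prems show ?thesis
        by (cases "n = 0") (simp_all add: edge_factor_def mu_def)
    qed
  qed
  then show ?case unfolding R by (simp add: mult_ac)
qed simp

lemma P_edge_factors: "P {} b = (\<Prod>k\<in>{0<..m}. edge_factor k b)"
proof -
  have "m \<notin> K" by (simp add: K_def)
  then have "(if 0 < m \<and> fwd (m - 1) \<and> m \<notin> K then 1 + b m * mu m b else 1) = 1 + b m * mu m b"
    using m_pos by (auto simp: mu_def)
  moreover have "P {} b = (\<Prod>i<m. 1 + b i * mu i b) * (1 + b m * mu m b)"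
  proof -
    have "{i. i \<in> {..m} \<and> w i \<notin> {}} = {..<Suc m}" by auto
    then show ?thesis unfolding P_def by simp
  qed
  ultimately show ?thesis using prod_edge_factor_aux[of m b] by simp
qed

end

section \<open>Noisy copying chains\<close>

definition chain_weight :: "nat \<Rightarrow> nat \<Rightarrow> (nat \<Rightarrow> real) \<Rightarrow> real" where
  "chain_weight p n b = (\<Prod>k\<in>{p<..n}. 1 + b (k - 1) * b k / 2)"

lemma chain_weight_split:
  assumes "p \<le> r" "r \<le> n"
  shows "chain_weight p n b = chain_weight p r b * chain_weight r n b"
proof -
  have "{p<..n} = {p<..r} \<union> {r<..n}" using assms by auto
  then show ?thesis
    unfolding chain_weight_def by (simp only:, intro prod.union_disjoint) auto
qed

lemma chain_weight_Suc:
  "p \<le> n \<Longrightarrow> chain_weight p (Suc n) b = chain_weight p n b * (1 + b n * b (Suc n) / 2)"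
proof -
  assume "p \<le> n"
  moreover have "{n<..Suc n} = {Suc n}" by auto
  ultimately show ?thesis
    by (subst chain_weight_split[of p n "Suc n"]) (auto simp: chain_weight_def)
qed

lemma ignores_chain_weight: "H \<inter> {p..n} = {} \<Longrightarrow> ignores H (chain_weight p n)"
  unfolding chain_weight_def[abs_def]
proof (rule ignores_prod, rule ignoresI)
  fix k and b b' :: "nat \<Rightarrow> real"
  assume *: "H \<inter> {p..n} = {}" "k \<in> {p<..n}" "\<And>i. i \<notin> H \<Longrightarrow> b i = b' i"
  then have "k \<in> {p..n}" "k - 1 \<in> {p..n}" by auto
  with *(1) have "k \<notin> H" "k - 1 \<notin> H" by blast+
  with *(3) show "1 + b (k - 1) * b k / 2 = 1 + b' (k - 1) * b' k / 2" by simp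
qed

text \<open>Each copy halves a correlation, hence the power of 2. Coefficients \<open>u\<close> and
  \<open>v\<close> are general because the edge beyond \<open>n\<close> turns an affine function of
  the last bit into one of \<open>b n\<close> whose coefficients depend on the later bit.\<close>

lemma avg_chain_weight:
  assumes "p \<le> n" "ignores {p<..n} u" "ignores {p<..n} v"
  shows "avg {p<..n} (\<lambda>b. chain_weight p n b * (u b + v b * b n)) b = u b + v b * b p / 2 ^ (n - p)"
  using assms
proof (induction n arbitrary: u v b rule: dec_induct)
  case base
  then show ?case by (simp add: chain_weight_def)
next
  case (step n)
  let ?c = "\<lambda>b. u b + v b * b (Suc n)"
  have set: "{p<..Suc n} = {Suc n} \<union> {p<..n}" using step.hyps by auto
  have eq: "(\<lambda>b. chain_weight p (Suc n) b * (u b + v b * b (Suc n))) =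
      (\<lambda>b. chain_weight p n b * (?c b + (b (Suc n) / 2 * ?c b) * b n))"
    using step.hyps by (simp add: chain_weight_Suc algebra_simps add_divide_distrib)
  have ig: "ignores {p<..n} u" "ignores {p<..n} v"
    by (rule ignores_mono[OF step.prems(1)] ignores_mono[OF step.prems(2)]; force)+
  have igc: "ignores {p<..n} ?c"
  proof (rule ignoresI)
    fix b b' :: "nat \<Rightarrow> real" assume *: "\<And>i. i \<notin> {p<..n} \<Longrightarrow> b i = b' i"
    show "?c b = ?c b'"
      using * ignoresD[OF ig(1) *] ignoresD[OF ig(2) *] by simp
  qed
  have igd: "ignores {p<..n} (\<lambda>b. b (Suc n) / 2 * ?c b)"
  proof (rule ignoresI)
    fix b b' :: "nat \<Rightarrow> real" assume *: "\<And>i. i \<notin> {p<..n} \<Longrightarrow> b i = b' i"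
    have "b (Suc n) = b' (Suc n)" by (rule *) simp
    moreover have "?c b = ?c b'" by (rule ignoresD[OF igc *])
    ultimately show "b (Suc n) / 2 * ?c b = b' (Suc n) / 2 * ?c b'" by (simp only:)
  qed
  have inner: "avg {p<..n} (\<lambda>b. chain_weight p (Suc n) b * (u b + v b * b (Suc n))) b
      = ?c b + (b (Suc n) / 2 * ?c b) * b p / 2 ^ (n - p)" for b
    unfolding eq by (rule step.IH[OF igc igd])
  have uv: "u (b(Suc n := t)) = u b" "v (b(Suc n := t)) = v b" for t
    by (rule ignores_upd[OF step.prems(1)] ignores_upd[OF step.prems(2)]; use step.hyps in simp)+
  have "avg {p<..Suc n} (\<lambda>b. chain_weight p (Suc n) b * (u b + v b * b (Suc n))) b =
      avg {Suc n} (\<lambda>b. ?c b + (b (Suc n) / 2 * ?c b) * b p / 2 ^ (n - p)) b"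
  proof -
    have "avg {p<..n} (\<lambda>b. chain_weight p (Suc n) b * (u b + v b * b (Suc n))) =
        (\<lambda>b. ?c b + (b (Suc n) / 2 * ?c b) * b p / 2 ^ (n - p))"
      by (rule ext) (rule inner)
    then show ?thesis unfolding set by (subst avg_union) simp_all
  qed
  also have "\<dots> = u b + v b * b p / 2 ^ (Suc n - p)"
    using step.hyps by (simp add: avg_single uv Suc_diff_le field_simps)
  finally show ?case .
qed

lemma avg_chain_weight_full: "p \<le> n \<Longrightarrow> avg {p<..n} (chain_weight p n) b = 1"
  using avg_chain_weight[of p n "\<lambda>_. 1" "\<lambda>_. 0" b] by simp

lemma avg_chain_weight_open:
  assumes "p < n"
  shows "avg {p<..<n} (chain_weight p n) b = 1 + b p * b n / 2 ^ (n - p)"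
proof -
  obtain k where n: "n = Suc k" and "p \<le> k" using assms by (cases n) auto
  have "{p<..<n} = {p<..k}" using n by auto
  moreover have "chain_weight p n = (\<lambda>b. chain_weight p k b * (1 + (b n / 2) * b k))"
    using \<open>p \<le> k\<close> n by (auto simp: chain_weight_Suc)
  moreover have "ignores {p<..k} (\<lambda>b. b n / 2)"
    using n by (intro ignoresI) auto
  ultimately have "avg {p<..<n} (chain_weight p n) b = 1 + (b n / 2) * b p / 2 ^ (k - p)"
    using avg_chain_weight[OF \<open>p \<le> k\<close>, of "\<lambda>_. 1" "\<lambda>b. b n / 2"] by simp
  then show ?thesis using n \<open>p \<le> k\<close> by (simp add: Suc_diff_le)
qed

text \<open>The weight after \<open>r\<close> is a conditional density given \<open>b r\<close>, so
  unseen bits at the end of the chain leave no trace.\<close>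

lemma avg_chain_weight_beyond:
  assumes "finite H" "H \<subseteq> {..<r}" "r \<le> n"
  shows "avg (H \<union> {r<..n}) (chain_weight 0 n) b = avg H (chain_weight 0 r) b"
proof -
  have "avg {r<..n} (\<lambda>b. chain_weight 0 r b * chain_weight r n b) b = chain_weight 0 r b" for b
    using assms by (subst avg_mult) (auto intro: ignores_chain_weight simp: avg_chain_weight_full)
  moreover have "chain_weight 0 n = (\<lambda>b. chain_weight 0 r b * chain_weight r n b)"
    using assms by (auto simp: chain_weight_split[of 0 r n])
  ultimately have "avg {r<..n} (chain_weight 0 n) = chain_weight 0 r" by auto
  then show ?thesis using assms by (subst avg_union) auto
qed

lemma avg_chain_weight_beyond_open:
  assumes "finite H" "H \<subseteq> {..<r}" "r < n"
  shows "avg (H \<union> {r<..<n}) (chain_weight 0 n) b =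
    (1 + b r * b n / 2 ^ (n - r)) * avg H (chain_weight 0 r) b"
proof -
  let ?c = "\<lambda>b. 1 + b r * b n / 2 ^ (n - r)"
  have "avg {r<..<n} (\<lambda>b. chain_weight 0 r b * chain_weight r n b) b = ?c b * chain_weight 0 r b" for b
    using assms by (subst avg_mult) (auto intro: ignores_chain_weight simp: avg_chain_weight_open)
  moreover have "chain_weight 0 n = (\<lambda>b. chain_weight 0 r b * chain_weight r n b)"
    using assms by (auto simp: chain_weight_split[of 0 r n])
  ultimately have "avg {r<..<n} (chain_weight 0 n) = (\<lambda>b. ?c b * chain_weight 0 r b)" by auto
  moreover have "ignores H ?c"
  proof (rule ignoresI)
    fix b b' :: "nat \<Rightarrow> real" assume "\<And>i. i \<notin> H \<Longrightarrow> b i = b' i"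
    moreover have "r \<notin> H" "n \<notin> H" using assms by auto
    ultimately show "?c b = ?c b'" by simp
  qed
  ultimately show ?thesis using assms by (subst avg_union) (auto simp: avg_mult)
qed

lemma avg_chain_weight_total: "avg {..n} (chain_weight 0 n) b = 1"
proof -
  have "{..n} = {0} \<union> {0<..n}" by auto
  moreover have "avg {0<..n} (chain_weight 0 n) = (\<lambda>_. 1)"
    by (intro ext avg_chain_weight_full) simp
  ultimately show ?thesis by (simp only:, subst avg_union) auto
qed

text \<open>The first bit of the chain is fair, and noisy copying preserves mean 0.\<close>

lemma avg_chain_weight_odd:
  assumes "r \<le> n"
  shows "avg {..n} (\<lambda>b. b r * chain_weight 0 n b) b = 0"
proof -
  have set: "{..n} = {0} \<union> ({0<..r} \<union> {r<..n})" using assms by auto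
  have split: "(\<lambda>b. b r * chain_weight 0 n b) = (\<lambda>b. (b r * chain_weight 0 r b) * chain_weight r n b)"
    using assms by (auto simp: chain_weight_split[of 0 r n])
  have ig: "ignores {r<..n} (\<lambda>b. b r * chain_weight 0 r b)"
  proof (rule ignoresI)
    fix b b' :: "nat \<Rightarrow> real" assume *: "\<And>i. i \<notin> {r<..n} \<Longrightarrow> b i = b' i"
    have "{r<..n} \<inter> {0..r} = {}" by auto
    then have "chain_weight 0 r b = chain_weight 0 r b'"
      by (rule ignoresD[OF ignores_chain_weight *])
    with * show "b r * chain_weight 0 r b = b' r * chain_weight 0 r b'" by simp
  qed
  have 1: "avg {r<..n} (\<lambda>b. b r * chain_weight 0 n b) = (\<lambda>b. chain_weight 0 r b * (0 + 1 * b r))"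
    unfolding split using assms by (auto simp: avg_mult[OF ig] avg_chain_weight_full)
  have 2: "avg {0<..r} (\<lambda>b. chain_weight 0 r b * (0 + 1 * b r)) b = b 0 / 2 ^ r" for b
    using avg_chain_weight[of 0 r "\<lambda>_. 0" "\<lambda>_. 1"] by simp
  have "avg {..n} (\<lambda>b. b r * chain_weight 0 n b) b =
      avg {0} (avg {0<..r} (avg {r<..n} (\<lambda>b. b r * chain_weight 0 n b))) b"
  proof -
    let ?F = "\<lambda>b. b r * chain_weight 0 n b"
    have "avg ({0<..r} \<union> {r<..n}) ?F = avg {0<..r} (avg {r<..n} ?F)"
      by (intro ext avg_union) auto
    moreover have "avg ({0} \<union> ({0<..r} \<union> {r<..n})) ?F b = avg {0} (avg ({0<..r} \<union> {r<..n}) ?F) b"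
      by (rule avg_union) auto
    ultimately show ?thesis unfolding set by (simp only:)
  qed
  also have "\<dots> = 0" unfolding 1 2 avg_single by simp
  finally show ?thesis .
qed

text \<open>Half of the left side is \<open>(1 - c * C) / (1 - C * C)\<close>, which equals 1 only
  for \<open>c = C\<close> or \<open>C = 0\<close>.\<close>

lemma ratio_average_ne:
  fixes c C :: real
  assumes "0 < C" "C < c" "c < 1"
  shows "(1 + c) / (1 + C) + (1 - c) / (1 - C) \<noteq> 2"
proof
  have nz: "1 + C \<noteq> 0" "1 - C \<noteq> 0" using assms by auto
  assume "(1 + c) / (1 + C) + (1 - c) / (1 - C) = 2"
  then have "(1 + c) * (1 - C) + (1 - c) * (1 + C) = 2 * ((1 + C) * (1 - C))"
    using nz by (simp add: add_frac_eq divide_eq_eq)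
  then have "C * (c - C) = 0" by (simp only: algebra_simps)
  then show False using assms by simp
qed

section \<open>Directed walks through \<open>S\<close> or \<open>Y\<close>\<close>

locale adjustment_setting =
  fixes V :: "'v set" and E :: "('v \<times> 'v) set" and X Y Z S :: "'v set"
  assumes DAG: "is_DAG V E"
    and sub: "X \<subseteq> V" "Y \<subseteq> V" "Z \<subseteq> V" "S \<subseteq> V"
    and disj: "X \<inter> Y = {}" "X \<inter> Z = {}" "X \<inter> S = {}" "Y \<inter> Z = {}" "Y \<inter> S = {}" "Z \<inter> S = {}"
    and Z_nondesc: "Z \<inter> De E X = {}"
    and adj: "cond_adj_set V E X Y Z S"

locale adjustment_chain = adjustment_setting V E X Y Z S
  for V :: "'v set" and E X Y Z S +
  fixes m :: nat and w :: "nat \<Rightarrow> 'v"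
  assumes chain_pos: "0 < m"
    and chain_step: "i < m \<Longrightarrow> (w i, w (Suc i)) \<in> E"
begin

sublocale walk_model V E m w
  by unfold_locales (use DAG chain_pos chain_step in auto)

lemma chain_fwd: "i < m \<Longrightarrow> fwd i"
  using chain_step by (simp add: fwd_def)

lemma chain_sink: "i \<le> m \<Longrightarrow> sink i \<longleftrightarrow> i = m"
  using chain_fwd chain_pos by (auto simp: sink_def)

lemma P_chain: "P {} = chain_weight 0 m"
proof
  fix b
  have "K = {}" using chain_fwd by (auto simp: K_def)
  then show "P {} b = chain_weight 0 m b"
    unfolding P_edge_factors chain_weight_def
    using chain_fwd by (intro prod.cong) (auto simp: edge_factor_def)
qed

lemma chain_identity:
  "M X (Y \<union> Z) (\<lambda>_. 1) / M X Z (\<lambda>_. 1) = avg {i. i \<le> m \<and> w i \<in> S} (adjusted X Y Z S) (\<lambda>_. 1)"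
  using adjustment_identity[OF sub(1-4) disj(1,3,4,5,6) adj] by simp

text \<open>Let \<open>r\<close> be the last visit to \<open>S\<close>. It screens off the end, so
  the conditional of \<open>Y\<close> depends on \<open>b r\<close> only; as \<open>b r\<close> is
  fair, adjustment returns 1. Intervention keeps the correlation \<open>1 / 2 ^ m\<close> between
  the two ends.\<close>

lemma no_causal_chain_through_S:
  assumes ends: "w 0 \<in> X" "w m \<in> Y"
    and inner: "\<And>i. 0 < i \<Longrightarrow> i < m \<Longrightarrow> w i \<notin> X \<union> Y \<union> Z"
    and S: "0 < s" "s < m" "w s \<in> S"
  shows False
proof -
  let ?S = "{i. i \<le> m \<and> w i \<in> S}"
  let ?Q = "chain_weight 0 m"
  define r where "r = Max ?S"
  have lab: "i = 0 \<or> 0 < i \<and> i < m \<or> i = m" if "i \<le> m" for i using that by auto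
  have iX: "w i \<in> X \<longleftrightarrow> i = 0" and iY: "w i \<in> Y \<longleftrightarrow> i = m" and iZ: "w i \<notin> Z" if "i \<le> m" for i
    using lab[OF that] ends inner[of i] disj chain_pos by auto
  have Sin: "?S \<subseteq> {0<..<m}" using iX iY disj by fastforce
  have mS: "i \<le> m \<Longrightarrow> w i \<in> S \<Longrightarrow> i \<in> ?S" for i by simp
  have "s \<in> ?S" using S by simp
  then have rS: "r \<in> ?S" unfolding r_def by (intro Max_in) auto
  have rmax: "i \<le> r" if "i \<in> ?S" for i unfolding r_def using that by (intro Max_ge) auto
  have r: "0 < r" "r < m" "r \<le> m" using rS Sin by auto
  let ?H = "{0<..<r} - ?S"
  let ?c = "1 / 2 ^ (m - r) :: real"
  have s1: "{i. i \<le> m \<and> w i \<notin> X \<union> (Y \<union> Z)} \<union> {i. i \<le> m \<and> w i \<in> X \<and> sink i} = {0<..<m}"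
  proof (intro set_eqI iffI)
    fix i assume "i \<in> {i. i \<le> m \<and> w i \<notin> X \<union> (Y \<union> Z)} \<union> {i. i \<le> m \<and> w i \<in> X \<and> sink i}"
    then show "i \<in> {0<..<m}" using iX[of i] iY[of i] iZ[of i] chain_sink[of i] chain_pos by (cases "i = m"; cases "i = 0") auto
  next
    fix i assume "i \<in> {0<..<m}"
    then show "i \<in> {i. i \<le> m \<and> w i \<notin> X \<union> (Y \<union> Z)} \<union> {i. i \<le> m \<and> w i \<in> X \<and> sink i}" using iX[of i] iY[of i] iZ[of i] chain_sink[of i] chain_pos by (cases "i = m"; cases "i = 0") auto
  qed
  have s2: "{i. i \<le> m \<and> w i \<notin> X \<union> Z} \<union> {i. i \<le> m \<and> w i \<in> X \<and> sink i} = {0<..m}"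
  proof (intro set_eqI iffI)
    fix i assume "i \<in> {i. i \<le> m \<and> w i \<notin> X \<union> Z} \<union> {i. i \<le> m \<and> w i \<in> X \<and> sink i}"
    then show "i \<in> {0<..m}" using iX[of i] iY[of i] iZ[of i] chain_sink[of i] chain_pos by (cases "i = m"; cases "i = 0") auto
  next
    fix i assume "i \<in> {0<..m}"
    then show "i \<in> {i. i \<le> m \<and> w i \<notin> X \<union> Z} \<union> {i. i \<le> m \<and> w i \<in> X \<and> sink i}" using iX[of i] iY[of i] iZ[of i] chain_sink[of i] chain_pos by (cases "i = m"; cases "i = 0") auto
  qed
  have s3: "{i. i \<le> m \<and> w i \<notin> Y \<union> (X \<union> Z \<union> S)} = ?H \<union> {r<..<m}"
  proof (intro set_eqI iffI)
    fix i assume "i \<in> {i. i \<le> m \<and> w i \<notin> Y \<union> (X \<union> Z \<union> S)}"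
    then show "i \<in> ?H \<union> {r<..<m}" using iX[of i] iY[of i] iZ[of i] rS rmax[of i] r by (cases "i = r"; cases "i = m"; cases "i = 0") auto
  next
    fix i assume "i \<in> ?H \<union> {r<..<m}"
    then show "i \<in> {i. i \<le> m \<and> w i \<notin> Y \<union> (X \<union> Z \<union> S)}" using iX[of i] iY[of i] iZ[of i] mS[of i] rmax[of i] r by auto
  qed
  have s4: "{i. i \<le> m \<and> w i \<notin> X \<union> Z \<union> S} = ?H \<union> {r<..m}"
  proof (intro set_eqI iffI)
    fix i assume "i \<in> {i. i \<le> m \<and> w i \<notin> X \<union> Z \<union> S}"
    then show "i \<in> ?H \<union> {r<..m}" using iX[of i] iY[of i] iZ[of i] rS rmax[of i] r by (cases "i = r"; cases "i = m"; cases "i = 0") auto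
  next
    fix i assume "i \<in> ?H \<union> {r<..m}"
    then show "i \<in> {i. i \<le> m \<and> w i \<notin> X \<union> Z \<union> S}" using iX[of i] iY[of i] iZ[of i] mS[of i] rmax[of i] r by auto
  qed
  have s5: "{i. i \<le> m \<and> w i \<notin> S \<union> Z} = {..m} - ?S"
    using iZ by auto
  have s6: "{i. i \<le> m \<and> w i \<notin> Z} = {..m}"
    using iZ by auto
  have do: "i \<le> m \<Longrightarrow> w i \<in> X \<Longrightarrow> sink i \<or> (i = 0 \<and> fwd 0)" for i
    using iX[of i] chain_fwd[of 0] chain_pos by auto
  have Mdo: "M X B = avg ({i. i \<le> m \<and> w i \<notin> X \<union> B} \<union> {i. i \<le> m \<and> w i \<in> X \<and> sink i}) (P {})" for B
    by (rule M_do_sinks) (rule do)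
  have L: "M X (Y \<union> Z) (\<lambda>_. 1) / M X Z (\<lambda>_. 1) = 1 + 1 / 2 ^ m"
    unfolding Mdo s1 s2 P_chain
    using chain_pos by (simp add: avg_chain_weight_open avg_chain_weight_full)
  \<comment> \<open>The average over hidden bits before \<open>r\<close> occurs in numerator and
    denominator and cancels once it is nonzero.\<close>
  have F: "avg ?H (chain_weight 0 r) b \<noteq> 0" if "signs b" for b
  proof -
    have "0 < avg ({i. i \<le> m \<and> w i \<notin> X \<union> Z \<union> S}) (P {}) b"
      using that by (intro avg_pos P_pos) auto
    then show ?thesis unfolding s4 P_chain
      using r by (subst (asm) avg_chain_weight_beyond) auto
  qed
  have e1: "avg (?H \<union> {r<..<m}) ?Q b = (1 + b r * b m / 2 ^ (m - r)) * avg ?H (chain_weight 0 r) b" for b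
    using r by (intro avg_chain_weight_beyond_open) auto
  have e2: "avg (?H \<union> {r<..m}) ?Q b = avg ?H (chain_weight 0 r) b" for b
    using r by (intro avg_chain_weight_beyond) auto
  have adj_eq: "adjusted X Y Z S b = avg ({..m} - ?S) (\<lambda>b. (1 + ?c * b r) * ?Q b) b"
    if b: "signs b" "b m = 1" for b
  proof -
    have "adjusted X Y Z S b = (1 + b r * b m * ?c) * avg ({..m} - ?S) ?Q b"
      unfolding adjusted_def M_obs s3 s4 s5 s6 P_chain
      unfolding e1 e2 avg_chain_weight_total using F[OF b(1)] by simp
    also have "\<dots> = (1 + ?c * b r) * avg ({..m} - ?S) ?Q b" using b by simp
    also have "\<dots> = avg ({..m} - ?S) (\<lambda>b. (1 + ?c * b r) * ?Q b) b"
      using rS by (intro avg_mult[symmetric] ignoresI) auto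
    finally show ?thesis .
  qed
  have "avg ?S (adjusted X Y Z S) (\<lambda>_. 1) = avg ?S (avg ({..m} - ?S) (\<lambda>b. (1 + ?c * b r) * ?Q b)) (\<lambda>_. 1)"
  proof (rule avg_cong[OF signs_one])
    fix b assume "signs b" "\<And>i. i \<notin> ?S \<Longrightarrow> b i = 1"
    moreover have "m \<notin> ?S" using Sin by auto
    ultimately show "adjusted X Y Z S b = avg ({..m} - ?S) (\<lambda>b. (1 + ?c * b r) * ?Q b) b"
      by (intro adj_eq) blast+
  qed
  also have "\<dots> = avg (?S \<union> ({..m} - ?S)) (\<lambda>b. (1 + ?c * b r) * ?Q b) (\<lambda>_. 1)"
    by (rule avg_union[symmetric]) auto
  also have "?S \<union> ({..m} - ?S) = {..m}" by auto
  also have "(\<lambda>b. (1 + ?c * b r) * ?Q b) = (\<lambda>b. ?Q b + ?c * (b r * ?Q b))"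
    by (auto simp: algebra_simps)
  also have "avg {..m} \<dots> (\<lambda>_. 1) = 1"
    using r by (simp only: avg_add avg_chain_weight_total avg_mult[OF ignores_const] avg_chain_weight_odd)
  finally show False using chain_identity L by simp
qed

text \<open>The intervention side does not see the end of the walk: in \<open>X\<close> it is a sink
  and is averaged, in \<open>S\<close> it is not mentioned. The adjusted side conditions on it,
  which contributes \<open>(1 + c) / (1 + C)\<close> when the end bit is 1. Here \<open>c\<close> is
  the correlation of the end with the last visit to \<open>Y\<close> and \<open>C\<close> that with
  the start; \<open>C < c\<close> because the start is further away.\<close>

lemma no_causal_chain_through_Y:
  assumes ends: "w 0 \<in> X" "w m \<in> S \<union> X"
    and inner: "\<And>i. 0 < i \<Longrightarrow> i < m \<Longrightarrow> w i \<notin> X \<union> S \<union> Z"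
    and Y: "0 < s" "s < m" "w s \<in> Y"
  shows False
proof -
  let ?Y = "{i. i \<le> m \<and> w i \<in> Y}"
  let ?Q = "chain_weight 0 m"
  define r where "r = Max ?Y"
  have lab: "i = 0 \<or> 0 < i \<and> i < m \<or> i = m" if "i \<le> m" for i using that by auto
  have iX: "w i \<in> X \<Longrightarrow> i = 0 \<or> i = m"
    and iS: "w i \<in> S \<Longrightarrow> i = m" and iZ: "w i \<notin> Z" if "i \<le> m" for i
    using lab[OF that] ends inner[of i] disj chain_pos by auto
  have wm: "w m \<in> X \<or> w m \<in> S" "\<not> (w m \<in> X \<and> w m \<in> S)" using ends disj by auto
  have Yin: "?Y \<subseteq> {0<..<m}"
  proof
    fix i assume i: "i \<in> ?Y"
    then have "i \<noteq> 0" "i \<noteq> m" using ends disj by auto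
    with i show "i \<in> {0<..<m}" by auto
  qed
  have "s \<in> ?Y" using Y by simp
  then have rY: "r \<in> ?Y" unfolding r_def by (intro Max_in) auto
  have rmax: "i \<le> r" if "i \<in> ?Y" for i unfolding r_def using that by (intro Max_ge) auto
  have r: "0 < r" "r < m" "r \<le> m" using rY Yin by auto
  let ?H = "{0<..<r} - ?Y"
  let ?F = "avg ?H (chain_weight 0 r)"
  let ?c = "1 / 2 ^ (m - r) :: real"
  let ?C = "1 / 2 ^ m :: real"
  have mem: "0 < i \<and> i < m \<Longrightarrow> w i \<notin> X \<union> S \<union> Z" for i using inner by blast
  have s1: "{i. i \<le> m \<and> w i \<notin> X \<union> (Y \<union> Z)} \<union> {i. i \<le> m \<and> w i \<in> X \<and> sink i} = ?H \<union> {r<..m}"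
  proof (intro set_eqI iffI)
    fix i assume "i \<in> ?H \<union> {r<..m}"
    then show "i \<in> {i. i \<le> m \<and> w i \<notin> X \<union> (Y \<union> Z)} \<union> {i. i \<le> m \<and> w i \<in> X \<and> sink i}"
      using iX[of i] iZ[of i] rmax[of i] r chain_sink[of i] by auto
  next
    fix i assume "i \<in> {i. i \<le> m \<and> w i \<notin> X \<union> (Y \<union> Z)} \<union> {i. i \<le> m \<and> w i \<in> X \<and> sink i}"
    then show "i \<in> ?H \<union> {r<..m}"
      using iX[of i] rY r ends chain_sink[of i] by (cases "i = 0"; cases "i = r") auto
  qed
  have s2: "{i. i \<le> m \<and> w i \<notin> X \<union> Z} \<union> {i. i \<le> m \<and> w i \<in> X \<and> sink i} = {0<..m}"
  proof (intro set_eqI iffI)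
    fix i assume "i \<in> {i. i \<le> m \<and> w i \<notin> X \<union> Z} \<union> {i. i \<le> m \<and> w i \<in> X \<and> sink i}"
    then show "i \<in> {0<..m}" using iX[of i] iZ[of i] chain_sink[of i] chain_pos ends by (cases "i = m"; cases "i = 0") auto
  next
    fix i assume "i \<in> {0<..m}"
    then show "i \<in> {i. i \<le> m \<and> w i \<notin> X \<union> Z} \<union> {i. i \<le> m \<and> w i \<in> X \<and> sink i}" using iX[of i] iZ[of i] chain_sink[of i] chain_pos ends by (cases "i = m"; cases "i = 0") auto
  qed
  have s3: "{i. i \<le> m \<and> w i \<notin> Y \<union> (X \<union> Z \<union> S)} = ?H \<union> {r<..<m}"
  proof (intro set_eqI iffI)
    fix i assume "i \<in> ?H \<union> {r<..<m}"
    then show "i \<in> {i. i \<le> m \<and> w i \<notin> Y \<union> (X \<union> Z \<union> S)}"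
      using mem[of i] rmax[of i] r by auto
  next
    fix i assume "i \<in> {i. i \<le> m \<and> w i \<notin> Y \<union> (X \<union> Z \<union> S)}"
    then show "i \<in> ?H \<union> {r<..<m}"
      using iX[of i] wm ends rY r by (cases "i = 0"; cases "i = r"; cases "i = m") auto
  qed
  have s4: "{i. i \<le> m \<and> w i \<notin> X \<union> Z \<union> S} = {0<..<m}"
  proof (intro set_eqI iffI)
    fix i assume "i \<in> {0<..<m}"
    then show "i \<in> {i. i \<le> m \<and> w i \<notin> X \<union> Z \<union> S}" using mem[of i] by auto
  next
    fix i assume "i \<in> {i. i \<le> m \<and> w i \<notin> X \<union> Z \<union> S}"
    then show "i \<in> {0<..<m}" using iX[of i] ends wm by (cases "i = 0"; cases "i = m") auto
  qed
  have s6: "{i. i \<le> m \<and> w i \<notin> Z} = {..m}"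
    using iZ by auto
  have do: "i \<le> m \<Longrightarrow> w i \<in> X \<Longrightarrow> sink i \<or> (i = 0 \<and> fwd 0)" for i
    using iX[of i] chain_fwd[of 0] chain_sink[of i] chain_pos by auto
  have Mdo: "M X B = avg ({i. i \<le> m \<and> w i \<notin> X \<union> B} \<union> {i. i \<le> m \<and> w i \<in> X \<and> sink i}) (P {})" for B
    by (rule M_do_sinks) (rule do)
  have L: "M X (Y \<union> Z) (\<lambda>_. 1) / M X Z (\<lambda>_. 1) = ?F (\<lambda>_. 1)"
    unfolding Mdo s1 s2 P_chain
    using r by (subst avg_chain_weight_beyond) (auto simp: avg_chain_weight_full)
  have F: "0 < ?F b" if "signs b" for b
  proof -
    have "0 < avg (?H \<union> {r<..m}) (P {}) b"
      using that by (intro avg_pos P_pos) auto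
    then show ?thesis unfolding P_chain
      using r by (subst (asm) avg_chain_weight_beyond) auto
  qed
  \<comment> \<open>At most the end bit is visible here, and on its own it is fair.\<close>
  have SZ: "M {} (S \<union> Z) b = 1" for b
  proof (cases "w m \<in> X")
    case True
    then have "{i. i \<le> m \<and> w i \<notin> S \<union> Z} = {..m}" using iS iZ wm by blast
    then show ?thesis unfolding M_obs P_chain by (simp add: avg_chain_weight_total)
  next
    case False
    have "{i. i \<le> m \<and> w i \<notin> S \<union> Z} = {0} \<union> {0<..<m}"
    proof (intro set_eqI iffI)
      fix i assume "i \<in> {i. i \<le> m \<and> w i \<notin> S \<union> Z}"
      then show "i \<in> {0} \<union> {0<..<m}" using False wm by (cases "i = 0"; cases "i = m") auto
    next
      fix i assume "i \<in> {0} \<union> {0<..<m}"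
      then show "i \<in> {i. i \<le> m \<and> w i \<notin> S \<union> Z}" using iS[of i] iZ[of i] chain_pos by auto
    qed
    moreover have "avg ({0} \<union> {0<..<m}) ?Q b = avg {0} (avg {0<..<m} ?Q) b"
      by (rule avg_union) auto
    ultimately show ?thesis unfolding M_obs P_chain
      using chain_pos by (simp add: avg_single avg_chain_weight_open)
  qed
  have e1: "avg (?H \<union> {r<..<m}) ?Q b = (1 + b r * b m / 2 ^ (m - r)) * ?F b" for b
    using r by (intro avg_chain_weight_beyond_open) auto
  have e2: "avg {0<..<m} ?Q b = 1 + b 0 * b m / 2 ^ m" for b
    using avg_chain_weight_open[OF chain_pos, of b] by simp
  have adj_eq: "adjusted X Y Z S b = ?F b * ((1 + b r * b m * ?c) / (1 + b 0 * b m * ?C))" for b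
    unfolding adjusted_def SZ unfolding M_obs s3 s4 s6 P_chain e1 e2 avg_chain_weight_total
    by simp
  have one: "?F (\<lambda>_. 1) = avg {i. i \<le> m \<and> w i \<in> S} (adjusted X Y Z S) (\<lambda>_. 1)"
    using chain_identity L by simp
  have c: "?C < ?c" "0 < ?C" "?c < 1"
    using r by (auto simp: frac_less2 power_strict_increasing)
  have Fm: "?F (b(m := t)) = ?F b" for b t
  proof -
    have "ignores (?H \<union> {m}) ?F"
      using r by (intro ignores_avg ignores_chain_weight) auto
    then show ?thesis by (rule ignores_upd) simp
  qed
  show False
  proof (cases "w m \<in> X")
    case True
    then have e: "{i. i \<le> m \<and> w i \<in> S} = {}" using iS wm by auto
    have "?F (\<lambda>_. 1) = adjusted X Y Z S (\<lambda>_. 1)" using one unfolding e by simp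
    also have "\<dots> = ?F (\<lambda>_. 1) * ((1 + ?c) / (1 + ?C))" unfolding adj_eq by simp
    finally have "?F (\<lambda>_. 1) = ?F (\<lambda>_. 1) * ((1 + ?c) / (1 + ?C))" .
    moreover have "?F (\<lambda>_. 1) \<noteq> 0" using F[OF signs_one] by simp
    ultimately have "(1 + ?c) / (1 + ?C) = 1" by (simp only: mult_cancel_left1 simp_thms)
    moreover have "1 + ?C \<noteq> 0" using c by linarith
    ultimately have "1 + ?c = 1 + ?C" by (simp only: divide_eq_1_iff)
    then show False using c by linarith
  next
    case False
    then have e: "{i. i \<le> m \<and> w i \<in> S} = {m}" using iS wm by auto
    \<comment> \<open>The end bit is averaged over both signs, and \<open>?F\<close> does not change
      since it concerns only positions up to \<open>r\<close>.\<close>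
    have "2 * ?F (\<lambda>_. 1) = 2 * avg {m} (adjusted X Y Z S) (\<lambda>_. 1)" using one unfolding e by (simp only:)
    also have "\<dots> = ?F (\<lambda>_. 1) * ((1 + ?c) / (1 + ?C)) + ?F (\<lambda>_. 1) * ((1 - ?c) / (1 - ?C))"
      unfolding avg_single adj_eq Fm using r chain_pos by (simp add: mult_ac)
    finally have "?F (\<lambda>_. 1) * 2 = ?F (\<lambda>_. 1) * ((1 + ?c) / (1 + ?C) + (1 - ?c) / (1 - ?C))"
      by (simp only: distrib_left mult.commute)
    moreover have "?F (\<lambda>_. 1) \<noteq> 0" using F[OF signs_one] by simp
    ultimately have "2 = (1 + ?c) / (1 + ?C) + (1 - ?c) / (1 - ?C)"
      by (simp only: mult_cancel_left simp_thms)
    then show False using ratio_average_ne[OF c(2,1,3)] by simp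
  qed
qed

end

section \<open>The joint law of the visible bits of a walk\<close>

context walk_model
begin

definition partial_weight :: "nat \<Rightarrow> (nat \<Rightarrow> real) \<Rightarrow> real" where
  "partial_weight n b = (\<Prod>k\<in>{0<..n}. edge_factor k b)"

definition Hid :: "nat set" where
  "Hid = {0<..<m} - K"

definition tau :: "nat \<Rightarrow> (nat \<Rightarrow> real) \<Rightarrow> real" where
  "tau n b = (\<Prod>k\<in>K \<inter> {..<n}. b k)"

text \<open>Elimination of hidden bits from left to right: \<open>f\<close> and \<open>g\<close> are the coefficients of the
  remaining weight as an affine function of the bit \<open>b n\<close>.\<close>
definition message :: "nat \<Rightarrow> ((nat \<Rightarrow> real) \<Rightarrow> real) \<Rightarrow> ((nat \<Rightarrow> real) \<Rightarrow> real) \<Rightarrow> bool" where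
  "message n f g \<longleftrightarrow> (\<forall>u v b. ignores (Hid \<inter> {..n}) u \<longrightarrow> ignores (Hid \<inter> {..n}) v \<longrightarrow>
     avg (Hid \<inter> {..n}) (\<lambda>b. partial_weight n b * (u b + v b * b n)) b = u b * f b + v b * g b)"

text \<open>The stage before \<open>b n\<close> itself is averaged. It also makes sense at the
  visible end \<open>m\<close>, where the elimination stops.\<close>

definition premessage :: "nat \<Rightarrow> ((nat \<Rightarrow> real) \<Rightarrow> real) \<Rightarrow> ((nat \<Rightarrow> real) \<Rightarrow> real) \<Rightarrow> bool" where
  "premessage n f g \<longleftrightarrow> (\<forall>b. avg (Hid \<inter> {..<n}) (partial_weight n) b = f b + g b * b n)"

text \<open>Only the form and the positivity of the constants need to survive. Copying keeps
  \<open>b n\<close> correlated with \<open>b 0\<close>; the mixture at the first collider creates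
  \<open>1 + a * b 0\<close>; pure products in between keep the constant part at 1; the mixture at
  the last collider puts a collider term into the constant part, which is where a positive
  \<open>\<gamma>\<close> comes from.\<close>

inductive shape :: "nat \<Rightarrow> ((nat \<Rightarrow> real) \<Rightarrow> real) \<Rightarrow> ((nat \<Rightarrow> real) \<Rightarrow> real) \<Rightarrow> bool" for n where
  before: "K \<inter> {..<n} = {} \<Longrightarrow> 0 < c \<Longrightarrow> shape n (\<lambda>_. 1) (\<lambda>b. c * b 0)"
| between: "K \<inter> {..<n} \<noteq> {} \<Longrightarrow> K \<inter> {..<n} \<noteq> K \<Longrightarrow> 0 < c \<Longrightarrow> 0 < a \<Longrightarrow>
    shape n (\<lambda>_. 1) (\<lambda>b. c * (tau n b * (1 + a * b 0)))"
| after: "K \<inter> {..<n} \<noteq> {} \<Longrightarrow> K \<inter> {..<n} = K \<Longrightarrow> 0 < a \<Longrightarrow> 0 < c \<Longrightarrow> 0 < d \<Longrightarrow>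
    shape n (\<lambda>b. 1 + c * (tau n b * (1 + a * b 0))) (\<lambda>b. d * (tau n b * (1 + a * b 0)))"

lemma finHid [simp]: "finite Hid"
  by (simp add: Hid_def)

lemma tau_ignores: "n \<le> i \<Longrightarrow> tau n (b(i := t)) = tau n b"
  unfolding tau_def by (intro prod.cong) auto

lemma shape_ignores:
  assumes "shape n f g" "0 < n"
  shows "f (b(n := t)) = f b \<and> g (b(n := t)) = g b"
  using assms(1) by cases (use assms(2) in \<open>simp_all add: tau_ignores\<close>)

text \<open>Averaging \<open>(u + v * b n) * (f + g * b n)\<close> over the two signs of
  \<open>b n\<close> removes the mixed terms, since none of the coefficients reads
  \<open>b n\<close>.\<close>

lemma premessage_imp_message:
  assumes pre: "premessage n f g" and sh: "shape n f g" and n: "n \<in> Hid"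
  shows "message n f g"
  unfolding message_def
proof (intro allI impI)
  fix u v :: "(nat \<Rightarrow> real) \<Rightarrow> real" and b
  assume u: "ignores (Hid \<inter> {..n}) u" and v: "ignores (Hid \<inter> {..n}) v"
  have n0: "0 < n" using n by (simp add: Hid_def)
  have set: "Hid \<inter> {..n} = {n} \<union> (Hid \<inter> {..<n})" using n by auto
  let ?c = "\<lambda>b. u b + v b * b n"
  have ig: "ignores (Hid \<inter> {..<n}) ?c"
  proof (rule ignoresI)
    fix b b' :: "nat \<Rightarrow> real" assume *: "\<And>i. i \<notin> Hid \<inter> {..<n} \<Longrightarrow> b i = b' i"
    have "u b = u b'" by (rule ignoresD[OF u]) (use * in auto)
    moreover have "v b = v b'" by (rule ignoresD[OF v]) (use * in auto)
    moreover have "b n = b' n" by (rule *) simp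
    ultimately show "?c b = ?c b'" by simp
  qed
  have inner: "avg (Hid \<inter> {..<n}) (\<lambda>b. partial_weight n b * ?c b) = (\<lambda>b. ?c b * (f b + g b * b n))"
    using avg_mult[OF ig, of "partial_weight n"] pre
    by (simp add: premessage_def mult.commute fun_eq_iff)
  have uv: "u (b(n := t)) = u b" "v (b(n := t)) = v b" for t
    using ignores_upd[OF u, of n b t] ignores_upd[OF v, of n b t] n by simp_all
  have "avg (Hid \<inter> {..n}) (\<lambda>b. partial_weight n b * ?c b) b =
      avg {n} (avg (Hid \<inter> {..<n}) (\<lambda>b. partial_weight n b * ?c b)) b"
    unfolding set by (rule avg_union) auto
  also have "\<dots> = u b * f b + v b * g b"
    unfolding inner avg_single
    using shape_ignores[OF sh n0, of b]
    by (simp add: uv field_simps)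
  finally show "avg (Hid \<inter> {..n}) (\<lambda>b. partial_weight n b * ?c b) b = u b * f b + v b * g b" .
qed

lemma message_0: "message 0 (\<lambda>_. 1) (\<lambda>b. b 0)"
proof -
  have "Hid \<inter> {..0} = {}" by (auto simp: Hid_def)
  then show ?thesis by (simp add: message_def partial_weight_def)
qed

lemma partial_weight_Suc: "partial_weight (Suc n) b = partial_weight n b * edge_factor (Suc n) b"
proof -
  have "{0<..Suc n} = insert (Suc n) {0<..n}" by auto
  then show ?thesis by (simp add: partial_weight_def mult.commute)
qed

lemma premessage_step:
  assumes msg: "message k f g" and k: "k \<notin> K" "Suc k \<notin> K"
  shows "premessage (Suc k) f (\<lambda>b. g b / 2)"
  unfolding premessage_def
proof
  fix b
  have eq: "partial_weight (Suc k) = (\<lambda>b. partial_weight k b * (1 + (b (Suc k) / 2) * b k))"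
    using k by (auto simp: partial_weight_Suc edge_factor_def)
  have ig: "ignores (Hid \<inter> {..k}) (\<lambda>b. b (Suc k) / 2)"
    by (intro ignoresI) auto
  have "avg (Hid \<inter> {..k}) (partial_weight (Suc k)) b = 1 * f b + (b (Suc k) / 2) * g b"
    unfolding eq using msg[unfolded message_def, rule_format, OF ignores_const ig] by simp
  then show "avg (Hid \<inter> {..<Suc k}) (partial_weight (Suc k)) b = f b + g b / 2 * b (Suc k)"
    by (simp add: lessThan_Suc_atMost)
qed

text \<open>The edge into a collider carries 1 and the next edge carries the whole collider factor,
  which reads both neighbours; hence the jump over two positions. The collider bit is not averaged
  and stays in the coefficients.\<close>

lemma premessage_collider:
  assumes msg: "message j f g" and k: "Suc j \<in> K"
    and l: "\<And>t. lmap (Suc j) t = l0 + l1 * t" and r: "\<And>t. rmap (Suc j) t = r0 + r1 * t"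
  shows "premessage (Suc (Suc j)) (\<lambda>b. f b + b (Suc j) * (l0 * f b + l1 * g b) / 4 * r0)
           (\<lambda>b. b (Suc j) * (l0 * f b + l1 * g b) / 4 * r1)"
  unfolding premessage_def
proof
  fix b
  let ?R = "\<lambda>b::nat \<Rightarrow> real. r0 + r1 * b (Suc (Suc j))"
  let ?u = "\<lambda>b. 1 + b (Suc j) * ?R b * l0 / 4"
  let ?v = "\<lambda>b. b (Suc j) * ?R b * l1 / 4"
  have kk: "fwd j" "\<not> fwd (Suc j)" using k by (auto simp: K_def)
  have eq: "partial_weight (Suc (Suc j)) = (\<lambda>b. partial_weight j b * (?u b + ?v b * b j))"
    using k kk by (auto simp: partial_weight_Suc edge_factor_def mu_def l r field_simps)
  have H: "Hid \<inter> {..<Suc (Suc j)} = Hid \<inter> {..j}"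
    using k by (auto simp: Hid_def less_Suc_eq)
  have ig: "ignores (Hid \<inter> {..j}) ?u" "ignores (Hid \<inter> {..j}) ?v"
    by (intro ignoresI; simp)+
  have "avg (Hid \<inter> {..j}) (partial_weight (Suc (Suc j))) b = ?u b * f b + ?v b * g b"
    unfolding eq by (rule msg[unfolded message_def, rule_format, OF ig])
  then show "avg (Hid \<inter> {..<Suc (Suc j)}) (partial_weight (Suc (Suc j))) b =
      f b + b (Suc j) * (l0 * f b + l1 * g b) / 4 * r0 +
      b (Suc j) * (l0 * f b + l1 * g b) / 4 * r1 * b (Suc (Suc j))"
    unfolding H by (simp add: field_simps)
qed

lemma shape_0: "shape 0 (\<lambda>_. 1) (\<lambda>b. b 0)"
  using shape.before[of 0 1] by simp

lemma shape_step:
  assumes "shape k f g" "k \<notin> K"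
  shows "shape (Suc k) f (\<lambda>b. g b / 2)"
proof -
  have K: "K \<inter> {..<Suc k} = K \<inter> {..<k}" using assms(2) by (auto simp: less_Suc_eq)
  have tau: "tau (Suc k) = tau k" unfolding tau_def[abs_def] K ..
  from assms(1) show ?thesis
  proof cases
    case (before c)
    then show ?thesis using shape.before[of "Suc k" "c / 2"] K by simp
  next
    case (between c a)
    then show ?thesis using shape.between[of "Suc k" "c / 2" a] K tau by simp
  next
    case (after a c d)
    then show ?thesis using shape.after[of "Suc k" a c "d / 2"] K tau by simp
  qed
qed

lemma shape_collider:
  assumes sh: "shape j f g" and k: "Suc j \<in> K"
    and l: "\<And>t. lmap (Suc j) t = l0 + l1 * t" and r: "\<And>t. rmap (Suc j) t = r0 + r1 * t"
  shows "shape (Suc (Suc j)) (\<lambda>b. f b + b (Suc j) * (l0 * f b + l1 * g b) / 4 * r0)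
           (\<lambda>b. b (Suc j) * (l0 * f b + l1 * g b) / 4 * r1)"
proof -
  let ?k = "Suc j"
  have jK: "j \<notin> K" using K_gap(2)[OF k] by simp
  have K: "K \<inter> {..<Suc ?k} = insert ?k (K \<inter> {..<j})"
    using k jK by (auto simp: less_Suc_eq)
  have tau: "tau (Suc ?k) b = b ?k * tau j b" for b
    unfolding tau_def K by (subst prod.insert) auto
  have ne: "K \<inter> {..<j} \<noteq> K" "K \<inter> {..<Suc ?k} \<noteq> {}"
  proof -
    have "?k \<notin> K \<inter> {..<j}" by simp
    then show "K \<inter> {..<j} \<noteq> K" using k by metis
    show "K \<inter> {..<Suc ?k} \<noteq> {}" unfolding K by (rule insert_not_empty)
  qed
  have lk: "lmap ?k 0 = l0" "lmap ?k 1 = l0 + l1" and rk: "rmap ?k 0 = r0" "rmap ?k 1 = r0 + r1"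
    using l[of 0] l[of 1] r[of 0] r[of 1] by auto
  have f1: "f = (\<lambda>_. 1)" using sh by cases (use ne in auto)
  \<comment> \<open>The collider adds one term proportional to its bit. Its dependence on
    \<open>b 0\<close> arises from the mixture \<open>l0 = l1 = 1/2\<close> at the first collider
    and is inherited through \<open>g\<close> at later ones, where \<open>l0 = 0\<close>.\<close>
  have kappa: "\<exists>c>0. \<exists>a>0. \<forall>b. b ?k * (l0 * f b + l1 * g b) / 4 = c * (tau (Suc ?k) b * (1 + a * b 0))"
    using sh
  proof cases
    case (before c)
    have "?k \<le> i" if "i \<in> K" for i
    proof -
      have "\<not> i < j" using before(3) that by (auto simp: disjoint_iff)
      moreover have "i \<noteq> j" using that jK by auto
      ultimately show ?thesis by simp
    qed
    then have "?k = Min K" using k by (intro Min_eqI[symmetric] finK) auto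
    then have ll: "l0 = 1/2" "l1 = 1/2" using lk by (auto simp: lmap_def)
    have tj: "tau j b = 1" for b unfolding tau_def before(3) by simp
    have eq: "\<forall>b. b ?k * (l0 * f b + l1 * g b) / 4 = 1/8 * (tau (Suc ?k) b * (1 + c * b 0))"
      unfolding tau tj f1 ll before(2) by (simp add: algebra_simps)
    show ?thesis
      by (rule exI[of _ "1/8"], rule conjI, simp, rule exI[of _ c], rule conjI, fact before(4), fact eq)
  next
    case (between c a)
    then obtain i where "i \<in> K" "i < j" by auto
    then have "?k \<noteq> Min K" using Min_le[OF finK, of i] by linarith
    then have ll: "l0 = 0" "l1 = 1" using lk by (auto simp: lmap_def)
    have eq: "\<forall>b. b ?k * (l0 * f b + l1 * g b) / 4 = c/4 * (tau (Suc ?k) b * (1 + a * b 0))"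
      unfolding tau f1 ll between(2) by simp
    have "0 < c / 4" using between(5) by simp
    show ?thesis
      by (rule exI[of _ "c/4"], rule conjI, fact, rule exI[of _ a], rule conjI, fact between(6), fact eq)
  qed (use ne in auto)
  then obtain c a where ca: "c > 0" "a > 0"
    "\<And>b. b ?k * (l0 * f b + l1 * g b) / 4 = c * (tau (Suc ?k) b * (1 + a * b 0))" by auto
  show ?thesis
  \<comment> \<open>Only at the last collider is \<open>r0\<close> nonzero; otherwise the constant
    part stays 1.\<close>
  proof (cases "K \<inter> {..<Suc ?k} = K")
    case True
    have "i \<le> ?k" if "i \<in> K" for i
    proof -
      have "i \<in> K \<inter> {..<Suc ?k}" using that by (subst True)
      then show ?thesis by auto
    qed
    then have "?k = Max K" using k by (intro Max_eqI[symmetric] finK) auto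
    then have r01: "r0 = 1/2" "r1 = 1/2" using rk by (auto simp: rmap_def)
    show ?thesis
      unfolding ca(3) unfolding r01 f1 using shape.after[OF ne(2) True ca(2), of "c / 2" "c / 2"] ca(1)
      by (simp add: mult_ac)
  next
    case False
    then obtain i where "i \<in> K" "i \<notin> K \<inter> {..<Suc ?k}" by blast
    then have i: "i \<in> K" "?k < i" by auto
    then have "?k \<noteq> Max K" using Max_ge[OF finK i(1)] by linarith
    then have r01: "r0 = 0" "r1 = 1" using rk by (auto simp: rmap_def)
    show ?thesis
      unfolding ca(3) unfolding r01 f1 using shape.between[OF ne(2) False ca(1,2)] by simp
  qed
qed

text \<open>Strong induction, because a collider just before \<open>n\<close> sends the recursion
  two positions back. Colliders are never adjacent, so it lands on a position that is no
  collider.\<close>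

lemma exists_premessage: "0 < n \<Longrightarrow> n \<le> m \<Longrightarrow> n \<notin> K \<Longrightarrow> \<exists>f g. shape n f g \<and> premessage n f g"
proof (induction n rule: less_induct)
  case (less n)
  have msg: "\<exists>f g. shape k f g \<and> message k f g" if kn: "k < n" "k \<notin> K" for k
  proof (cases "k = 0")
    case True
    then show ?thesis using shape_0 message_0 by blast
  next
    case False
    then obtain f g where "shape k f g" "premessage k f g" using less.IH[of k] less.prems kn by auto
    moreover have "k \<in> Hid" using kn False less.prems by (auto simp: Hid_def)
    ultimately show ?thesis using premessage_imp_message by blast
  qed
  obtain k where n: "n = Suc k" using less.prems by (cases n) auto
  show ?case
  proof (cases "k \<in> K")
    case False
    with msg[of k] n obtain f g where "shape k f g" "message k f g" by auto
    with False less.prems n show ?thesis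
      using premessage_step[of k f g] shape_step[of k f g] by auto
  next
    case True
    then obtain j where k: "k = Suc j" using K_bounds[of k] by (cases k) auto
    have "j \<notin> K" using K_gap(2)[OF True] k by simp
    with msg[of j] n k obtain f g where fg: "shape j f g" "message j f g" by auto
    have l: "lmap (Suc j) t = (if Suc j = Min K then 1/2 else 0) + (if Suc j = Min K then 1/2 else 1) * t" for t
      by (simp add: lmap_def add_divide_distrib)
    have r: "rmap (Suc j) t = (if Suc j = Max K then 1/2 else 0) + (if Suc j = Max K then 1/2 else 1) * t" for t
      by (simp add: rmap_def add_divide_distrib)
    show ?thesis
      using premessage_collider[OF fg(2) _ l r] shape_collider[OF fg(1) _ l r] True n k by blast
  qed
qed

text \<open>Positive \<open>\<beta>\<close> and \<open>\<delta>\<close> tie the two ends together. A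
  positive \<open>\<gamma>\<close> means that the collider bits still inform about
  \<open>b 0\<close> after the last bit is averaged; this rests on the mixture at the last collider,
  so it is claimed only if a collider exists.\<close>

lemma hidden_average:
  obtains \<alpha> \<beta> \<gamma> \<delta> :: real where "0 \<le> \<alpha>" "0 < \<beta>" "0 \<le> \<gamma>" "0 < \<delta>" "K \<noteq> {} \<Longrightarrow> 0 < \<gamma>"
    "\<And>b. avg Hid (P {}) b = 1 + (\<Prod>k\<in>K. b k) * (\<alpha> + \<beta> * b 0) * (\<gamma> + \<delta> * b m)"
proof -
  have mK: "m \<notin> K" by (simp add: K_def)
  from exists_premessage[OF m_pos order_refl mK] obtain f g where fg: "shape m f g" "premessage m f g" by blast
  have Km: "K \<inter> {..<m} = K" by (auto simp: K_def)
  have H: "Hid \<inter> {..<m} = Hid" by (auto simp: Hid_def)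
  have P: "P {} = partial_weight m" by (auto simp: P_edge_factors partial_weight_def)
  have val: "avg Hid (P {}) b = f b + g b * b m" for b
    using fg(2) unfolding premessage_def H P by blast
  have tau: "tau m b = (\<Prod>k\<in>K. b k)" for b unfolding tau_def Km ..
  from fg(1) show thesis
  proof cases
    case (before c)
    show thesis
    proof (rule that[of 0 c 0 1])
      show "avg Hid (P {}) b = 1 + (\<Prod>k\<in>K. b k) * (0 + c * b 0) * (0 + 1 * b m)" for b
        unfolding val using before Km by simp
    qed (use before Km in auto)
  next
    case (between c a)
    then show thesis using Km by simp
  next
    case (after a c d)
    show thesis
    proof (rule that[of 1 a c d])
      show "avg Hid (P {}) b = 1 + (\<Prod>k\<in>K. b k) * (1 + a * b 0) * (c + d * b m)" for b
        unfolding val after tau by (simp add: algebra_simps)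
    qed (use after in auto)
  qed
qed

end

section \<open>Open non-causal walks\<close>

lemma signs_prod:
  assumes "finite F" "signs b" shows "prod b F = 1 \<or> prod b F = -1"
  using assms(1)
proof (induction F rule: finite_induct)
  case (insert k F)
  then show ?case using assms(2) by (auto simp: signs_def dest: spec[of _ k])
qed simp

locale adjustment_walk = adjustment_setting V E X Y Z S
  for V :: "'v set" and E X Y Z S +
  fixes m :: nat and w :: "nat \<Rightarrow> 'v"
  assumes pos: "0 < m"
    and step: "i < m \<Longrightarrow> (w i, w (Suc i)) \<in> E \<or> (w (Suc i), w i) \<in> E"
    and ends: "w 0 \<in> X" "w m \<in> Y"
    and colliders: "0 < i \<Longrightarrow> i < m \<Longrightarrow> (w (i - 1), w i) \<in> E \<Longrightarrow> (w (Suc i), w i) \<in> E \<Longrightarrow>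
      w i \<in> X \<union> S \<union> Z"
    and noncolliders: "0 < i \<Longrightarrow> i < m \<Longrightarrow> \<not> ((w (i - 1), w i) \<in> E \<and> (w (Suc i), w i) \<in> E) \<Longrightarrow>
      w i \<notin> X \<union> Y \<union> S \<union> Z"
    and noncausal: "\<exists>i<m. (w (Suc i), w i) \<in> E"
begin

sublocale walk_model V E m w
  by unfold_locales (use DAG pos step in auto)

lemma not_fwd: "i < m \<Longrightarrow> \<not> fwd i \<longleftrightarrow> (w (Suc i), w i) \<in> E"
proof -
  assume i: "i < m"
  have "\<not> ((w i, w (Suc i)) \<in> E \<and> (w (Suc i), w i) \<in> E)"
    using acyc by (meson acyclic_def r_into_trancl' trancl_trans)
  then show ?thesis using step[OF i] by (auto simp: fwd_def)
qed

lemma K_iff: "i \<in> K \<longleftrightarrow> 0 < i \<and> i < m \<and> (w (i - 1), w i) \<in> E \<and> (w (Suc i), w i) \<in> E"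
  using not_fwd[of i] by (auto simp: K_def fwd_def)

lemma K_label: "i \<in> K \<Longrightarrow> w i \<in> X \<union> S \<union> Z"
  using colliders[of i] by (auto simp: K_iff)

lemma Hid_label: "i \<in> Hid \<Longrightarrow> w i \<notin> X \<union> Y \<union> S \<union> Z"
  using noncolliders[of i] by (auto simp: Hid_def K_iff)

definition T :: "nat set" where "T = {0, m} \<union> K"

text \<open>The joint law of the visible bits; every marginal needed below is an average of it over
  some positions in \<open>T\<close>.\<close>

definition \<Phi> :: "(nat \<Rightarrow> real) \<Rightarrow> real" where "\<Phi> = avg Hid (P {})"

lemma finT [simp]: "finite T"
  using finK by (simp add: T_def)

lemma positions: "i \<le> m \<longleftrightarrow> i \<in> T \<or> i \<in> Hid" and T_Hid: "i \<in> T \<Longrightarrow> i \<notin> Hid"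
  using K_bounds[of i] pos by (auto simp: T_def Hid_def)

lemma avg_T: "J \<subseteq> T \<Longrightarrow> avg (J \<union> Hid) (P {}) = avg J \<Phi>"
  unfolding \<Phi>_def by (intro ext avg_union) (auto intro: finite_subset[OF _ finT] dest: T_Hid)

lemma M_obs_T:
  assumes "B \<subseteq> X \<union> Y \<union> Z \<union> S"
  shows "M {} B = avg {i \<in> T. w i \<notin> B} \<Phi>"
proof -
  have "w i \<notin> B" if "i \<in> Hid" for i using Hid_label[OF that] assms by blast
  then have "{i. i \<le> m \<and> w i \<notin> B} = {i \<in> T. w i \<notin> B} \<union> Hid"
    using positions by blast
  then show ?thesis unfolding M_obs by (simp add: avg_T)
qed

lemma K_sink: "i \<in> K \<Longrightarrow> sink i"
  by (simp add: K_def sink_def)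

lemma sink_0: "sink 0 \<longleftrightarrow> \<not> fwd 0"
  using pos by (simp add: sink_def)

lemma X_position: "i \<le> m \<Longrightarrow> w i \<in> X \<Longrightarrow> i = 0 \<or> i \<in> K"
  using positions[of i] Hid_label[of i] ends disj by (auto simp: T_def)

lemma M_do_T:
  assumes "B \<subseteq> X \<union> Y \<union> Z \<union> S"
  shows "M X B = avg {i \<in> T. w i \<notin> X \<union> B \<or> w i \<in> X \<and> sink i} \<Phi>"
proof -
  have "w i \<notin> X \<union> B" if "i \<in> Hid" for i using Hid_label[OF that] assms by blast
  then have "{i. i \<le> m \<and> w i \<notin> X \<union> B} \<union> {i. i \<le> m \<and> w i \<in> X \<and> sink i} =
      {i \<in> T. w i \<notin> X \<union> B \<or> w i \<in> X \<and> sink i} \<union> Hid"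
    using positions by blast
  moreover have "M X B = avg ({i. i \<le> m \<and> w i \<notin> X \<union> B} \<union> {i. i \<le> m \<and> w i \<in> X \<and> sink i}) (P {})"
    by (rule M_do_sinks) (use X_position K_sink sink_0 in blast)
  ultimately show ?thesis by (simp add: avg_T)
qed

lemma M_obs_eq:
  "{i \<in> T. w i \<notin> B} = J \<Longrightarrow> B \<subseteq> X \<union> Y \<union> Z \<union> S \<Longrightarrow> M {} B b = avg J \<Phi> b"
  by (simp only: M_obs_T)

lemma M_do_eq:
  "{i \<in> T. w i \<notin> X \<union> B \<or> w i \<in> X \<and> sink i} = J \<Longrightarrow> B \<subseteq> X \<union> Y \<union> Z \<union> S \<Longrightarrow> M X B b = avg J \<Phi> b"
  by (simp only: M_do_T)

text \<open>Follow the walk to its first backward edge. The position where it turns is a collider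
  and a descendant of \<open>w 0\<close>, so it is not in \<open>Z\<close>.\<close>

lemma collider_outside_Z:
  assumes "fwd 0" obtains k where "k \<in> K" "w k \<in> X \<union> S"
proof -
  define k where "k = (LEAST i. i < m \<and> \<not> fwd i)"
  obtain i where "i < m" "\<not> fwd i" using noncausal not_fwd by blast
  then have k: "k < m" "\<not> fwd k"
    using LeastI[of "\<lambda>i. i < m \<and> \<not> fwd i" i] by (simp_all add: k_def)
  have before: "fwd i" if "i < k" for i
    using not_less_Least[of i "\<lambda>i. i < m \<and> \<not> fwd i"] that k(1) unfolding k_def by auto
  have "0 < k" using assms k by (cases k) auto
  then have kK: "k \<in> K" using k before by (simp add: K_def)
  have "(w 0, w i) \<in> E\<^sup>*" if "i \<le> k" for i
    using that
  proof (induction i)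
    case (Suc i)
    then show ?case using before[of i] by (auto simp: fwd_def intro: rtrancl_into_rtrancl)
  qed simp
  then have "w k \<in> De E X" using ends by (auto simp: De_def)
  then have "w k \<notin> Z" using Z_nondesc by blast
  then show thesis using that K_label[OF kK] kK by blast
qed

text \<open>Flipping \<open>b i\<close> flips the product of all collider bits, so the second term
  cancels.\<close>

lemma avg_odd_in_collider:
  assumes "finite J" "i \<in> J" "i \<in> K" "ignores {i} h"
  shows "avg J (\<lambda>b. c + (\<Prod>k\<in>K. b k) * h b) b = c"
proof -
  let ?F = "\<lambda>b. c + (\<Prod>k\<in>K. b k) * h b"
  have J: "J = (J - {i}) \<union> {i}" using assms by auto
  have prod: "(\<Prod>k\<in>K. (b(i := t)) k) = t * (\<Prod>k\<in>K - {i}. b k)" for b :: "nat \<Rightarrow> real" and t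
  proof -
    have "(\<Prod>k\<in>K - {i}. (b(i := t)) k) = (\<Prod>k\<in>K - {i}. b k)" by (intro prod.cong) auto
    then show ?thesis using prod.remove[OF finK assms(3), of "b(i := t)"] by simp
  qed
  have "avg {i} ?F = (\<lambda>_. c)"
    unfolding avg_single prod by (auto simp: ignores_upd[OF assms(4)])
  then have "avg ((J - {i}) \<union> {i}) ?F b = c"
    using assms by (subst avg_union) auto
  then show ?thesis using J by simp
qed

lemma open_walk_contradiction: False
proof -
  obtain \<alpha> \<beta> \<gamma> \<delta> :: real where pars: "0 \<le> \<alpha>" "0 < \<beta>" "0 \<le> \<gamma>" "0 < \<delta>" "K \<noteq> {} \<Longrightarrow> 0 < \<gamma>"
    and \<Phi>: "\<And>b. \<Phi> b = 1 + (\<Prod>k\<in>K. b k) * (\<alpha> + \<beta> * b 0) * (\<gamma> + \<delta> * b m)"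
    using hidden_average unfolding \<Phi>_def by metis
  let ?\<tau> = "\<lambda>b::nat \<Rightarrow> real. \<Prod>k\<in>K. b k"
  let ?p = "\<alpha> + \<beta>" and ?q = "\<gamma> + \<delta>"
  let ?one = "\<lambda>_::nat. 1::real"
  have K0: "0 \<notin> K" "m \<notin> K" "m \<noteq> 0" using K_bounds[of 0] K_bounds[of m] pos by auto
  have \<tau>upd: "?\<tau> (b(i := t)) = ?\<tau> b" if "i \<notin> K" for b i t
    using that by (intro prod.cong) auto
  have cut: "avg J \<Phi> b = 1" if J: "J \<subseteq> T" "i \<in> J" "i \<in> K" for J i b
  proof -
    have "\<Phi> = (\<lambda>b. 1 + ?\<tau> b * ((\<alpha> + \<beta> * b 0) * (\<gamma> + \<delta> * b m)))"
      by (auto simp: \<Phi> mult.assoc)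
    moreover have "0 \<noteq> i" "m \<noteq> i" using J(3) K0(1,2) by blast+
    then have "ignores {i} (\<lambda>b. (\<alpha> + \<beta> * b 0) * (\<gamma> + \<delta> * b m))"
      by (intro ignoresI) simp
    moreover have "finite J" using J(1) by (rule finite_subset) simp
    ultimately show ?thesis using avg_odd_in_collider J by simp
  qed
  have avg0: "avg {0} \<Phi> b = 1 + ?\<tau> b * \<alpha> * (\<gamma> + \<delta> * b m)" for b
    unfolding avg_single \<Phi> \<tau>upd[OF K0(1)] using K0 by (simp add: field_simps)
  have avgm: "avg {m} \<Phi> b = 1 + ?\<tau> b * (\<alpha> + \<beta> * b 0) * \<gamma>" for b
    unfolding avg_single \<Phi> \<tau>upd[OF K0(2)] using K0 by (simp add: field_simps)
  have avg0m: "avg {0, m} \<Phi> b = 1 + ?\<tau> b * \<alpha> * \<gamma>" for b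
  proof -
    have "avg {0, m} \<Phi> b = avg ({m} \<union> {0}) \<Phi> b" by (simp add: insert_commute)
    also have "\<dots> = avg {m} (avg {0} \<Phi>) b" using K0 by (intro avg_union) auto
    also have "\<dots> = 1 + ?\<tau> b * \<alpha> * \<gamma>"
      unfolding avg_single[of m] avg0 \<tau>upd[OF K0(2)] using K0 by (simp add: field_simps)
    finally show ?thesis .
  qed
  have identity: "M X (Y \<union> Z) ?one / M X Z ?one = avg {i. i \<le> m \<and> w i \<in> S} (adjusted X Y Z S) ?one"
    using adjustment_identity[OF sub(1-4) disj(1,3,4,5,6) adj] by simp
  have S_set: "{i. i \<le> m \<and> w i \<in> S} = {i \<in> K. w i \<in> S}"
  proof (intro set_eqI iffI)
    fix i assume i: "i \<in> {i. i \<le> m \<and> w i \<in> S}"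
    then have "i \<noteq> 0" "i \<noteq> m" "i \<notin> Hid" using ends disj Hid_label[of i] by auto
    then show "i \<in> {i \<in> K. w i \<in> S}" using i positions[of i] by (auto simp: T_def)
  next
    fix i assume "i \<in> {i \<in> K. w i \<in> S}"
    then show "i \<in> {i. i \<le> m \<and> w i \<in> S}" using K_bounds[of i] by auto
  qed
  have T_XZS: "{i \<in> T. w i \<notin> X \<union> Z \<union> S} = {m}"
    using K_label ends disj unfolding T_def by blast
  have T_YXZS: "{i \<in> T. w i \<notin> Y \<union> (X \<union> Z \<union> S)} = {}"
    using K_label ends unfolding T_def by blast
  have M1: "M {} (Y \<union> (X \<union> Z \<union> S)) b = \<Phi> b" for b
    by (subst M_obs_eq[OF T_YXZS]) auto
  have M2: "M {} (X \<union> Z \<union> S) b = 1 + ?\<tau> b * (\<alpha> + \<beta> * b 0) * \<gamma>" for b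
    by (subst M_obs_eq[OF T_XZS]) (auto simp: avgm)
  have one: "?\<tau> ?one = 1" by simp
  show False
  proof (cases "\<exists>k\<in>K. w k \<in> X \<union> S")
    \<comment> \<open>All colliders lie in \<open>Z\<close>, so the walk must leave \<open>X\<close>
      against an arrow. Intervention averages \<open>b 0\<close> and turns
      \<open>\<alpha> + \<beta>\<close> into \<open>\<alpha>\<close>, while conditioning keeps the
      sum; cross multiplication leaves \<open>\<beta> * \<delta>\<close>.\<close>
    case False
    then have KZ: "w k \<in> Z" "w k \<notin> X" "w k \<notin> S" if "k \<in> K" for k
      using K_label[OF that] that by auto
    have nf: "\<not> fwd 0" using collider_outside_Z False by blast
    have wz: "w 0 \<notin> Y" "w 0 \<notin> Z" "w 0 \<notin> S" "w m \<notin> X" "w m \<notin> Z" "w m \<notin> S" using ends disj by auto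
    have e1: "{i \<in> T. w i \<notin> X \<union> (Y \<union> Z) \<or> w i \<in> X \<and> sink i} = {0}"
      using KZ ends wz nf sink_0 unfolding T_def by blast
    have L1: "M X (Y \<union> Z) ?one = 1 + \<alpha> * ?q"
      by (subst M_do_eq[OF e1]) (auto simp: avg0)
    have e2: "{i \<in> T. w i \<notin> X \<union> Z \<or> w i \<in> X \<and> sink i} = {0, m}"
      using KZ ends wz nf sink_0 unfolding T_def by blast
    have L2: "M X Z ?one = 1 + \<alpha> * \<gamma>"
      by (subst M_do_eq[OF e2]) (auto simp: avg0m)
    have e3: "{i \<in> T. w i \<notin> S \<union> Z} = {0, m}" "{i \<in> T. w i \<notin> Z} = {0, m}"
      using KZ ends wz unfolding T_def by blast+
    have "M {} (S \<union> Z) = M {} Z"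
    proof
      fix b
      have "M {} (S \<union> Z) b = avg {0, m} \<Phi> b" by (rule M_obs_eq[OF e3(1)]) auto
      also have "\<dots> = M {} Z b" by (rule M_obs_eq[OF e3(2), symmetric]) auto
      finally show "M {} (S \<union> Z) b = M {} Z b" .
    qed
    then have "M {} (S \<union> Z) ?one / M {} Z ?one = 1" using M_pos[OF signs_one, of "{}" Z] by simp
    moreover have e4: "{i. i \<le> m \<and> w i \<in> S} = {}" unfolding S_set using KZ by auto
    ultimately have "(1 + \<alpha> * ?q) / (1 + \<alpha> * \<gamma>) = (1 + ?p * ?q) / (1 + ?p * \<gamma>)"
      using identity unfolding L1 L2 e4 by (simp add: adjusted_def M1 M2 \<Phi>)
    moreover have "0 < 1 + \<alpha> * \<gamma>" "0 < 1 + ?p * \<gamma>" using pars by (auto intro: add_pos_nonneg)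
    ultimately have "(1 + \<alpha> * ?q) * (1 + ?p * \<gamma>) = (1 + ?p * ?q) * (1 + \<alpha> * \<gamma>)"
      by (simp add: frac_eq_eq)
    then have "\<beta> * \<delta> = 0" by (simp add: algebra_simps)
    then show False using pars by simp
  next
    case True
    then obtain k where k: "k \<in> K" "w k \<in> X \<union> S" by blast
    then have kT: "k \<in> T" and kZ: "w k \<notin> Z" "w k \<notin> Y" using disj by (auto simp: T_def)
    have "0 < \<gamma>" using pars(5) k by auto
    have pp: "0 < ?p" using pars by simp
    \<comment> \<open>A collider in \<open>X\<close> is averaged as a sink and one in
      \<open>S\<close> as unseen; either removes the product of the collider bits.\<close>
    have "M X B ?one = 1" if "B \<subseteq> Y \<union> Z" for B
      using that k kT kZ K_sink[OF k(1)] by (subst M_do_T) (auto intro!: cut[of _ k])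
    then have L: "M X (Y \<union> Z) ?one / M X Z ?one = 1" by simp
    have MZ: "M {} Z b = 1" for b
      using k kT kZ by (subst M_obs_T) (auto intro!: cut[of _ k])
    show False
    proof (cases "\<exists>k\<in>K. w k \<in> S")
      \<comment> \<open>Nothing is averaged on the adjusted side, where conditioning on the collider
        in \<open>X\<close> makes the ends dependent.\<close>
      case False
      then have "w k \<in> X" "w k \<notin> S" using k by auto
      then have "M {} (S \<union> Z) b = 1" for b
        using k kT kZ by (subst M_obs_T) (auto intro!: cut[of _ k])
      moreover have e4: "{i. i \<le> m \<and> w i \<in> S} = {}" unfolding S_set using False by auto
      ultimately have "1 = (1 + ?p * ?q) / (1 + ?p * \<gamma>)"
        using identity unfolding L e4 by (simp add: adjusted_def M1 M2 MZ \<Phi>)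
      moreover have "0 < 1 + ?p * \<gamma>" using pars by (auto intro: add_pos_nonneg)
      ultimately have "?p * \<delta> = 0" by (simp add: algebra_simps)
      then show False using pars pp by simp
    next
      case True
      then obtain s where s: "s \<in> K" "w s \<in> S" by blast
      \<comment> \<open>The collider coefficient in f(s, z): a collider in \<open>X\<close> is
        averaged there and removes the term; otherwise only the two ends are averaged, leaving
        \<open>\<alpha> * \<gamma>\<close>.\<close>
      define C where "C = (if \<exists>k\<in>K. w k \<in> X then 0 else \<alpha> * \<gamma>)"
      let ?A = "?p * ?q" and ?D = "?p * \<gamma>"
      have MSZ: "M {} (S \<union> Z) b = 1 + ?\<tau> b * C" for b
      proof (cases "\<exists>k\<in>K. w k \<in> X")
        case True
        then obtain j where j: "j \<in> K" "w j \<in> X" by blast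
        then have "w j \<notin> S \<union> Z" "j \<in> T" using disj by (auto simp: T_def)
        then have "M {} (S \<union> Z) b = 1"
          using j by (subst M_obs_T) (auto intro!: cut[of _ j])
        then show ?thesis using True by (simp add: C_def)
      next
        case False
        then have e3: "{i \<in> T. w i \<notin> S \<union> Z} = {0, m}"
          using K_label ends disj unfolding T_def by blast
        show ?thesis using False by (subst M_obs_eq[OF e3]) (auto simp: avg0m C_def mult.assoc)
      qed
      \<comment> \<open>\<open>1 - ?D\<close> is the value of a marginal at an assignment whose
        collider product is -1, and marginals are positive.\<close>
      have D1: "?D < 1"
      proof -
        let ?b = "(\<lambda>_. 1)(s := -1) :: nat \<Rightarrow> real"
        have "?\<tau> ?b = -1"
        proof -
          have "(\<Prod>k\<in>K - {s}. ?b k) = 1" by (intro prod.neutral) auto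
          then show ?thesis using prod.remove[OF finK s(1), of ?b] by simp
        qed
        moreover have "s \<noteq> 0" using K0(1) s(1) by metis
        moreover have "0 < M {} (X \<union> Z \<union> S) ?b" by (rule M_pos[OF signs_upd(2)[OF signs_one]])
        ultimately show ?thesis unfolding M2 by (simp add: algebra_simps)
      qed
      have D0: "0 < ?D" using pp \<open>0 < \<gamma>\<close> by simp
      have D2: "1 - ?D * ?D \<noteq> 0" "1 + ?D \<noteq> 0" "1 - ?D \<noteq> 0"
      proof -
        have "?D * ?D < 1 * 1" using D0 D1 by (intro mult_strict_mono) auto
        then show "1 - ?D * ?D \<noteq> 0" "1 + ?D \<noteq> 0" "1 - ?D \<noteq> 0" using D0 D1 by auto
      qed
      \<comment> \<open>At \<open>t = 1\<close> and at \<open>t = -1\<close> the quotient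
        \<open>(1 + t * A) * (1 + t * C) / (1 + t * D)\<close> agrees with \<open>u + t * v\<close>.
        Only the even part \<open>u\<close> survives the averaging over a collider in
        \<open>S\<close>.\<close>
      define u v where "u = (1 + ?A * C - ?D * (?A + C)) / (1 - ?D * ?D)"
        and "v = (?A + C - ?D * (1 + ?A * C)) / (1 - ?D * ?D)"
      have adj_eq: "adjusted X Y Z S b = u + ?\<tau> b * v"
        if b: "signs b" "b 0 = 1" "b m = 1" for b
      proof -
        have t: "?\<tau> b = 1 \<or> ?\<tau> b = -1" by (rule signs_prod[OF finK b(1)])
        have "adjusted X Y Z S b = (1 + ?\<tau> b * ?A) / (1 + ?\<tau> b * ?D) * (1 + ?\<tau> b * C)"
          unfolding adjusted_def M1 M2 MZ MSZ \<Phi> using b by (simp add: mult.assoc)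
        also have "\<dots> = u + ?\<tau> b * v"
          using t
        proof
          assume t: "?\<tau> b = 1"
          have "(1 + ?A) * (1 + C) * (1 - ?D) = 1 + ?A * C - ?D * (?A + C) + (?A + C - ?D * (1 + ?A * C))"
            by (simp add: algebra_simps)
          moreover have "1 - ?D * ?D = (1 + ?D) * (1 - ?D)" by (simp add: algebra_simps)
          ultimately have "u + v = (1 + ?A) * (1 + C) * (1 - ?D) / ((1 + ?D) * (1 - ?D))"
            unfolding u_def v_def by (simp only: add_divide_distrib)
          also have "\<dots> = (1 + ?A) / (1 + ?D) * (1 + C)" using D2 by simp
          finally show ?thesis unfolding t by simp
        next
          assume t: "?\<tau> b = -1"
          have "(1 - ?A) * (1 - C) * (1 + ?D) = 1 + ?A * C - ?D * (?A + C) - (?A + C - ?D * (1 + ?A * C))"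
            by (simp add: algebra_simps)
          moreover have "1 - ?D * ?D = (1 - ?D) * (1 + ?D)" by (simp add: algebra_simps)
          ultimately have "u - v = (1 - ?A) * (1 - C) * (1 + ?D) / ((1 - ?D) * (1 + ?D))"
            unfolding u_def v_def by (simp only: diff_divide_distrib)
          also have "\<dots> = (1 - ?A) / (1 - ?D) * (1 - C)" using D2 by simp
          finally show ?thesis unfolding t by simp
        qed
        finally show ?thesis .
      qed
      have "avg {i \<in> K. w i \<in> S} (adjusted X Y Z S) ?one = avg {i \<in> K. w i \<in> S} (\<lambda>b. u + ?\<tau> b * v) ?one"
      proof (rule avg_cong[OF signs_one])
        fix b assume "signs b" "\<And>i. i \<notin> {i \<in> K. w i \<in> S} \<Longrightarrow> b i = 1"
        then show "adjusted X Y Z S b = u + ?\<tau> b * v" using K0 by (intro adj_eq) auto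
      qed
      also have "\<dots> = u"
        using s finK by (intro avg_odd_in_collider[of _ s]) auto
      finally have "u = 1" using identity unfolding L S_set by simp
      then have "(?A - ?D) * (C - ?D) = 0"
        unfolding u_def using D2 by (simp add: divide_eq_eq algebra_simps)
      moreover have "?A - ?D = ?p * \<delta>" by (simp add: algebra_simps)
      then have "?A - ?D \<noteq> 0" using pp pars(4) by simp
      moreover have "C - ?D \<noteq> 0"
      proof (cases "\<exists>k\<in>K. w k \<in> X")
        case True
        then have "C = 0" by (simp add: C_def)
        then show ?thesis using D0 by linarith
      next
        case False
        then have "C - ?D = - (\<beta> * \<gamma>)" by (simp add: C_def algebra_simps)
        then show ?thesis using pars(2) \<open>0 < \<gamma>\<close> by simp
      qed
      ultimately show False by simp
    qed
  qed
qed

end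

section \<open>Walks in the DAG\<close>

context adjustment_setting
begin

lemma edge_asym: "(u, v) \<in> E \<Longrightarrow> (v, u) \<notin> E"
  using DAG unfolding is_DAG_def by (meson acyclic_def r_into_trancl' trancl_trans)

text \<open>\<open>reach v a n\<close>: an open walk from \<open>X\<close> ends in \<open>v\<close>, its last edge points into \<open>v\<close> iff \<open>a\<close>, and if
  \<open>n\<close> then some edge is traversed backwards.\<close>
inductive reach :: "'v \<Rightarrow> bool \<Rightarrow> bool \<Rightarrow> bool" where
  start_fwd: "x \<in> X \<Longrightarrow> (x, v) \<in> E \<Longrightarrow> reach v True False"
| start_bwd: "x \<in> X \<Longrightarrow> (v, x) \<in> E \<Longrightarrow> reach v False True"
| through: "reach v a n \<Longrightarrow> v \<notin> X \<union> Y \<union> S \<union> Z \<Longrightarrow> (v, u) \<in> E \<Longrightarrow> reach u True n"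
| backward: "reach v False n \<Longrightarrow> v \<notin> X \<union> Y \<union> S \<union> Z \<Longrightarrow> (u, v) \<in> E \<Longrightarrow> reach u False True"
| collide: "reach v True n \<Longrightarrow> v \<in> X \<union> S \<union> Z \<Longrightarrow> (u, v) \<in> E \<Longrightarrow> reach u False True"

text \<open>\<open>reach\<close> with explicit positions. Interior positions are already checked but
  the end \<open>v\<close> is not, since the next edge decides whether it becomes a
  collider.\<close>

definition walk_to :: "nat \<Rightarrow> (nat \<Rightarrow> 'v) \<Rightarrow> 'v \<Rightarrow> bool \<Rightarrow> bool \<Rightarrow> bool" where
  "walk_to m w v a n \<longleftrightarrow> 0 < m \<and> w 0 \<in> X \<and> w m = v \<and> (a \<longleftrightarrow> (w (m - 1), w m) \<in> E) \<and>
     (\<forall>i<m. (w i, w (Suc i)) \<in> E \<or> (w (Suc i), w i) \<in> E) \<and>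
     (\<forall>i. 0 < i \<and> i < m \<longrightarrow>
        (if (w (i - 1), w i) \<in> E \<and> (w (Suc i), w i) \<in> E then w i \<in> X \<union> S \<union> Z
         else w i \<notin> X \<union> Y \<union> S \<union> Z)) \<and>
     (n \<longrightarrow> (\<exists>i<m. (w (Suc i), w i) \<in> E))"

lemma walk_to_extend:
  assumes w: "walk_to m w v a n" and e: "(v, u) \<in> E \<or> (u, v) \<in> E"
    and v: "if a \<and> (u, v) \<in> E then v \<in> X \<union> S \<union> Z else v \<notin> X \<union> Y \<union> S \<union> Z"
    and n: "n' \<Longrightarrow> n \<or> (u, v) \<in> E" and a': "a' \<longleftrightarrow> (v, u) \<in> E"
  shows "walk_to (Suc m) (w(Suc m := u)) u a' n'"
proof -
  let ?w = "w(Suc m := u)"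
  have m: "0 < m" "w m = v" using w by (auto simp: walk_to_def)
  have 1: "(?w i, ?w (Suc i)) \<in> E \<or> (?w (Suc i), ?w i) \<in> E" if "i < Suc m" for i
    using that w e m by (cases "i = m") (auto simp: walk_to_def)
  have 2: "if (?w (i - 1), ?w i) \<in> E \<and> (?w (Suc i), ?w i) \<in> E then ?w i \<in> X \<union> S \<union> Z
         else ?w i \<notin> X \<union> Y \<union> S \<union> Z" if "0 < i" "i < Suc m" for i
  proof (cases "i = m")
    case True
    have a: "a = ((w (m - 1), v) \<in> E)" using w m by (simp add: walk_to_def)
    have "?w (i - 1) = w (m - 1)" "?w i = v" "?w (Suc i) = u" using True m by auto
    then show ?thesis using v unfolding a by (simp only:)
  next
    case False
    then have "i < m" using that by simp
    then have "?w (i - 1) = w (i - 1)" "?w i = w i" "?w (Suc i) = w (Suc i)" by auto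
    moreover have "if (w (i - 1), w i) \<in> E \<and> (w (Suc i), w i) \<in> E then w i \<in> X \<union> S \<union> Z
         else w i \<notin> X \<union> Y \<union> S \<union> Z"
      using w that(1) \<open>i < m\<close> unfolding walk_to_def by blast
    ultimately show ?thesis by (simp only:)
  qed
  have 3: "\<exists>i<Suc m. (?w (Suc i), ?w i) \<in> E" if "n'"
  proof -
    from n[OF that] show ?thesis
    proof
      assume n
      then obtain i where "i < m" "(w (Suc i), w i) \<in> E" using w by (auto simp: walk_to_def)
      then show ?thesis by (intro exI[of _ i]) auto
    next
      assume "(u, v) \<in> E"
      then show ?thesis using m by (intro exI[of _ m]) auto
    qed
  qed
  have "?w 0 \<in> X" using w by (simp add: walk_to_def)
  moreover have "?w (Suc m) = u" "a' = ((?w (Suc m - 1), ?w (Suc m)) \<in> E)" using m a' by simp_all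
  ultimately show ?thesis
    unfolding walk_to_def using 1 2 3 by blast
qed

lemma reach_imp_walk: "reach v a n \<Longrightarrow> \<exists>m w. walk_to m w v a n"
proof (induction rule: reach.induct)
  case (start_fwd x v)
  then have "walk_to 1 (\<lambda>i. if i = 0 then x else v) v True False"
    by (auto simp: walk_to_def)
  then show ?case by blast
next
  case (start_bwd x v)
  then have "walk_to 1 (\<lambda>i. if i = 0 then x else v) v False True"
    using edge_asym by (auto simp: walk_to_def)
  then show ?case by blast
next
  case (through v a n u)
  then obtain m w where "walk_to m w v a n" by blast
  then have "walk_to (Suc m) (w(Suc m := u)) u True n"
    by (rule walk_to_extend) (use through edge_asym in auto)
  then show ?case by blast
next
  case (backward v n u)
  then obtain m w where "walk_to m w v False n" by blast
  then have "walk_to (Suc m) (w(Suc m := u)) u False True"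
    by (rule walk_to_extend) (use backward edge_asym in auto)
  then show ?case by blast
next
  case (collide v n u)
  then obtain m w where "walk_to m w v True n" by blast
  then have "walk_to (Suc m) (w(Suc m := u)) u False True"
    by (rule walk_to_extend) (use collide edge_asym in auto)
  then show ?case by blast
qed

lemma no_open_noncausal_walk:
  assumes "reach y a True" "y \<in> Y"
  shows False
proof -
  obtain m w where w: "walk_to m w y a True" using reach_imp_walk[OF assms(1)] by blast
  interpret adjustment_walk V E X Y Z S m w
  proof
    show "w i \<in> X \<union> S \<union> Z" if "0 < i" "i < m" "(w (i - 1), w i) \<in> E" "(w (Suc i), w i) \<in> E" for i
      using w that unfolding walk_to_def by presburger
    show "w i \<notin> X \<union> Y \<union> S \<union> Z" if "0 < i" "i < m" "\<not> ((w (i - 1), w i) \<in> E \<and> (w (Suc i), w i) \<in> E)" for i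
      using w that unfolding walk_to_def by presburger
  qed (use w assms(2) in \<open>auto simp: walk_to_def\<close>)
  show False by (rule open_walk_contradiction)
qed

text \<open>Restricting sources only lets a directed path end in \<open>Q\<close> without passing
  through it.\<close>

definition E_from :: "'v set \<Rightarrow> ('v \<times> 'v) set" where
  "E_from Q = {(u, v) \<in> E. u \<notin> Q}"

lemma E_from_mono: "Q \<subseteq> Q' \<Longrightarrow> E_from Q' \<subseteq> E_from Q"
  by (auto simp: E_from_def)

lemma E_from_sub: "(E_from Q)\<^sup>* \<subseteq> E\<^sup>*"
  by (rule rtrancl_mono) (auto simp: E_from_def)

lemma E_from_source: "(a, b) \<in> (E_from Q)\<^sup>+ \<Longrightarrow> a \<notin> Q"
  by (auto simp: E_from_def dest: tranclD)

lemma first_hit: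
  assumes "(a, s) \<in> E\<^sup>*" "s \<in> T"
  shows "\<exists>t\<in>T. (a, t) \<in> (E_from T)\<^sup>*"
  using assms
proof (induction rule: converse_rtrancl_induct)
  case (step a b)
  then obtain t where t: "t \<in> T" "(b, t) \<in> (E_from T)\<^sup>*" by blast
  show ?case
  proof (cases "a \<in> T")
    case False
    then have "(a, b) \<in> E_from T" using step by (simp add: E_from_def)
    then show ?thesis using t by (blast intro: converse_rtrancl_into_rtrancl)
  qed blast
qed blast

abbreviation "hidden_edges \<equiv> E_from (X \<union> Y \<union> S \<union> Z)"

lemma reach_down:
  assumes "reach v a n" "(v, t) \<in> hidden_edges\<^sup>+"
  shows "reach t True n"
  using assms(2,1)
proof (induction rule: trancl_induct)
  case (base t)
  then show ?case using through[of v a n t] by (auto simp: E_from_def)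
next
  case (step t u)
  then show ?case using through[of t True n u] by (auto simp: E_from_def)
qed

text \<open>The second half of the detour that starts with \<open>reach_down\<close>: the visible
  node \<open>t\<close> serves as a collider and the walk climbs the same edges again, arriving at
  \<open>v\<close> against the arrow, so that \<open>v\<close> no longer has to act as a
  collider.\<close>

lemma reach_up:
  assumes "(v, t) \<in> hidden_edges\<^sup>+" "reach t True n" "t \<in> X \<union> S \<union> Z"
  shows "reach v False True"
  using assms(1)
proof (induction rule: converse_trancl_induct)
  case (base v)
  then show ?case using collide[OF assms(2,3)] by (auto simp: E_from_def)
next
  case (step v u)
  have "u \<notin> X \<union> Y \<union> S \<union> Z" using step E_from_source by blast
  then show ?case using step backward[of u True v] by (auto simp: E_from_def)
qed

lemma desc_not_Z: "x \<in> X \<Longrightarrow> (x, v) \<in> E\<^sup>* \<Longrightarrow> v \<notin> Z"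
  using Z_nondesc by (auto simp: De_def)

text \<open>The first edge is kept apart because its source \<open>x\<close> may lie in
  \<open>Q\<close>. Index \<open>s\<close> marks the intermediate node \<open>c\<close>.\<close>

lemma directed_walk:
  assumes "(x, v) \<in> E" "(v, c) \<in> (E_from Q)\<^sup>*" "(c, b) \<in> (E_from Q)\<^sup>*"
  obtains m w s where "0 < s" "s \<le> m" "w 0 = x" "w s = c" "w m = b"
    "\<And>i. i < m \<Longrightarrow> (w i, w (Suc i)) \<in> E" "\<And>i. 0 < i \<Longrightarrow> i < m \<Longrightarrow> w i \<notin> Q"
proof -
  obtain p f where f: "f 0 = v" "f p = c" "\<And>i. i < p \<Longrightarrow> (f i, f (Suc i)) \<in> E_from Q"
    using assms(2) unfolding rtrancl_power relpow_fun_conv by blast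
  obtain q g where g: "g 0 = c" "g q = b" "\<And>i. i < q \<Longrightarrow> (g i, g (Suc i)) \<in> E_from Q"
    using assms(3) unfolding rtrancl_power relpow_fun_conv by blast
  define w where "w i = (if i = 0 then x else if i \<le> Suc p then f (i - 1) else g (i - Suc p))" for i
  have w_g: "w (Suc p + j) = g j" for j using f g by (cases "j = 0") (auto simp: w_def)
  have w_f: "w (Suc j) = f j" if "j \<le> p" for j using that by (auto simp: w_def)
  have step: "(w i, w (Suc i)) \<in> E_from Q" if i: "0 < i" "i < Suc p + q" for i
  proof (cases "i \<le> p")
    case True
    then obtain j where "i = Suc j" using i by (cases i) auto
    then show ?thesis using True w_f[of j] w_f[of "Suc j"] f(3)[of j] by simp
  next
    case False
    then obtain j where j: "i = Suc p + j" using le_Suc_ex[of "Suc p" i] by auto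
    then show ?thesis using i w_g[of j] w_g[of "Suc j"] g(3)[of j] by simp
  qed
  show thesis
  proof (rule that[of "Suc p" "Suc p + q" w])
    show "w 0 = x" "w (Suc p) = c" "w (Suc p + q) = b"
      using w_g[of q] w_f[of p] f g by (auto simp: w_def)
    show "(w i, w (Suc i)) \<in> E" if "i < Suc p + q" for i
    proof (cases "i = 0")
      case True
      then show ?thesis using assms(1) w_f[of 0] f by (simp add: w_def)
    next
      case False
      then show ?thesis using step[of i] that by (auto simp: E_from_def)
    qed
    show "w i \<notin> Q" if "0 < i" "i < Suc p + q" for i
      using step[OF that] by (auto simp: E_from_def)
  qed auto
qed

lemma directed_walk_reach:
  assumes "\<And>i. i < m \<Longrightarrow> (w i, w (Suc i)) \<in> E" "i \<le> j" "j \<le> m"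
  shows "(w i, w j) \<in> E\<^sup>*"
  using assms(2,3)
proof (induction j rule: dec_induct)
  case (step n)
  then show ?case using assms(1)[of n] by (auto intro: rtrancl_into_rtrancl)
qed simp

lemma no_directed_walk_through_S:
  assumes "x \<in> X" "(x, v) \<in> E" "(v, s) \<in> (E_from (X \<union> Y))\<^sup>*" "(s, y) \<in> (E_from (X \<union> Y))\<^sup>*"
    and "s \<in> S" "y \<in> Y"
  shows False
proof -
  obtain m w r where w: "0 < r" "r \<le> m" "w 0 = x" "w r = s" "w m = y"
    "\<And>i. i < m \<Longrightarrow> (w i, w (Suc i)) \<in> E" "\<And>i. 0 < i \<Longrightarrow> i < m \<Longrightarrow> w i \<notin> X \<union> Y"
    using directed_walk[OF assms(2,3,4)] by metis
  have "r \<noteq> m" using w assms disj by auto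
  interpret adjustment_chain V E X Y Z S m w
    by unfold_locales (use w in auto)
  show False
  proof (rule no_causal_chain_through_S[of r])
    show "w i \<notin> X \<union> Y \<union> Z" if "0 < i" "i < m" for i
      using w(7)[OF that] desc_not_Z[OF assms(1)] directed_walk_reach[of m w 0 i] w(3,6) that by auto
  qed (use w assms \<open>r \<noteq> m\<close> in auto)
qed

lemma no_directed_walk_through_Y:
  assumes "x \<in> X" "(x, v) \<in> E" "(v, y) \<in> (E_from (X \<union> S))\<^sup>*" "(y, t) \<in> (E_from (X \<union> S))\<^sup>*"
    and "y \<in> Y" "t \<in> X \<union> S"
  shows False
proof -
  obtain m w r where w: "0 < r" "r \<le> m" "w 0 = x" "w r = y" "w m = t"
    "\<And>i. i < m \<Longrightarrow> (w i, w (Suc i)) \<in> E" "\<And>i. 0 < i \<Longrightarrow> i < m \<Longrightarrow> w i \<notin> X \<union> S"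
    using directed_walk[OF assms(2,3,4)] by metis
  have "r \<noteq> m" using w assms disj by auto
  interpret adjustment_chain V E X Y Z S m w
    by unfold_locales (use w in auto)
  show False
  proof (rule no_causal_chain_through_Y[of r])
    show "w i \<notin> X \<union> S \<union> Z" if "0 < i" "i < m" for i
      using w(7)[OF that] desc_not_Z[OF assms(1)] directed_walk_reach[of m w 0 i] w(3,6) that by auto
  qed (use w assms \<open>r \<noteq> m\<close> in auto)
qed

text \<open>A directed walk in a DAG cannot repeat a node, so it is already a path; at its last node
  properness follows from \<open>X\<close> and \<open>Y\<close> being disjoint.\<close>

lemma mediatorI:
  assumes "x \<in> X" "(x, v) \<in> E" "(v, c) \<in> (E_from X)\<^sup>*" "(c, y) \<in> (E_from X)\<^sup>*" "y \<in> Y"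
  shows "c \<in> mediators E X Y"
proof -
  obtain m w r where w: "0 < r" "r \<le> m" "w 0 = x" "w r = c" "w m = y"
    "\<And>i. i < m \<Longrightarrow> (w i, w (Suc i)) \<in> E" "\<And>i. 0 < i \<Longrightarrow> i < m \<Longrightarrow> w i \<notin> X"
    using directed_walk[OF assms(2,3,4)] by metis
  let ?p = "map w [0..<Suc m]"
  have nth: "?p ! i = w i" if "i \<le> m" for i using that by (simp del: upt_Suc)
  have "w i \<noteq> w j" if "i < j" "j \<le> m" for i j
  proof
    assume eq: "w i = w j"
    have "(w i, w (Suc i)) \<in> E" using w(6) that by simp
    moreover have "(w (Suc i), w j) \<in> E\<^sup>*"
      by (rule directed_walk_reach[of m]) (use w(6) that in auto)
    ultimately have "(w i, w i) \<in> E\<^sup>+" using eq by auto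
    then show False using DAG by (auto simp: is_DAG_def acyclic_def)
  qed
  then have "inj_on w {0..<Suc m}"
    by (intro linorder_inj_onI) auto
  then have "distinct ?p" by (simp add: distinct_map del: upt_Suc)
  then have "is_path E ?p"
    using w(6) by (auto simp: is_path_def adjacent_def nth simp del: upt_Suc)
  moreover have "hd ?p \<in> X" using w(3) assms(1) by (simp add: hd_map del: upt_Suc)
  moreover have "last ?p \<in> Y" using w(5) assms(5) by simp
  moreover have "?p ! i \<notin> X" if "0 < i" "i < length ?p" for i
    using that w(5,7) assms(5) disj nth[of i] by (cases "i = m") (auto simp del: upt_Suc)
  moreover have "causal_path E ?p"
    using w(6) by (auto simp: causal_path_def nth simp del: upt_Suc)
  ultimately have "proper_path E X Y ?p \<and> causal_path E ?p"
    by (auto simp: proper_path_def path_from_to_def simp del: upt_Suc)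
  moreover have "?p ! r = c" "r < length ?p" using w nth[of r] by (auto simp del: upt_Suc)
  ultimately show ?thesis unfolding mediators_def using w(1) by blast
qed

section \<open>The two conditions of the criterion\<close>

lemma directed_segment:
  assumes "i \<le> j" "\<And>l. i \<le> l \<Longrightarrow> l < j \<Longrightarrow> (p ! l, p ! Suc l) \<in> E"
    and "\<And>l. i \<le> l \<Longrightarrow> l < j \<Longrightarrow> p ! l \<notin> Q"
  shows "(p ! i, p ! j) \<in> (E_from Q)\<^sup>*"
  using assms
proof (induction j rule: dec_induct)
  case (step n)
  then have "(p ! n, p ! Suc n) \<in> E_from Q" by (simp add: E_from_def)
  moreover have "(p ! i, p ! n) \<in> (E_from Q)\<^sup>*" using step by simp
  ultimately show ?case by (rule rtrancl_into_rtrancl[rotated])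
qed simp

text \<open>Descendants of \<open>X\<close> are never in \<open>Z\<close>, so \<open>Y\<close> is
  the only kind of visible node that such a path can still pass through.\<close>

lemma hidden_or_through_Y:
  assumes "(a, t) \<in> (E_from (X \<union> S))\<^sup>+" "x \<in> X" "(x, a) \<in> E\<^sup>*"
  shows "(a, t) \<in> hidden_edges\<^sup>+ \<or>
    (\<exists>y\<in>Y. (a, y) \<in> (E_from (X \<union> S))\<^sup>* \<and> (y, t) \<in> (E_from (X \<union> S))\<^sup>*)"
  using assms(1,3)
proof (induction rule: converse_trancl_induct)
  case (base a)
  show ?case
  proof (cases "a \<in> Y")
    case True
    then show ?thesis using base by blast
  next
    case False
    then have "(a, t) \<in> hidden_edges" using base desc_not_Z[OF assms(2)] by (auto simp: E_from_def)
    then show ?thesis by blast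
  qed
next
  case (step a b)
  show ?case
  proof (cases "a \<in> Y")
    case True
    moreover have "(a, t) \<in> (E_from (X \<union> S))\<^sup>*"
      using step by (meson converse_rtrancl_into_rtrancl trancl_into_rtrancl)
    ultimately show ?thesis by blast
  next
    case False
    then have ab: "(a, b) \<in> hidden_edges" using step desc_not_Z[OF assms(2)] by (auto simp: E_from_def)
    have "(x, b) \<in> E\<^sup>*" using step by (auto simp: E_from_def intro: rtrancl_into_rtrancl)
    with step.IH consider "(b, t) \<in> hidden_edges\<^sup>+"
      | y where "y \<in> Y" "(b, y) \<in> (E_from (X \<union> S))\<^sup>*" "(y, t) \<in> (E_from (X \<union> S))\<^sup>*" by blast
    then show ?thesis
    proof cases
      case 1
      then show ?thesis using ab by (meson trancl_into_trancl2)
    next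
      case 2
      then show ?thesis using step(1) by (meson converse_rtrancl_into_rtrancl)
    qed
  qed
qed

text \<open>A proper path may visit \<open>Y\<close> before its end, whereas the interior of an open
  walk may not; so paths are cut at the first visit.\<close>

lemma first_Y:
  assumes "proper_path E X Y p"
  obtains k where "0 < k" "k < length p" "p ! k \<in> Y" "\<And>j. j < k \<Longrightarrow> p ! j \<notin> Y" "p ! 0 \<in> X"
    "\<And>j. 0 < j \<Longrightarrow> j < length p \<Longrightarrow> p ! j \<notin> X"
    "\<And>j. Suc j < length p \<Longrightarrow> (p ! j, p ! Suc j) \<in> E \<or> (p ! Suc j, p ! j) \<in> E"
proof -
  have ne: "p \<noteq> []" and ends: "p ! 0 \<in> X" "p ! (length p - 1) \<in> Y"
    using assms by (auto simp: proper_path_def path_from_to_def is_path_def hd_conv_nth last_conv_nth)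
  define k where "k = (LEAST k. p ! k \<in> Y)"
  have k: "p ! k \<in> Y" "k \<le> length p - 1"
    unfolding k_def by (rule LeastI[of "\<lambda>k. p ! k \<in> Y", OF ends(2)], rule Least_le, rule ends(2))
  have "0 < k" using k ends disj by (cases k) auto
  moreover have "k < length p" using k ne by (cases p) auto
  moreover have "p ! j \<notin> Y" if "j < k" for j using that not_less_Least unfolding k_def by blast
  ultimately show thesis
    using that k ends assms
    by (auto simp: proper_path_def path_from_to_def is_path_def adjacent_def)
qed

text \<open>A forbidden node of \<open>S\<close> yields a descent from a causal path. If the path
  passes \<open>S\<close>, or the descent passes \<open>Y\<close>, a directed chain refutes
  adjustment. Otherwise the descent can be walked down and up again before continuing to
  \<open>Y\<close>, which gives an open non-causal walk.\<close>

lemma S_avoids_Forb: "S \<inter> Forb E X Y = {}"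
proof (rule ccontr)
  assume "S \<inter> Forb E X Y \<noteq> {}"
  then obtain s m0 where s: "s \<in> S" "m0 \<in> mediators E X Y" "(m0, s) \<in> E\<^sup>*"
    by (auto simp: Forb_def De_def)
  then obtain p i0 where p: "proper_path E X Y p" "causal_path E p" "0 < i0" "i0 < length p" "p ! i0 = m0"
    by (auto simp: mediators_def)
  obtain k where k: "0 < k" "k < length p" "p ! k \<in> Y" "\<And>j. j < k \<Longrightarrow> p ! j \<notin> Y"
    and X0: "p ! 0 \<in> X" and Xj: "\<And>j. 0 < j \<Longrightarrow> j < length p \<Longrightarrow> p ! j \<notin> X"
    using first_Y[OF p(1)] by metis
  have edge: "(p ! j, p ! Suc j) \<in> E" if "Suc j < length p" for j
    using p(2) that by (simp add: causal_path_def)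
  have e01: "(p ! 0, p ! 1) \<in> E" using edge[of 0] k by simp
  have desc: "(p ! i, p ! j) \<in> E\<^sup>*" if "i \<le> j" "j < length p" for i j
    using directed_segment[of i j p "{}"] edge that E_from_sub by fastforce
  have seg: "(p ! i, p ! j) \<in> (E_from Q)\<^sup>*" if "0 < i" "i \<le> j" "j \<le> k"
    "\<And>l. 0 < l \<Longrightarrow> l < k \<Longrightarrow> p ! l \<notin> Q" for i j Q
    by (rule directed_segment) (use that edge k in auto)
  have no_S: "p ! j \<notin> S" if "0 < j" "j < k" for j
  proof
    assume "p ! j \<in> S"
    moreover have "(p ! 1, p ! j) \<in> (E_from (X \<union> Y))\<^sup>*" "(p ! j, p ! k) \<in> (E_from (X \<union> Y))\<^sup>*"
      using that k Xj by (auto intro!: seg)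
    ultimately show False using no_directed_walk_through_S[OF X0 e01] k by blast
  qed
  \<comment> \<open>A mediator beyond the first visit to \<open>Y\<close> is replaced by that visit,
    from which it descends.\<close>
  define i where "i = min i0 k"
  have i: "0 < i" "i \<le> k" using p k by (auto simp: i_def)
  have "(p ! i, s) \<in> E\<^sup>*"
    using desc[of i i0] p s by (auto simp: i_def intro: rtrancl_trans)
  \<comment> \<open>Another node of \<open>X\<close> may be met before \<open>s\<close>; it serves
    equally well as the lower end of the descent.\<close>
  then obtain t where t: "t \<in> X \<union> S" "(p ! i, t) \<in> (E_from (X \<union> S))\<^sup>*"
    using first_hit[of "p ! i" s "X \<union> S"] s by auto
  have "p ! i \<notin> X \<union> S"
    using i k Xj[of i] no_S[of i] disj by (cases "i = k") auto
  then have "p ! i \<noteq> t" using t by auto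
  then have ti: "(p ! i, t) \<in> (E_from (X \<union> S))\<^sup>+" using t by (auto dest: rtranclD)
  have p1i: "(p ! 1, p ! i) \<in> (E_from (X \<union> S))\<^sup>*"
    using i k Xj no_S by (intro seg) auto
  have "(p ! 0, p ! i) \<in> E\<^sup>*" using desc[of 0 i] i k by simp
  from hidden_or_through_Y[OF ti X0 this] show False
  proof
    assume "\<exists>y\<in>Y. (p ! i, y) \<in> (E_from (X \<union> S))\<^sup>* \<and> (y, t) \<in> (E_from (X \<union> S))\<^sup>*"
    then obtain y where y: "y \<in> Y" "(p ! i, y) \<in> (E_from (X \<union> S))\<^sup>*" "(y, t) \<in> (E_from (X \<union> S))\<^sup>*" by blast
    show False
      by (rule no_directed_walk_through_Y[OF X0 e01 rtrancl_trans[OF p1i y(2)] y(3,1) t(1)])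
  next
    assume h: "(p ! i, t) \<in> hidden_edges\<^sup>+"
    then have "p ! i \<notin> Y" using E_from_source by blast
    then have "i \<noteq> k" using k by auto
    then have ik: "i < k" using i by simp
    have hid: "p ! l \<notin> X \<union> Y \<union> S \<union> Z" if "0 < l" "l < k" for l
      using that Xj[of l] k(2,4) no_S[of l] desc_not_Z[OF X0 desc[of 0 l]] by auto
    have r1: "reach (p ! 1) True False" by (rule start_fwd[OF X0 e01])
    have ri: "reach (p ! i) True False"
    proof (cases "p ! 1 = p ! i")
      case False
      have "(p ! 1, p ! i) \<in> hidden_edges\<^sup>*" using i hid by (intro seg) auto
      then show ?thesis using False reach_down[OF r1] by (auto dest: rtranclD)
    qed (use r1 in simp)
    have "reach (p ! i) False True"
      using reach_up[OF h reach_down[OF ri h]] t(1) by blast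
    moreover have "(p ! i, p ! k) \<in> hidden_edges\<^sup>*" using ik i hid by (intro seg) auto
    then have "(p ! i, p ! k) \<in> hidden_edges\<^sup>+"
      using \<open>p ! i \<notin> Y\<close> k(3) by (auto dest: rtranclD)
    ultimately show False using reach_down no_open_noncausal_walk k(3) by blast
  qed
qed

text \<open>Follow the path to its first visit to \<open>Y\<close>, with a detour at each collider
  that is outside \<open>S \<union> Z\<close> but has a descendant there. Where this gives no open
  non-causal walk, a causal piece makes a node of \<open>S\<close> forbidden, contrary to the first
  condition.\<close>

lemma noncausal_paths_blocked:
  assumes p: "proper_path E X Y p" "\<not> causal_path E p"
  shows "blocked E (S \<union> Z) p"
proof (rule ccontr)
  assume "\<not> blocked E (S \<union> Z) p"
  then have open_at: "0 < j \<Longrightarrow> Suc j < length p \<Longrightarrow>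
      if collider E p j then De E {p ! j} \<inter> (S \<union> Z) \<noteq> {} else p ! j \<notin> S \<union> Z" for j
    unfolding blocked_def d_connecting_def by blast
  obtain k where k: "0 < k" "k < length p" "p ! k \<in> Y" "\<And>j. j < k \<Longrightarrow> p ! j \<notin> Y"
    and X0: "p ! 0 \<in> X" and Xj: "\<And>j. 0 < j \<Longrightarrow> j < length p \<Longrightarrow> p ! j \<notin> X"
    and edge: "\<And>j. Suc j < length p \<Longrightarrow> (p ! j, p ! Suc j) \<in> E \<or> (p ! Suc j, p ! j) \<in> E"
    using first_Y[OF p(1)] by metis
  have fwd_seg: "(p ! 1, p ! j) \<in> (E_from X)\<^sup>* \<and> (p ! 0, p ! 1) \<in> E \<and> (p ! 0, p ! j) \<in> E\<^sup>*"
    if "0 < j" "j < length p" "\<And>i. i < j \<Longrightarrow> (p ! i, p ! Suc i) \<in> E" for j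
  proof (intro conjI)
    show "(p ! 1, p ! j) \<in> (E_from X)\<^sup>*"
      by (rule directed_segment) (use that Xj in auto)
    show "(p ! 0, p ! 1) \<in> E" using that(3)[of 0] that(1) by simp
    have "(p ! 0, p ! j) \<in> (E_from {})\<^sup>*"
      by (rule directed_segment) (use that in auto)
    then show "(p ! 0, p ! j) \<in> E\<^sup>*" using E_from_sub by blast
  qed
  have S_desc: "s \<in> S" if "(p ! 0, c) \<in> E\<^sup>*" "s \<in> De E {c}" "s \<in> S \<union> Z" for s c
    using that desc_not_Z[OF X0, of s] by (auto simp: De_def intro: rtrancl_trans)
  have not_forb: False if "c \<in> mediators E X Y" "(c, s) \<in> E\<^sup>*" "s \<in> S" for c s
    using S_avoids_Forb that by (auto simp: Forb_def De_def)
  \<comment> \<open>Cutting at \<open>p ! k\<close> might lose all backward edges. Then the first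
    one leaves an open collider that descends from \<open>p ! k\<close>; since \<open>p ! k\<close>
    is a mediator, the node of \<open>S\<close> opening this collider would be forbidden.\<close>
  have bwd: "\<exists>i<k. (p ! Suc i, p ! i) \<in> E"
  proof (rule ccontr)
    assume no: "\<not> (\<exists>i<k. (p ! Suc i, p ! i) \<in> E)"
    define l where "l = (LEAST l. Suc l < length p \<and> (p ! l, p ! Suc l) \<notin> E)"
    obtain l0 where "Suc l0 < length p \<and> (p ! l0, p ! Suc l0) \<notin> E"
      using p(2) by (auto simp: causal_path_def)
    then have l: "Suc l < length p" "(p ! l, p ! Suc l) \<notin> E"
      using LeastI[of "\<lambda>l. Suc l < length p \<and> (p ! l, p ! Suc l) \<notin> E" l0] by (simp_all add: l_def)
    have before: "(p ! i, p ! Suc i) \<in> E" if "i < l" for i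
      using not_less_Least[of i "\<lambda>l. Suc l < length p \<and> (p ! l, p ! Suc l) \<notin> E"] that l(1)
      by (simp add: l_def)
    have "k \<le> l" using l edge[of l] no by (meson not_le)
    then have l0: "0 < l" using k by simp
    have "collider E p l"
      using l l0 edge[of l] before[of "l - 1"] by (auto simp: collider_def)
    then obtain s where s: "s \<in> De E {p ! l}" "s \<in> S \<union> Z"
      using open_at[OF l0 l(1)] by auto
    have "s \<in> S" using S_desc s fwd_seg[of l] l l0 before by auto
    have pk: "(p ! 1, p ! k) \<in> (E_from X)\<^sup>*" "(p ! 0, p ! 1) \<in> E"
      using fwd_seg[of k] k before \<open>k \<le> l\<close> by auto
    then have "p ! k \<in> mediators E X Y"
      using mediatorI[OF X0 _ _ _ k(3)] by blast
    moreover have "(p ! k, p ! l) \<in> (E_from {})\<^sup>*"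
      by (rule directed_segment) (use \<open>k \<le> l\<close> before in auto)
    then have "(p ! k, s) \<in> E\<^sup>*"
      using s E_from_sub by (auto simp: De_def intro: rtrancl_trans)
    ultimately show False using not_forb \<open>s \<in> S\<close> by blast
  qed
  have "j < k \<Longrightarrow> reach (p ! Suc j) ((p ! j, p ! Suc j) \<in> E) (\<exists>i\<le>j. (p ! Suc i, p ! i) \<in> E)" for j
  proof (induction j)
    case 0
    have "Suc 0 < length p" using k by simp
    from edge[OF this] show ?case
    proof
      assume "(p ! 0, p ! Suc 0) \<in> E"
      then show ?thesis using start_fwd[OF X0] edge_asym by simp
    next
      assume "(p ! Suc 0, p ! 0) \<in> E"
      then show ?thesis using start_bwd[OF X0] edge_asym by simp
    qed
  next
    case (Suc j)
    let ?c = "p ! Suc j" and ?d = "p ! Suc (Suc j)"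
    let ?n = "\<exists>i\<le>j. (p ! Suc i, p ! i) \<in> E"
    have IH: "reach ?c ((p ! j, ?c) \<in> E) ?n" using Suc by simp
    have len: "Suc (Suc j) < length p" using Suc.prems k by simp
    have cXY: "?c \<notin> X" "?c \<notin> Y" using Xj[of "Suc j"] k(4)[of "Suc j"] Suc.prems len by auto
    have n_True: "(\<exists>i\<le>Suc j. (p ! Suc i, p ! i) \<in> E) = True" if "(?d, ?c) \<in> E"
      using that by auto
    have n_eq: "(\<exists>i\<le>Suc j. (p ! Suc i, p ! i) \<in> E) = ?n" if "(?d, ?c) \<notin> E"
      using that by (auto simp: le_Suc_eq)
    show ?case
    proof (cases "(?d, ?c) \<in> E")
      case False
      then have e: "(?c, ?d) \<in> E" using edge[OF len] by blast
      have "\<not> collider E p (Suc j)" using False by (simp add: collider_def)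
      then have "?c \<notin> S \<union> Z" using open_at[of "Suc j"] len by simp
      then have "reach ?d True ?n" using through[OF IH _ e] cXY by auto
      then show ?thesis using n_eq[OF False] e by simp
    next
      case True
      then have ne: "(?c, ?d) \<notin> E" using edge_asym by blast
      have "reach ?d False True"
      proof (cases "(p ! j, ?c) \<in> E")
        case False
        then have "\<not> collider E p (Suc j)" by (simp add: collider_def)
        then have "?c \<notin> S \<union> Z" using open_at[of "Suc j"] len by simp
        then show ?thesis using backward[of ?c ?n ?d] IH False True cXY by auto
      next
        case into: True
        then have r: "reach ?c True ?n" using IH by simp
        show ?thesis
        proof (cases "?c \<in> S \<union> Z")
          case cSZ: True
          then show ?thesis using collide[OF r _ True] by blast
        next
          case cSZ: False
          have "collider E p (Suc j)" using into True len by (simp add: collider_def)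
          then obtain s where s: "s \<in> De E {?c}" "s \<in> S \<union> Z"
            using open_at[of "Suc j"] len by auto
          let ?T = "X \<union> Y \<union> S \<union> Z"
          obtain t where t: "t \<in> ?T" "(?c, t) \<in> hidden_edges\<^sup>*"
            using first_hit[of ?c s ?T] s by (auto simp: De_def)
          have "?c \<noteq> t" using t cSZ cXY by auto
          then have tp: "(?c, t) \<in> hidden_edges\<^sup>+" using t by (auto dest: rtranclD)
          have rt: "reach t True ?n" by (rule reach_down[OF r tp])
          \<comment> \<open>If the first visible node \<open>t\<close> below the collider is in
            \<open>Y\<close>, no detour exists, but a walk to \<open>Y\<close> does. With a backward
            edge it is refuted directly; without one the path so far is causal, the collider is a
            mediator and \<open>s\<close> is forbidden.\<close>
          show ?thesis
          proof (cases "t \<in> Y")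
            case False
            then have "reach ?c False True" using reach_up[OF tp rt] t by blast
            then show ?thesis using backward[of ?c True ?d] cSZ cXY True by auto
          next
            case tY: True
            show ?thesis
            proof (cases ?n)
              case True
              then show ?thesis using no_open_noncausal_walk[of t True] rt tY by simp
            next
              case False
              have before: "(p ! i, p ! Suc i) \<in> E" if "i < Suc j" for i
                using edge[of i] False that len by auto
              have seg: "(p ! 1, ?c) \<in> (E_from X)\<^sup>*" "(p ! 0, p ! 1) \<in> E" "(p ! 0, ?c) \<in> E\<^sup>*"
                using fwd_seg[of "Suc j"] before len by auto
              have "(?c, t) \<in> (E_from X)\<^sup>*"
                using t(2) rtrancl_mono[OF E_from_mono[of X ?T]] by blast
              then have "?c \<in> mediators E X Y" using mediatorI[OF X0 seg(2,1) _ tY] by blast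
              moreover have "s \<in> S" using S_desc[OF seg(3) s] .
              ultimately show ?thesis using not_forb s(1) by (auto simp: De_def)
            qed
          qed
        qed
      qed
      then show ?thesis using n_True[OF True] ne by simp
    qed
  qed
  from this[of "k - 1"] k(1) have "reach (p ! k) ((p ! (k - 1), p ! k) \<in> E) (\<exists>i\<le>k - 1. (p ! Suc i, p ! i) \<in> E)"
    by simp
  moreover have "\<exists>i\<le>k - 1. (p ! Suc i, p ! i) \<in> E" 
  proof -
    obtain i where "i < k" "(p ! Suc i, p ! i) \<in> E" using bwd by blast
    then show ?thesis by (intro exI[of _ i]) auto
  qed
  ultimately show False using no_open_noncausal_walk[OF _ k(3)] by simp
qed

end

theorem mainTheorem10:
  assumes "is_DAG V E"
    and "X \<subseteq> V" and "Y \<subseteq> V" and "Z \<subseteq> V" and "S \<subseteq> V"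
    and "X \<inter> Y = {}" and "X \<inter> Z = {}" and "X \<inter> S = {}"
    and "Y \<inter> Z = {}" and "Y \<inter> S = {}" and "Z \<inter> S = {}"
    and "Z \<inter> De E X = {}"
    and "cond_adj_set V E X Y Z S"
  shows "cond_adj_criterion E X Y Z S"
proof -
  interpret adjustment_setting V E X Y Z S
    by unfold_locales (use assms in auto)
  show ?thesis
    unfolding cond_adj_criterion_def
    using S_avoids_Forb noncausal_paths_blocked by blast
qed

end
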